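(* Let $d\ge1$ and let $\mathbf X=(X_t)_{t\ge0}$ be an isotropic unimodal Lévy process on $\mathbb R^d$ with characteristic exponent $\psi$, transition density $p(t,\cdot)$ and Lévy density $\nu$. Then the following are equivalent: (i) $\psi\in\mathcal R^\infty_\alpha$ for some $\alpha\in(0,2)$; (ii) there is $c>0$ such that $$\lim_{\substack{x\to0\\ t\psi(|x|^{-1})\to0}}\frac{p(t,x)}{|x|^{-d}\,t\,\psi(|x|^{-1})}=c;$$ (iii) there is $c>0$ such that $$\lim_{x\to0}\frac{\nu(x)}{|x|^{-d}\,\psi(|x|^{-1})}=c.$$
   Context: An isotropic Lévy process in $\mathbb R^d$ is a Lévy process $\mathbf X=(X_t)_{t\ge0}$ with $X_0=0$ a.s. such that each $X_t$ has a rotationally invariant distribution $p(t,dx)$. Its Lévy–Khintchine (characteristic) exponent $\psi$ is defined by $\int_{\mathbb R^d}e^{i\langle\xi,x\rangle}p(t,dx)=e^{-t\psi(\xi)}$, with $\psi(\xi)=\int_{\mathbb R^d}(1-\cos\langle\xi,x\rangle)\,\nu(dx)+\eta|\xi|^2$, where $\eta\ge0$ and $\nu$ is a rotationally invariant Lévy measure. The function $\psi$ is radial and one writes $\psi(r)=\psi(\xi)$ for $r=|\xi|$. A Borel measure is isotropic unimodal if it is absolutely continuous on $\mathbb R^d\setminus\{0\}$ with a radial, radially non-increasing density. $\mathbf X$ is isotropic unimodal if $p(t,dx)$ is isotropic unimodal for every $t>0$ (equivalently, by a theorem of Watanabe, if its Lévy measure is isotropic unimodal); $p(t,x)$ and $\nu(x)$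 denote the radial, radially non-increasing densities on $\mathbb R^d\setminus\{0\}$ of $p(t,dx)$ and of the Lévy measure. Regular variation: a function $f$, positive on some $[x_0,+\infty)$ with $x_0>0$, is in $\mathcal R^\infty_\alpha$ (regularly varying of index $\alpha$ at infinity) if $f(\lambda x)/f(x)\to\lambda^\alpha$ as $x\to+\infty$ for each $\lambda>0$. The condition $\psi\in\mathcal R^\infty_\alpha$ refers to $r\mapsto\psi(r)$. The joint limit in (ii) means: for every $\varepsilon>0$ there is $\delta>0$ such that the quotient is within $\varepsilon$ of the limit for all $t>0$ and all $x$ with $0<|x|\le\delta$ and $t\psi(|x|^{-1})\le\delta$. *)

theory Defs
  imports "HOL-Probability.Probability"
begin

(* Processes are indexed by real times, but only their values at times t >= 0 matter.
   The state space is an arbitrary Euclidean space, of dimension d = DIM('a) >= 1. *)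

definition independent_increments :: "'s measure \<Rightarrow> (real \<Rightarrow> 's \<Rightarrow> 'a::euclidean_space) \<Rightarrow> bool" where
  "independent_increments M X \<longleftrightarrow>
     (\<forall>(n::nat) \<tau>. 0 \<le> \<tau> 0 \<and> (\<forall>i<n. \<tau> i \<le> \<tau> (Suc i)) \<longrightarrow>
        prob_space.indep_vars M (\<lambda>_. borel) (\<lambda>i \<omega>. X (\<tau> (Suc i)) \<omega> - X (\<tau> i) \<omega>) {..<n})"

definition stationary_increments :: "'s measure \<Rightarrow> (real \<Rightarrow> 's \<Rightarrow> 'a::euclidean_space) \<Rightarrow> bool" where
  "stationary_increments M X \<longleftrightarrow>
     (\<forall>s\<ge>0. \<forall>t\<ge>0. distr M borel (\<lambda>\<omega>. X (s + t) \<omega> - X s \<omega>) = distr M borel (\<lambda>\<omega>. X t \<omega> - X 0 \<omega>))"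

definition stochastically_continuous :: "'s measure \<Rightarrow> (real \<Rightarrow> 's \<Rightarrow> 'a::euclidean_space) \<Rightarrow> bool" where
  "stochastically_continuous M X \<longleftrightarrow>
     (\<forall>t\<ge>0. \<forall>\<epsilon>>0.
        ((\<lambda>s. measure M {\<omega> \<in> space M. norm (X s \<omega> - X t \<omega>) > \<epsilon>}) \<longlongrightarrow> 0) (at t within {0..}))"

definition cadlag_path :: "(real \<Rightarrow> 'a::euclidean_space) \<Rightarrow> bool" where
  "cadlag_path f \<longleftrightarrow>
     (\<forall>t\<ge>0. continuous (at_right t) f) \<and> (\<forall>t>0. \<exists>l. (f \<longlongrightarrow> l) (at_left t))"

definition levy_process :: "'s measure \<Rightarrow> (real \<Rightarrow> 's \<Rightarrow> 'a::euclidean_space) \<Rightarrow> bool" where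
  "levy_process M X \<longleftrightarrow>
     prob_space M \<and> (\<forall>t\<ge>0. X t \<in> borel_measurable M) \<and>
     (AE \<omega> in M. X 0 \<omega> = 0) \<and>
     independent_increments M X \<and> stationary_increments M X \<and>
     stochastically_continuous M X \<and> (AE \<omega> in M. cadlag_path (\<lambda>t. X t \<omega>))"

(* Invariance under the full orthogonal group O(d); for d >= 2 this agrees with invariance
   under SO(d), while for d = 1 it means symmetry. *)
definition rotation_invariant :: "'a::euclidean_space measure \<Rightarrow> bool" where
  "rotation_invariant \<mu> \<longleftrightarrow> (\<forall>g. orthogonal_transformation g \<longrightarrow> distr \<mu> borel g = \<mu>)"

(* Monotonicity in the norm makes f radial away from 0, since vectors of equal norm can be
   compared both ways.  The measure may have an atom (or infinite mass near) 0, and the value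
   f 0 is irrelevant. *)
definition isotropic_unimodal_density ::
  "'a::euclidean_space measure \<Rightarrow> ('a \<Rightarrow> real) \<Rightarrow> bool" where
  "isotropic_unimodal_density \<mu> f \<longleftrightarrow>
     f \<in> borel_measurable borel \<and>
     (\<forall>x. x \<noteq> 0 \<longrightarrow> 0 \<le> f x) \<and>
     (\<forall>x y. x \<noteq> 0 \<and> norm x \<le> norm y \<longrightarrow> f y \<le> f x) \<and>
     (\<forall>A \<in> sets borel. 0 \<notin> A \<longrightarrow> emeasure \<mu> A = (\<integral>\<^sup>+x\<in>A. ennreal (f x) \<partial>lborel))"

definition isotropic_unimodal :: "'a::euclidean_space measure \<Rightarrow> bool" where
  "isotropic_unimodal \<mu> \<longleftrightarrow> sets \<mu> = sets borel \<and> (\<exists>f. isotropic_unimodal_density \<mu> f)"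

definition isotropic_levy_process :: "'s measure \<Rightarrow> (real \<Rightarrow> 's \<Rightarrow> 'a::euclidean_space) \<Rightarrow> bool" where
  "isotropic_levy_process M X \<longleftrightarrow>
     levy_process M X \<and> (\<forall>t\<ge>0. rotation_invariant (distr M borel (X t)))"

definition isotropic_unimodal_levy_process ::
  "'s measure \<Rightarrow> (real \<Rightarrow> 's \<Rightarrow> 'a::euclidean_space) \<Rightarrow> bool" where
  "isotropic_unimodal_levy_process M X \<longleftrightarrow>
     isotropic_levy_process M X \<and> (\<forall>t>0. isotropic_unimodal (distr M borel (X t)))"

definition levy_measure :: "'a::euclidean_space measure \<Rightarrow> bool" where
  "levy_measure N \<longleftrightarrow>
     sets N = sets borel \<and> emeasure N {0} = 0 \<and>
     (\<integral>\<^sup>+x. ennreal (min 1 ((norm x)\<^sup>2)) \<partial>N) < \<infinity>"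

definition characteristic_exponent ::
  "'s measure \<Rightarrow> (real \<Rightarrow> 's \<Rightarrow> 'a::euclidean_space) \<Rightarrow> ('a \<Rightarrow> real) \<Rightarrow> bool" where
  "characteristic_exponent M X \<psi> \<longleftrightarrow>
     (\<forall>t\<ge>0. \<forall>\<xi>. (\<integral>x. exp (\<i> * complex_of_real (\<xi> \<bullet> x)) \<partial>(distr M borel (X t)))
                 = exp (complex_of_real (- t * \<psi> \<xi>)))"

(* The Levy-Khintchine formula in the isotropic case; it determines \<eta> and N from \<psi>. *)
definition isotropic_levy_khintchine ::
  "('a::euclidean_space \<Rightarrow> real) \<Rightarrow> real \<Rightarrow> 'a measure \<Rightarrow> bool" where
  "isotropic_levy_khintchine \<psi> \<eta> N \<longleftrightarrow>
     \<eta> \<ge> 0 \<and> levy_measure N \<and> rotation_invariant N \<and>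
     (\<forall>\<xi>. \<psi> \<xi> = (\<integral>x. (1 - cos (\<xi> \<bullet> x)) \<partial>N) + \<eta> * (norm \<xi>)\<^sup>2)"

(* For radial f this is the profile r \<mapsto> f x, |x| = r >= 0; the unit vector is immaterial. *)
definition radial_profile :: "('a::euclidean_space \<Rightarrow> real) \<Rightarrow> real \<Rightarrow> real" where
  "radial_profile f r = f (r *\<^sub>R (SOME b. b \<in> Basis))"

definition regularly_varying :: "real \<Rightarrow> (real \<Rightarrow> real) \<Rightarrow> bool" where
  "regularly_varying \<alpha> f \<longleftrightarrow>
     (\<exists>x\<^sub>0>0. \<forall>x\<ge>x\<^sub>0. f x > 0) \<and>
     (\<forall>l>0. ((\<lambda>x. f (l * x) / f x) \<longlongrightarrow> l powr \<alpha>) at_top)"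

end

theory Submission
  imports Defs "HOL-Complex_Analysis.Great_Picard"
begin

text \<open>
Write $\psi(r)$ for the profile of the exponent and $d$ for the dimension.  The three conditions are
linked in the cyclic order (i), (ii), (iii), (i).

From (i) to (ii).  Averaging $e^{-t\psi(s\xi)}$ over a standard Gaussian $\xi$ gives
$\int e^{-s^2|x|^2/2}\,p(t,dx)$, so regular variation of $\psi$ determines, by dominated convergence,
the limits of all the integrals $\int (1 - e^{-k|x|^2/r^2})\,p(t,dx) / (t\psi(1/r))$ with $k$ a natural
number, as $r \to 0$ and $t\psi(1/r) \to 0$.  The limits agree with the same integrals of the isotropic
stable Levy measure.  The numbers $e^{-k|x|^2}$ are the powers of one variable $v = e^{-|x|^2}$ in
$[0,1]$, so the Weierstrass theorem upgrades this to convergence of integrals of bumps supported in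
thin shells (\<open>moment_convergence\<close>).  Since $p(t,\cdot)$ is monotone in the radius, its values are squeezed
between its averages over shells just inside and just outside (\<open>density_quotient_tendsto\<close>).  The
squeeze plays the part of a monotone density theorem.

From (ii) to (iii).  The same convergence, with the scale kept fixed and $t \to 0$, shows that
$p(t,dx)/t$ converges to the Levy measure on bumps.  The two-sided bound (ii) then passes to
averages of $\nu$ over shells, and monotonicity of $\nu$ turns it into a pointwise bound
(\<open>levy_density_asymptotics\<close>).

From (iii) to (i).  Let $H$ be the measure $|x|^{-d}dx$, which is invariant under dilations, and let $e$ be a unit
vector.  Condition (iii) inserted into the Levy-Khintchine formula says that $\psi$ solves, up to relatively
small errors at infinity, the equation
$$ g(l) = c \int (1 - \cos\langle z, e\rangle)\, g(l/|z|)\, H(dz), $$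
a convolution equation in the logarithm of $l$.  Because the kernel has infinite mass against
the powers $|z|^0$ and $|z|^{-2}$, the function $\psi$ is forced to grow strictly faster than a constant
and strictly slower than $r^2$, with uniform bounds (\<open>profile_ratio_le\<close>).  These bounds make the rescaled
functions $\psi(l r_n)/\psi(r_n)$ precompact, and all their limits are positive exact solutions
(\<open>ex_scaling_limit\<close>).

The positive solutions are found by a maximum principle: a nonnegative solution that vanishes
somewhere vanishes identically (\<open>solution_nonneg_zero\<close>).  Let $E$ be the shift $g(l) \mapsto g(2l)$ and let $Q$ be a
polynomial.  If the quotient $Q(E)g(1)/g(1)$ attains its maximum $\theta$ over a compact dilation-invariant
class of positive solutions at $g$, then $\theta g - Q(E)g$ is a nonnegative solution with a zero, so that $Q(E)g = \theta g$.
Taking $Q(E) = E$ produces in every such class a solution $l^\rho$, where $\rho$ is a root of the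
equation $c\kappa(\rho) = 1$ for the Mellin transform $\kappa$ of the kernel.  By convexity there are at most two roots
$\rho_1 \le \rho_2$; choosing for $Q$ the quadratic polynomial with zeros $2^{\rho_1}$ and $2^{\rho_2}$ gives $Q(E)g = 0$ for
all positive solutions, and therefore $g(l) = (1-a) l^{\rho_1} + a l^{\rho_2}$ with $0 \le a \le 1$ (\<open>positive_solutions_eq_powr_mixture\<close>).

It remains to exclude that $a$ depends on the subsequence.  Along such a mixture the quotient
$g(2l)/g(l)$ increases with $l$, strictly if $0 < a < 1$.  Hence a quotient $\psi(2r)/\psi(r)$ that exceeds
a level between $2^{\rho_1}$ and $2^{\rho_2}$ at one large $r$ stays above it from $2r$ on, which forces $a = 1$ for
all limits; if this never happens, then $a = 0$ for all of them (\<open>regularly_varying_if_mixture_limits\<close>).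
\<close>

section \<open>The dilation-invariant measure\<close>

lemma nn_integral_lborel_scaleR:
  fixes f :: "'a::euclidean_space \<Rightarrow> ennreal"
  assumes [measurable]: "f \<in> borel_measurable borel" and a: "a > 0"
  shows "(\<integral>\<^sup>+x. f x \<partial>lborel) = ennreal (a ^ DIM('a)) * (\<integral>\<^sup>+x. f (a *\<^sub>R x) \<partial>lborel)"
proof -
  have "(\<integral>\<^sup>+x. f x \<partial>lborel)
      = (\<integral>\<^sup>+x. f x \<partial>density (distr lborel borel (\<lambda>x. 0 + a *\<^sub>R x)) (\<lambda>_. ennreal (\<bar>a\<bar>^DIM('a))))"
    using lborel_affine[of a "0::'a"] a by simp
  also have "\<dots> = (\<integral>\<^sup>+x. ennreal (a ^ DIM('a)) * f (a *\<^sub>R x) \<partial>lborel)"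
    using a by (simp add: nn_integral_density nn_integral_distr)
  finally show ?thesis by (simp add: nn_integral_cmult)
qed

lemma nn_integral_lborel_translate:
  fixes f :: "'a::euclidean_space \<Rightarrow> ennreal"
  assumes [measurable]: "f \<in> borel_measurable borel"
  shows "(\<integral>\<^sup>+x. f (x + a) \<partial>lborel) = (\<integral>\<^sup>+x. f x \<partial>lborel)"
proof -
  have "(\<integral>\<^sup>+x. f x \<partial>lborel)
      = (\<integral>\<^sup>+x. f x \<partial>density (distr lborel borel (\<lambda>x. a + 1 *\<^sub>R x)) (\<lambda>_. ennreal (\<bar>1\<bar>^DIM('a))))"
    by (subst lborel_affine[of 1 a]) simp_all
  also have "\<dots> = (\<integral>\<^sup>+x. f (x + a) \<partial>lborel)"
    by (subst nn_integral_density, simp, simp, subst nn_integral_distr) (simp_all add: add.commute)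
  finally show ?thesis by simp
qed

text \<open>Up to a constant this is the product of the surface measure of the sphere and of $dr/r$, the Haar
measure of the dilation group.  Integrals of radial functions can be rescaled under it without
polar coordinates.  At $x = 0$ the density takes the value $0$.\<close>

definition dilation_measure :: "'a::euclidean_space measure" where
  "dilation_measure = density lborel (\<lambda>x. ennreal (inverse (norm x) ^ DIM('a)))"

lemma sets_dilation_measure [measurable_cong, simp]: "sets dilation_measure = sets borel"
  and space_dilation_measure [simp]: "space dilation_measure = UNIV"
  by (simp_all add: dilation_measure_def)

lemma nn_integral_dilation_measure:
  assumes "f \<in> borel_measurable borel"
  shows "(\<integral>\<^sup>+x. f x \<partial>dilation_measure)
       = (\<integral>\<^sup>+(x::'a::euclidean_space). ennreal (inverse (norm x) ^ DIM('a)) * f x \<partial>lborel)"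
  using assms by (simp add: dilation_measure_def nn_integral_density)

lemma AE_dilation_measure:
  "(AE x in dilation_measure. P x) \<longleftrightarrow> (AE (x::'a::euclidean_space) in lborel. x \<noteq> 0 \<longrightarrow> P x)"
proof -
  have "(AE x in dilation_measure. P x) \<longleftrightarrow>
      (AE (x::'a) in lborel. 0 < ennreal (inverse (norm x) ^ DIM('a)) \<longrightarrow> P x)"
    unfolding dilation_measure_def by (subst AE_density) auto
  also have "\<dots> \<longleftrightarrow> (AE (x::'a) in lborel. x \<noteq> 0 \<longrightarrow> P x)"
    by (intro arg_cong[where f="\<lambda>P. Measure_Space.almost_everywhere lborel P"] ext) (auto simp: zero_less_power power_0_left)
  finally show ?thesis .
qed

lemma AE_dilation_measure_nonzero: "AE x in dilation_measure. x \<noteq> 0"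
  by (simp add: AE_dilation_measure)

lemma nn_integral_dilation_measure_scaleR:
  fixes f :: "'a::euclidean_space \<Rightarrow> ennreal"
  assumes [measurable]: "f \<in> borel_measurable borel" and a: "a > 0"
  shows "(\<integral>\<^sup>+x. f (a *\<^sub>R x) \<partial>dilation_measure) = (\<integral>\<^sup>+x. f x \<partial>dilation_measure)"
proof -
  have "(\<integral>\<^sup>+x. f x \<partial>dilation_measure)
      = ennreal (a ^ DIM('a)) * (\<integral>\<^sup>+x. ennreal (inverse (norm (a *\<^sub>R x)) ^ DIM('a)) * f (a *\<^sub>R x) \<partial>lborel)"
    by (subst nn_integral_dilation_measure, simp, subst nn_integral_lborel_scaleR[OF _ a]) simp_all
  also have "\<dots> = (\<integral>\<^sup>+x. ennreal (a ^ DIM('a)) * (ennreal (inverse (norm (a *\<^sub>R x)) ^ DIM('a)) * f (a *\<^sub>R x)) \<partial>lborel)"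
    by (simp add: nn_integral_cmult)
  also have "\<dots> = (\<integral>\<^sup>+x. ennreal (inverse (norm x) ^ DIM('a)) * f (a *\<^sub>R x) \<partial>lborel)"
  proof (intro nn_integral_cong)
    fix x :: 'a
    have "ennreal (a ^ DIM('a)) * ennreal (inverse (norm (a *\<^sub>R x)) ^ DIM('a))
        = ennreal (inverse (norm x) ^ DIM('a))"
      using a by (simp add: ennreal_mult[symmetric] power_mult_distrib[symmetric] mult.assoc[symmetric])
    then show "ennreal (a ^ DIM('a)) * (ennreal (inverse (norm (a *\<^sub>R x)) ^ DIM('a)) * f (a *\<^sub>R x))
        = ennreal (inverse (norm x) ^ DIM('a)) * f (a *\<^sub>R x)"
      by (simp add: mult.assoc[symmetric])
  qed
  finally show ?thesis by (simp add: nn_integral_dilation_measure)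
qed

lemma distr_dilation_measure:
  assumes a: "a > 0"
  shows "distr dilation_measure borel ((*\<^sub>R) a) = (dilation_measure :: 'a::euclidean_space measure)"
proof (rule measure_eqI)
  fix A :: "'a set" assume "A \<in> sets (distr dilation_measure borel ((*\<^sub>R) a))"
  then have [measurable]: "A \<in> sets borel" by simp
  have "emeasure (distr dilation_measure borel ((*\<^sub>R) a)) A
      = (\<integral>\<^sup>+x. indicator A x \<partial>distr dilation_measure borel ((*\<^sub>R) a))"
    by simp
  also have "\<dots> = (\<integral>\<^sup>+x. indicator A (a *\<^sub>R x) \<partial>dilation_measure)"
    by (subst nn_integral_distr) auto
  also have "\<dots> = (\<integral>\<^sup>+x. indicator A x \<partial>dilation_measure)"
    by (rule nn_integral_dilation_measure_scaleR[OF _ a]) simp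
  finally show "emeasure (distr dilation_measure borel ((*\<^sub>R) a)) A = emeasure dilation_measure A"
    by simp
qed simp

lemma integral_dilation_measure_scaleR:
  fixes f :: "'a::euclidean_space \<Rightarrow> real"
  assumes f: "f \<in> borel_measurable borel" and a: "a > 0"
  shows "(\<integral>x. f (a *\<^sub>R x) \<partial>dilation_measure) = (\<integral>x. f x \<partial>dilation_measure)"
proof -
  have "(\<integral>x. f x \<partial>distr dilation_measure borel ((*\<^sub>R) a)) = (\<integral>x. f (a *\<^sub>R x) \<partial>dilation_measure)"
    by (rule integral_distr) (use f in auto)
  then show ?thesis using distr_dilation_measure[OF a, where 'a='a] by simp
qed

lemma integrable_dilation_measure_scaleR:
  fixes f :: "'a::euclidean_space \<Rightarrow> real"
  assumes f: "f \<in> borel_measurable borel" and a: "a > 0"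
  shows "integrable dilation_measure (\<lambda>x. f (a *\<^sub>R x)) \<longleftrightarrow> integrable dilation_measure f"
proof -
  have "integrable (distr dilation_measure borel ((*\<^sub>R) a)) f \<longleftrightarrow> integrable dilation_measure (\<lambda>x. f (a *\<^sub>R x))"
    by (rule integrable_distr_eq) (use f in auto)
  then show ?thesis using distr_dilation_measure[OF a, where 'a='a] by simp
qed

definition shell :: "real \<Rightarrow> real \<Rightarrow> 'a::euclidean_space set" where
  "shell a b = {x. a \<le> norm x \<and> norm x < b}"

lemma shell_measurable [measurable, simp]: "shell a b \<in> sets borel"
  unfolding shell_def by measurable

lemma emeasure_shell_scaleR:
  assumes "a > 0"
  shows "emeasure dilation_measure (shell (a * s) (a * t) :: 'a::euclidean_space set)
       = emeasure dilation_measure (shell s t :: 'a set)"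
proof -
  have "emeasure dilation_measure (shell (a * s) (a * t) :: 'a set)
      = (\<integral>\<^sup>+x. indicator (shell (a * s) (a * t)) (a *\<^sub>R x :: 'a) \<partial>dilation_measure)"
    by (subst nn_integral_dilation_measure_scaleR) (use assms in auto)
  also have "\<dots> = (\<integral>\<^sup>+x. indicator (shell s t :: 'a set) x \<partial>dilation_measure)"
    using assms by (intro nn_integral_cong) (auto simp: indicator_def shell_def)
  finally show ?thesis by simp
qed

lemma emeasure_shell_finite:
  assumes "s > 0"
  shows "emeasure dilation_measure (shell s t :: 'a::euclidean_space set) < \<infinity>"
proof -
  have "emeasure dilation_measure (shell s t :: 'a set)
      = (\<integral>\<^sup>+x. ennreal (inverse (norm x) ^ DIM('a)) * indicator (shell s t :: 'a set) x \<partial>lborel)"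
    by (subst nn_integral_dilation_measure[symmetric]) auto
  also have "\<dots> \<le> (\<integral>\<^sup>+x. ennreal (inverse s ^ DIM('a)) * indicator (cball 0 t :: 'a set) x \<partial>lborel)"
  proof (rule nn_integral_mono)
    fix x :: 'a
    show "ennreal (inverse (norm x) ^ DIM('a)) * indicator (shell s t) x
        \<le> ennreal (inverse s ^ DIM('a)) * indicator (cball 0 t) x"
      using assms
      by (cases "x \<in> shell s t")
        (auto simp: shell_def indicator_def intro!: ennreal_leI power_mono le_imp_inverse_le)
  qed
  also have "\<dots> = ennreal (inverse s ^ DIM('a)) * emeasure lborel (cball 0 t :: 'a set)"
    by (rule nn_integral_cmult_indicator) simp
  also have "\<dots> < \<infinity>"
    using emeasure_lborel_cball_finite[of "0::'a" t] by (simp add: ennreal_mult_less_top)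
  finally show ?thesis .
qed

lemma emeasure_lborel_open_pos:
  assumes "open S" "S \<noteq> ({}::'a::euclidean_space set)"
  shows "emeasure lborel S > 0"
proof (rule ccontr)
  assume "\<not> ?thesis"
  then have "S \<in> null_sets lborel"
    using assms by (auto simp: null_sets_def)
  then have "negligible S"
    using negligible_iff_null_sets null_sets_completionI by blast
  then show False using open_not_negligible[OF assms] by simp
qed

lemma emeasure_shell_pos:
  assumes "0 < s" "s < t"
  shows "emeasure dilation_measure (shell s t :: 'a::euclidean_space set) > 0"
proof (rule ccontr)
  assume "\<not> ?thesis"
  then have "AE x in dilation_measure. x \<notin> (shell s t :: 'a set)"
    by (subst AE_iff_measurable[where N="shell s t"]) auto
  then have "AE (x::'a) in lborel. x \<notin> shell s t"
    unfolding AE_dilation_measure by eventually_elim (use assms in \<open>auto simp: shell_def\<close>)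
  then have "emeasure lborel (shell s t :: 'a set) = 0"
    by (subst (asm) AE_iff_measurable[where N="shell s t"]) auto
  moreover have op: "open (ball 0 t - cball 0 s :: 'a set)" by auto
  obtain b :: 'a where b: "b \<in> Basis" using nonempty_Basis by blast
  then have "((s + t) / 2) *\<^sub>R b \<in> ball 0 t - cball 0 s" using assms by simp
  then have "emeasure lborel (ball 0 t - cball 0 s :: 'a set) > 0"
    by (intro emeasure_lborel_open_pos[OF op]) blast
  moreover have "emeasure lborel (ball 0 t - cball 0 s :: 'a set) \<le> emeasure lborel (shell s t :: 'a set)"
    by (intro emeasure_mono) (auto simp: shell_def)
  ultimately show False by simp
qed

lemma emeasure_dyadic_shells:
  "emeasure dilation_measure (shell 1 (2 ^ k) :: 'a::euclidean_space set)
   = of_nat k * emeasure dilation_measure (shell 1 2 :: 'a set)"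
proof (induction k)
  case 0
  have "shell 1 (2 ^ 0) = ({} :: 'a set)" by (auto simp: shell_def)
  then show ?case by simp
next
  case (Suc k)
  have *: "shell 1 (2 ^ Suc k) = (shell 1 (2 ^ k) \<union> shell (2 ^ k) (2 ^ Suc k) :: 'a set)"
  proof -
    have "(1::real) \<le> 2 ^ k" "(2::real) ^ k \<le> 2 ^ Suc k" by simp_all
    then show ?thesis unfolding shell_def set_eq_iff Un_iff mem_Collect_eq by (smt (verit))
  qed
  have "emeasure dilation_measure (shell 1 (2 ^ Suc k) :: 'a set)
      = emeasure dilation_measure (shell 1 (2 ^ k) :: 'a set)
      + emeasure dilation_measure (shell (2 ^ k) (2 ^ Suc k) :: 'a set)"
    unfolding * by (rule plus_emeasure[symmetric]) (auto simp: shell_def)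
  also have "emeasure dilation_measure (shell (2 ^ k) (2 ^ Suc k) :: 'a set)
      = emeasure dilation_measure (shell 1 2 :: 'a set)"
    using emeasure_shell_scaleR[of "2^k" 1 2, where 'a='a] by (simp add: mult.commute)
  finally show ?case using Suc by (simp add: distrib_right add.commute)
qed

lemma ex_power_ge_one:
  fixes b x :: real
  assumes b: "1 < b" and x: "1 \<le> x"
  obtains j :: nat where "b ^ j \<le> x" "x < b ^ Suc j"
proof -
  define n where "n = (LEAST n. x < b ^ n)"
  have ex: "\<exists>n. x < b ^ n" by (rule real_arch_pow[OF b])
  have 1: "x < b ^ n" unfolding n_def by (rule LeastI_ex[OF ex])
  with x obtain j where j: "n = Suc j" by (cases n) auto
  have "\<not> x < b ^ j" using not_less_Least[of j "\<lambda>n. x < b ^ n"] j n_def by auto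
  with 1 j that[of j] show ?thesis by (simp add: not_less)
qed

lemma ex_dyadic_ge_one:
  fixes x :: real
  assumes "1 \<le> x"
  obtains j :: nat where "2 ^ j \<le> x" "x < 2 ^ Suc j"
  by (rule ex_power_ge_one[of 2 x]) (use assms that in auto)

text \<open>Both ends are geometric series: all dyadic shells have the same finite mass, and on the shell of
radius about $2^j$ the integrand is at most $2^{-j\rho}$ for $j \ge 0$ and $2^{-|j|(2-\rho)}$ for $j < 0$, up to constants.\<close>

lemma integrable_min_powr:
  assumes \<rho>: "0 < \<rho>" "\<rho> < 2"
  shows "integrable dilation_measure (\<lambda>z::'a::euclidean_space. min 1 ((norm z)\<^sup>2) * norm z powr - \<rho>)"
proof (rule integrableI_nonneg)
  define \<sigma> where "\<sigma> = emeasure dilation_measure (shell (1/2) 2 :: 'a set)"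
  have \<sigma>: "\<sigma> < \<infinity>" unfolding \<sigma>_def by (rule emeasure_shell_finite) simp
  define A :: "nat \<Rightarrow> 'a set" where "A j = shell (2 ^ j * (1/2)) (2 ^ j * 2)" for j
  define B :: "nat \<Rightarrow> 'a set" where "B j = shell (inverse (2 ^ j) * (1/2)) (inverse (2 ^ j) * 2)" for j
  define q where "q = 2 powr - \<rho>"
  define p where "p = 2 powr - (2 - \<rho>)"
  have [measurable]: "A j \<in> sets borel" "B j \<in> sets borel" for j
    by (simp_all add: A_def B_def)
  have q: "0 < q" "q < 1" and p: "0 < p" "p < 1"
    using \<rho> by (auto simp: p_def q_def powr_less_one)
  have pw: "(2 ^ j) powr x = (2 powr x) ^ j" for j :: nat and x :: real
    by (simp add: powr_realpow[symmetric] powr_powr mult.commute)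
  have mA: "emeasure dilation_measure (A j) = \<sigma>" for j
    unfolding A_def \<sigma>_def by (rule emeasure_shell_scaleR) simp
  have mB: "emeasure dilation_measure (B j) = \<sigma>" for j
    unfolding B_def \<sigma>_def by (rule emeasure_shell_scaleR) simp
  have "(\<integral>\<^sup>+(z::'a). ennreal (min 1 ((norm z)\<^sup>2) * norm z powr - \<rho>) \<partial>dilation_measure)
      \<le> (\<integral>\<^sup>+(z::'a). (\<Sum>j. ennreal (q ^ j) * indicator (A j) z + ennreal (p ^ j) * indicator (B j) z) \<partial>dilation_measure)"
  proof (rule nn_integral_mono)
    fix z :: 'a
    have le: "f j \<le> (\<Sum>j. f j)" for f :: "nat \<Rightarrow> ennreal" and j
      using sum_le_suminf[of f "{j}"] by auto
    consider "z = 0" | "1 \<le> norm z" | "0 < norm z" "norm z < 1" by force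
    then show "ennreal (min 1 ((norm z)\<^sup>2) * norm z powr - \<rho>)
      \<le> (\<Sum>j. ennreal (q ^ j) * indicator (A j) z + ennreal (p ^ j) * indicator (B j) z)"
    proof cases
      case 1 then show ?thesis by simp
    next
      case 2
      then obtain j where j: "2 ^ j \<le> norm z" "norm z < 2 ^ Suc j" using ex_dyadic_ge_one by blast
      have "norm z powr - \<rho> \<le> (2 ^ j) powr - \<rho>"
        using j \<rho> by (intro powr_mono2') auto
      also have "\<dots> = q ^ j" by (simp add: pw q_def)
      finally have "norm z powr - \<rho> \<le> q ^ j" .
      moreover have "min 1 ((norm z)\<^sup>2) = 1" using 2 by (simp add: min_def)
      moreover have "z \<in> A j" using j by (auto simp: A_def shell_def mult.commute)
      ultimately have "ennreal (min 1 ((norm z)\<^sup>2) * norm z powr - \<rho>)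
          \<le> ennreal (q ^ j) * indicator (A j) z + ennreal (p ^ j) * indicator (B j) z"
        by (auto intro!: add_increasing2 ennreal_leI)
      also have "\<dots> \<le> (\<Sum>j. ennreal (q ^ j) * indicator (A j) z + ennreal (p ^ j) * indicator (B j) z)"
        by (rule le)
      finally show ?thesis .
    next
      case 3
      define w where "w = inverse (norm z)"
      have "1 \<le> w" using 3 by (simp add: w_def one_le_inverse)
      then obtain j where j: "2 ^ j \<le> w" "w < 2 ^ Suc j" using ex_dyadic_ge_one by blast
      have nz: "norm z = inverse w" by (simp add: w_def)
      have "(norm z)\<^sup>2 * norm z powr - \<rho> = norm z powr (2 - \<rho>)"
        using 3 powr_add[of "norm z" 2 "- \<rho>"] by simp
      also have "\<dots> = w powr - (2 - \<rho>)"
        using \<open>1 \<le> w\<close> by (simp add: nz powr_minus[symmetric] inverse_powr)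
      also have "\<dots> \<le> (2 ^ j) powr - (2 - \<rho>)"
        using j \<rho> by (intro powr_mono2') auto
      also have "\<dots> = p ^ j" by (simp add: pw p_def)
      finally have a: "(norm z)\<^sup>2 * norm z powr - \<rho> \<le> p ^ j" .
      have "inverse (2 ^ Suc j) < inverse w" "inverse w \<le> inverse (2 ^ j)"
        using less_imp_inverse_less[OF j(2)] le_imp_inverse_le[OF j(1)] \<open>1 \<le> w\<close> by simp_all
      moreover have "(0::real) < inverse (2 ^ j)" by simp
      ultimately have b: "z \<in> B j"
        unfolding B_def shell_def mem_Collect_eq nz by (simp add: field_simps del: inverse_positive_iff_positive)
      have "min 1 ((norm z)\<^sup>2) = (norm z)\<^sup>2" using 3 by (intro min_absorb2 power_le_one) auto
      with a b have "ennreal (min 1 ((norm z)\<^sup>2) * norm z powr - \<rho>)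
          \<le> ennreal (q ^ j) * indicator (A j) z + ennreal (p ^ j) * indicator (B j) z"
        by (auto intro!: add_increasing ennreal_leI)
      also have "\<dots> \<le> (\<Sum>j. ennreal (q ^ j) * indicator (A j) z + ennreal (p ^ j) * indicator (B j) z)"
        by (rule le)
      finally show ?thesis .
    qed
  qed
  also have "\<dots> = (\<Sum>j. ennreal (q ^ j) * \<sigma> + ennreal (p ^ j) * \<sigma>)"
    by (subst nn_integral_suminf) (auto simp: nn_integral_add nn_integral_cmult mA mB)
  also have "\<dots> = (\<Sum>j. ennreal (q ^ j + p ^ j)) * \<sigma>"
    using p q by (subst ennreal_suminf_multc[symmetric])
      (auto intro!: suminf_cong simp: ennreal_plus distrib_right)
  also have "(\<Sum>j. ennreal (q ^ j + p ^ j)) < \<infinity>"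
  proof -
    have "summable (\<lambda>j. q ^ j + p ^ j)"
      using p q by (intro summable_add summable_geometric) auto
    then have "(\<Sum>j. ennreal (q ^ j + p ^ j)) = ennreal (\<Sum>j. q ^ j + p ^ j)"
      using p q by (intro suminf_ennreal2) auto
    then show ?thesis by simp
  qed
  then have "(\<Sum>j. ennreal (q ^ j + p ^ j)) * \<sigma> < \<infinity>"
    using \<sigma> by (simp add: ennreal_mult_less_top)
  finally show "(\<integral>\<^sup>+(z::'a). ennreal (min 1 ((norm z)\<^sup>2) * norm z powr - \<rho>) \<partial>dilation_measure) < \<infinity>" .
qed auto

section \<open>Exponents of isotropic unimodal Levy measures\<close>

lemma one_minus_cos_le: "1 - cos x \<le> 2 * min 1 (x\<^sup>2)" for x :: real
proof -
  have "1 - cos x = 2 * (sin (x / 2))\<^sup>2" using cos_double_sin[of "x/2"] by simp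
  moreover have "(sin (x / 2))\<^sup>2 \<le> \<bar>x / 2\<bar>\<^sup>2"
    using abs_sin_x_le_abs_x[of "x/2"] by (metis abs_ge_zero power2_abs power_mono)
  moreover have "\<bar>x / 2\<bar>\<^sup>2 = x\<^sup>2 / 4" by (simp add: power2_eq_square)
  moreover have "0 \<le> x\<^sup>2" by simp
  ultimately have "1 - cos x \<le> 2 * x\<^sup>2" by linarith
  moreover have "1 - cos x \<le> 2" using cos_ge_minus_one[of x] by linarith
  ultimately show ?thesis by (simp add: min_def)
qed

text \<open>The Taylor polynomial of degree two has remainder at most $x^4/24$, and $x^2 \le 4$.\<close>

lemma one_minus_cos_ge:
  fixes x :: real
  assumes "\<bar>x\<bar> \<le> 2"
  shows "x\<^sup>2 / 3 \<le> 1 - cos x"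
proof (cases "x = 0")
  case False
  define y where "y = \<bar>x\<bar>"
  have y: "0 < y" "y \<le> 2" using assms False by (auto simp: y_def)
  obtain t where t: "cos y = (\<Sum>m<4. cos_coeff m * y ^ m) + (cos (t + 1/2 * real 4 * pi) / fact 4) * y ^ 4"
    using Maclaurin_cos_expansion2[of y 4] y by auto
  have s: "(\<Sum>m<4. cos_coeff m * y ^ m) = 1 - y\<^sup>2 / 2"
    
  proof -
    have "{..<4::nat} = {0, 1, 2, 3}" by auto
    then show ?thesis by (simp add: cos_coeff_def)
  qed
  have "cos (t + 1/2 * real 4 * pi) * y ^ 4 \<le> 1 * y ^ 4"
    by (intro mult_right_mono) auto
  then have "cos y \<le> 1 - y\<^sup>2 / 2 + y ^ 4 / 24"
    unfolding t s by (simp add: fact_numeral)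
  moreover have "y ^ 4 \<le> 4 * y\<^sup>2"
  proof -
    have "y\<^sup>2 \<le> 4" using y power_mono[of y 2 2] by simp
    then have "y\<^sup>2 * y\<^sup>2 \<le> 4 * y\<^sup>2" by (intro mult_right_mono) auto
    then show ?thesis by (simp add: power_add[symmetric])
  qed
  moreover have "cos y = cos x" "y\<^sup>2 = x\<^sup>2" by (auto simp: y_def)
  ultimately show ?thesis by simp
qed auto

text \<open>The reflection in the hyperplane orthogonal to $a - b$ exchanges $a$ and $b$.\<close>

lemma ex_orthogonal_transformation_eq_norm:
  fixes a b :: "'a::euclidean_space"
  assumes "norm a = norm b"
  obtains g where "orthogonal_transformation g" "g a = b"
proof (cases "a = b")
  case True then show ?thesis using that[of id] linear_id by (simp add: orthogonal_transformation_def)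
next
  case False
  define v where "v = a - b"
  define g where "g x = x - (2 * (x \<bullet> v) / (v \<bullet> v)) *\<^sub>R v" for x
  have vv: "v \<bullet> v \<noteq> 0" using False by (simp add: v_def)
  have "linear g"
    by (intro linearI) (simp_all add: g_def inner_left_distrib add_divide_distrib algebra_simps)
  moreover have "g x \<bullet> g y = x \<bullet> y" for x y
    using vv by (simp add: g_def inner_diff_left inner_diff_right inner_commute field_simps)
  moreover have "g a = b"
  proof -
    have "a \<bullet> a = b \<bullet> b" using assms by (simp add: norm_eq_sqrt_inner)
    then have "2 * (a \<bullet> v) = v \<bullet> v"
      by (simp add: v_def inner_diff_left inner_diff_right inner_commute)
    then show ?thesis using vv by (simp add: g_def v_def)
  qed
  ultimately show ?thesis using that by (auto simp: orthogonal_transformation_def)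
qed

lemma isotropic_unimodal_density_mono:
  assumes "isotropic_unimodal_density \<mu> f" "x \<noteq> 0" "norm x \<le> norm y"
  shows "f y \<le> f x"
  using assms unfolding isotropic_unimodal_density_def by blast

lemma isotropic_unimodal_density_nonneg:
  assumes "isotropic_unimodal_density \<mu> f" "x \<noteq> 0"
  shows "0 \<le> f x"
  using assms unfolding isotropic_unimodal_density_def by blast

lemma isotropic_unimodal_density_cong_norm:
  assumes "isotropic_unimodal_density \<mu> f" "x \<noteq> 0" "norm x = norm y"
  shows "f x = f y"
  using assms isotropic_unimodal_density_mono[OF assms(1), of x y]
    isotropic_unimodal_density_mono[OF assms(1), of y x] by force

lemma isotropic_unimodal_density_measurable:
  "isotropic_unimodal_density \<mu> f \<Longrightarrow> f \<in> borel_measurable borel"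
  by (simp add: isotropic_unimodal_density_def)

text \<open>The measure may have an atom at the origin, which the density does not see; hence the condition
on $g(0)$.\<close>

lemma nn_integral_isotropic_unimodal_density:
  fixes \<mu> :: "'a::euclidean_space measure"
  assumes f: "isotropic_unimodal_density \<mu> f" and sets: "sets \<mu> = sets borel"
    and g[measurable]: "g \<in> borel_measurable borel" and g0: "g 0 = 0"
  shows "(\<integral>\<^sup>+x. g x \<partial>\<mu>) = (\<integral>\<^sup>+x. ennreal (f x) * g x \<partial>lborel)"
proof -
  note [measurable_cong] = sets
  have [measurable]: "f \<in> borel_measurable borel"
    by (rule isotropic_unimodal_density_measurable[OF f])
  have sp: "space \<mu> = UNIV" using sets_eq_imp_space_eq[OF sets] by simp
  have "density \<mu> (indicator (- {0})) = density lborel (\<lambda>x. ennreal (f x) * indicator (- {0}) x)"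
  proof (rule measure_eqI)
    fix A assume "A \<in> sets (density \<mu> (indicator (- {0})))"
    then have [measurable]: "A \<in> sets borel" using sets by simp
    have "emeasure (density \<mu> (indicator (- {0}))) A = (\<integral>\<^sup>+x. indicator (A - {0}) x \<partial>\<mu>)"
      by (subst emeasure_density) (auto intro!: nn_integral_cong simp: indicator_def simp del: nn_integral_indicator)
    also have "\<dots> = emeasure \<mu> (A - {0})" using sets by (intro nn_integral_indicator) auto
    also have "\<dots> = (\<integral>\<^sup>+x\<in>A - {0}. ennreal (f x) \<partial>lborel)"
      using f unfolding isotropic_unimodal_density_def by auto
    also have "\<dots> = emeasure (density lborel (\<lambda>x. ennreal (f x) * indicator (- {0}) x)) A"
      by (subst emeasure_density) (auto intro!: nn_integral_cong simp: indicator_def)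
    finally show "emeasure (density \<mu> (indicator (- {0}))) A
        = emeasure (density lborel (\<lambda>x. ennreal (f x) * indicator (- {0}) x)) A" .
  qed (simp add: sets)
  then have "(\<integral>\<^sup>+x. g x \<partial>density \<mu> (indicator (- {0})))
      = (\<integral>\<^sup>+x. g x \<partial>density lborel (\<lambda>x. ennreal (f x) * indicator (- {0}) x))" by simp
  moreover have "(\<integral>\<^sup>+x. g x \<partial>density \<mu> (indicator (- {0}))) = (\<integral>\<^sup>+x. g x \<partial>\<mu>)"
    by (subst nn_integral_density) (auto intro!: nn_integral_cong simp: indicator_def g0)
  moreover have "(\<integral>\<^sup>+x. g x \<partial>density lborel (\<lambda>x. ennreal (f x) * indicator (- {0}) x))
     = (\<integral>\<^sup>+x. ennreal (f x) * g x \<partial>lborel)"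
    by (subst nn_integral_density) (auto intro!: nn_integral_cong simp: indicator_def g0)
  ultimately show ?thesis by simp
qed

definition axis_vector :: "'a::euclidean_space" where
  "axis_vector = (SOME b. b \<in> Basis)"

lemma axis_vector_in_Basis: "axis_vector \<in> Basis"
  unfolding axis_vector_def using nonempty_Basis by (rule some_in_eq[THEN iffD2])

lemma norm_axis_vector [simp]: "norm axis_vector = 1"
  by (rule norm_Basis[OF axis_vector_in_Basis])

lemma radial_profile_axis_vector: "radial_profile f r = f (r *\<^sub>R axis_vector)"
  by (simp add: radial_profile_def axis_vector_def)

lemma min_one_scale_le:
  fixes s t :: real assumes "0 \<le> s" "0 \<le> t"
  shows "min 1 (s * t) \<le> max 1 s * min 1 t"
proof (cases "1 \<le> t")
  case False
  have "s * t \<le> max 1 s * t" using assms by (intro mult_right_mono) auto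
  then show ?thesis using False by simp
next
  case True
  then have "min 1 (s * t) \<le> 1" "1 \<le> max 1 s" "min 1 t = 1" by auto
  then show ?thesis by linarith
qed

lemma one_minus_cos_inner_le: "1 - cos (\<xi> \<bullet> x) \<le> 2 * min 1 ((norm \<xi>)\<^sup>2 * (norm x)\<^sup>2)" 
  for \<xi> x :: "'a::euclidean_space"
proof -
  have "\<bar>\<xi> \<bullet> x\<bar> \<le> norm \<xi> * norm x" by (rule Cauchy_Schwarz_ineq2)
  then have "\<bar>\<xi> \<bullet> x\<bar>\<^sup>2 \<le> (norm \<xi> * norm x)\<^sup>2" by (rule power_mono) simp
  then have "(\<xi> \<bullet> x)\<^sup>2 \<le> (norm \<xi>)\<^sup>2 * (norm x)\<^sup>2" by (simp add: power_mult_distrib)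
  then have "min 1 ((\<xi> \<bullet> x)\<^sup>2) \<le> min 1 ((norm \<xi>)\<^sup>2 * (norm x)\<^sup>2)" by simp
  then show ?thesis using one_minus_cos_le[of "\<xi> \<bullet> x"] by linarith
qed

locale unimodal_exponent =
  fixes \<psi> :: "'a::euclidean_space \<Rightarrow> real" and \<eta> :: real and N :: "'a measure" and \<nu> :: "'a \<Rightarrow> real"
  assumes levy_khintchine: "isotropic_levy_khintchine \<psi> \<eta> N"
    and density: "isotropic_unimodal_density N \<nu>"
begin

abbreviation profile :: "real \<Rightarrow> real" where
  "profile \<equiv> radial_profile \<psi>"

lemma eta_nonneg: "0 \<le> \<eta>"
  and sets_N [measurable_cong]: "sets N = sets borel"
  and N_zero: "emeasure N {0} = 0"
  and rotation_N: "rotation_invariant N"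
  and psi_eq: "\<psi> \<xi> = (\<integral>x. (1 - cos (\<xi> \<bullet> x)) \<partial>N) + \<eta> * (norm \<xi>)\<^sup>2"
  and nn_integral_N_finite: "(\<integral>\<^sup>+x. ennreal (min 1 ((norm x)\<^sup>2)) \<partial>N) < \<infinity>"
  using levy_khintchine by (simp_all add: isotropic_levy_khintchine_def levy_measure_def)

lemma space_N [simp]: "space N = UNIV"
  using sets_eq_imp_space_eq[OF sets_N] by simp

lemma nu_measurable [measurable]: "\<nu> \<in> borel_measurable borel"
  by (rule isotropic_unimodal_density_measurable[OF density])

lemma integrable_min_N: "integrable N (\<lambda>x. min 1 ((norm x)\<^sup>2))"
  by (rule integrableI_nonneg) (use nn_integral_N_finite in auto)

lemma integrable_scaled_min_N: "integrable N (\<lambda>x. min 1 (r\<^sup>2 * (norm x)\<^sup>2))"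
proof (rule Bochner_Integration.integrable_bound)
  show "integrable N (\<lambda>x. max 1 (r\<^sup>2) * min 1 ((norm x)\<^sup>2))"
    using integrable_min_N by simp
  show "AE x in N. norm (min 1 (r\<^sup>2 * (norm x)\<^sup>2)) \<le> norm (max 1 (r\<^sup>2) * min 1 ((norm x)\<^sup>2))"
    using min_one_scale_le[of "r\<^sup>2"] by (intro always_eventually allI) simp
qed auto

lemma integrable_one_minus_cos_N: "integrable N (\<lambda>x. 1 - cos (\<xi> \<bullet> x))"
proof (rule Bochner_Integration.integrable_bound)
  show "integrable N (\<lambda>x. 2 * min 1 ((norm \<xi>)\<^sup>2 * (norm x)\<^sup>2))"
    using integrable_scaled_min_N[of "norm \<xi>"] by simp
  show "AE x in N. norm (1 - cos (\<xi> \<bullet> x)) \<le> norm (2 * min 1 ((norm \<xi>)\<^sup>2 * (norm x)\<^sup>2))"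
    using one_minus_cos_inner_le[of \<xi>] by (intro always_eventually allI) simp
qed auto

lemma psi_nonneg: "0 \<le> \<psi> \<xi>"
  unfolding psi_eq using eta_nonneg
  by (intro add_nonneg_nonneg mult_nonneg_nonneg Bochner_Integration.integral_nonneg) auto

lemma profile_nonneg: "0 \<le> profile r"
  by (simp add: radial_profile_def psi_nonneg)

text \<open>The measure $N$ is invariant under the orthogonal map that moves one vector to the other.\<close>

lemma psi_radial:
  assumes "norm \<xi> = norm \<zeta>"
  shows "\<psi> \<xi> = \<psi> \<zeta>"
proof -
  obtain g where g: "orthogonal_transformation g" "g \<xi> = \<zeta>"
    using ex_orthogonal_transformation_eq_norm[OF assms] .
  have [measurable]: "g \<in> borel_measurable borel"
    using g by (intro borel_measurable_continuous_onI linear_continuous_on)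
      (auto simp: orthogonal_transformation_def linear_conv_bounded_linear)
  have "(\<integral>x. (1 - cos (\<zeta> \<bullet> x)) \<partial>N) = (\<integral>x. (1 - cos (\<zeta> \<bullet> x)) \<partial>distr N borel g)"
    using rotation_N g by (simp add: rotation_invariant_def)
  also have "\<dots> = (\<integral>x. (1 - cos (g \<xi> \<bullet> g x)) \<partial>N)"
    by (subst integral_distr) (auto simp: g(2))
  also have "\<dots> = (\<integral>x. (1 - cos (\<xi> \<bullet> x)) \<partial>N)"
    using g(1) by (simp add: orthogonal_transformation_def)
  finally show ?thesis by (simp add: psi_eq assms)
qed

lemma psi_eq_profile: "\<psi> \<xi> = profile (norm \<xi>)"
  unfolding radial_profile_axis_vector by (rule psi_radial) simp

lemma nn_integral_N:
  assumes "g \<in> borel_measurable borel"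
  shows "(\<integral>\<^sup>+x. g x \<partial>N) = (\<integral>\<^sup>+x. ennreal (\<nu> x) * g x \<partial>lborel)"
proof -
  have "AE x in N. x \<noteq> 0"
    by (rule AE_I[of _ _ "{0}"]) (auto simp: N_zero)
  then have "(\<integral>\<^sup>+x. g x \<partial>N) = (\<integral>\<^sup>+x. g x * indicator (- {0}) x \<partial>N)"
    by (intro nn_integral_cong_AE) (auto elim!: eventually_mono)
  also have "\<dots> = (\<integral>\<^sup>+x. ennreal (\<nu> x) * (g x * indicator (- {0}) x) \<partial>lborel)"
    using assms by (intro nn_integral_isotropic_unimodal_density[OF density sets_N]) auto
  also have "\<dots> = (\<integral>\<^sup>+x. ennreal (\<nu> x) * g x \<partial>lborel)"
    using AE_lborel_singleton[of "0::'a"]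
    by (intro nn_integral_cong_AE) (auto elim!: eventually_mono)
  finally show ?thesis .
qed

text \<open>Unimodality bounds $\psi$ from below.  Shifting by the half period $a = \pi/r$ towards the origin replaces
$1 - \cos$ by $1 + \cos$, and the two add up to $2$; on the half-space beyond $a/2$ the shift decreases the
norm, so the density at the shifted point is at least as large.\<close>

lemma halfspace_mass_le:
  assumes b: "norm b = 1" and r: "r > 0"
  shows "emeasure N {x. x \<bullet> b \<ge> pi / (2 * r)} \<le> (\<integral>\<^sup>+x. ennreal (1 - cos (r * (x \<bullet> b))) \<partial>N)"
proof -
  define a where "a = pi / r"
  define f where "f x = 1 - cos (r * (x \<bullet> b))" for x
  define S where "S = {x. x \<bullet> b \<ge> a / 2}"
  have a: "a > 0" using r by (simp add: a_def)
  have [measurable]: "f \<in> borel_measurable borel" "S \<in> sets borel"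
    by (auto simp: f_def[abs_def] S_def)
  have f0: "0 \<le> f x" for x by (simp add: f_def)
  have ff: "f x + f (x - a *\<^sub>R b) = 2" for x
  proof -
    have "r * ((x - a *\<^sub>R b) \<bullet> b) = r * (x \<bullet> b) - pi"
      using r b by (simp add: inner_diff_left a_def right_diff_distrib norm_eq_1)
    then show ?thesis by (simp add: f_def cos_diff)
  qed
  have shift: "\<nu> x \<le> \<nu> (x - a *\<^sub>R b)" if "x \<in> S" "x \<noteq> a *\<^sub>R b" for x
  proof (rule isotropic_unimodal_density_mono[OF density])
    have "(norm (x - a *\<^sub>R b))\<^sup>2 = (norm x)\<^sup>2 - a * (2 * (x \<bullet> b) - a)"
      using b by (simp add: power2_norm_eq_inner inner_diff_left inner_diff_right inner_commute
          norm_eq_1 algebra_simps)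
    also have "\<dots> \<le> (norm x)\<^sup>2" using that a by (simp add: S_def)
    finally show "norm (x - a *\<^sub>R b) \<le> norm x" by (rule power2_le_imp_le) simp
  qed (use that in auto)
  have "2 * emeasure N S = (\<integral>\<^sup>+x. 2 * indicator S x \<partial>N)"
    using sets_N by (subst nn_integral_cmult) auto
  also have "\<dots> = (\<integral>\<^sup>+x. ennreal (\<nu> x) * (ennreal (f x) * indicator S x)
      + ennreal (\<nu> x) * (ennreal (f (x - a *\<^sub>R b)) * indicator S x) \<partial>lborel)"
  proof (subst nn_integral_N, simp, rule nn_integral_cong)
    fix x
    have "(2::ennreal) = ennreal (f x) + ennreal (f (x - a *\<^sub>R b))"
      using ff[of x] f0 by (simp add: ennreal_plus[symmetric] del: ennreal_plus)
    then show "ennreal (\<nu> x) * (2 * indicator S x) = ennreal (\<nu> x) * (ennreal (f x) * indicator S x)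
      + ennreal (\<nu> x) * (ennreal (f (x - a *\<^sub>R b)) * indicator S x)"
      by (simp add: distrib_left[symmetric] distrib_right[symmetric])
  qed
  also have "\<dots> = (\<integral>\<^sup>+x. ennreal (\<nu> x) * (ennreal (f x) * indicator S x) \<partial>lborel)
      + (\<integral>\<^sup>+x. ennreal (\<nu> x) * (ennreal (f (x - a *\<^sub>R b)) * indicator S x) \<partial>lborel)"
    by (rule nn_integral_add) auto
  also have "\<dots> \<le> (\<integral>\<^sup>+x. ennreal (\<nu> x) * ennreal (f x) \<partial>lborel)
      + (\<integral>\<^sup>+x. ennreal (\<nu> (x - a *\<^sub>R b)) * ennreal (f (x - a *\<^sub>R b)) \<partial>lborel)"
  proof (intro add_mono)
    show "(\<integral>\<^sup>+x. ennreal (\<nu> x) * (ennreal (f x) * indicator S x) \<partial>lborel)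
        \<le> (\<integral>\<^sup>+x. ennreal (\<nu> x) * ennreal (f x) \<partial>lborel)"
      by (intro nn_integral_mono) (auto simp: indicator_def)
    show "(\<integral>\<^sup>+x. ennreal (\<nu> x) * (ennreal (f (x - a *\<^sub>R b)) * indicator S x) \<partial>lborel)
        \<le> (\<integral>\<^sup>+x. ennreal (\<nu> (x - a *\<^sub>R b)) * ennreal (f (x - a *\<^sub>R b)) \<partial>lborel)"
      using AE_lborel_singleton[of "a *\<^sub>R b"]
      by (intro nn_integral_mono_AE)
        (auto elim!: eventually_mono simp: indicator_def intro!: mult_right_mono ennreal_leI shift)
  qed
  also have "(\<integral>\<^sup>+x. ennreal (\<nu> (x - a *\<^sub>R b)) * ennreal (f (x - a *\<^sub>R b)) \<partial>lborel)
      = (\<integral>\<^sup>+x. ennreal (\<nu> x) * ennreal (f x) \<partial>lborel)"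
    using nn_integral_lborel_translate[of "\<lambda>x. ennreal (\<nu> x) * ennreal (f x)" "- (a *\<^sub>R b)"] by simp
  also have "(\<integral>\<^sup>+x. ennreal (\<nu> x) * ennreal (f x) \<partial>lborel) = (\<integral>\<^sup>+x. ennreal (f x) \<partial>N)"
    by (rule nn_integral_N[symmetric]) simp
  finally have "2 * emeasure N S \<le> 2 * (\<integral>\<^sup>+x. ennreal (f x) \<partial>N)" by (simp add: mult_2)
  then have "emeasure N S \<le> (\<integral>\<^sup>+x. ennreal (f x) \<partial>N)"
    by (subst (asm) ennreal_mult_le_mult_iff) auto
  then show ?thesis by (simp add: S_def f_def a_def mult.commute)
qed

text \<open>Within a quarter period $1 - \cos$ is comparable to the square, and the two remaining half-spaces
are controlled by the half-period shift.\<close>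

lemma coordinate_truncated_moment_le:
  assumes b: "norm b = 1" and r: "r > 0"
  shows "(\<integral>\<^sup>+x. ennreal (min 1 (r\<^sup>2 * (x \<bullet> b)\<^sup>2)) \<partial>N) \<le> 5 * (\<integral>\<^sup>+x. ennreal (1 - cos (r * (x \<bullet> b))) \<partial>N)"
proof -
  define S where "S c = {x. x \<bullet> c \<ge> pi / (2 * r)}" for c :: 'a
  have [measurable]: "S c \<in> sets borel" for c by (simp add: S_def)
  have pt: "min 1 (r\<^sup>2 * (x \<bullet> b)\<^sup>2) \<le> 3 * (1 - cos (r * (x \<bullet> b))) + indicator (S b) x + indicator (S (- b)) x" for x
  proof (cases "x \<in> S b \<or> x \<in> S (- b)")
    case True
    have "0 \<le> 1 - cos (r * (x \<bullet> b))" by simp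
    moreover have "min 1 (r\<^sup>2 * (x \<bullet> b)\<^sup>2) \<le> 1" by simp
    moreover have "1 \<le> (indicator (S b) x :: real) + indicator (S (- b)) x"
      using True by (auto simp: indicator_def)
    ultimately show ?thesis
      by (smt (verit))
  next
    case False
    then have "\<bar>x \<bullet> b\<bar> \<le> pi / (2 * r)" by (auto simp: S_def)
    then have "r * \<bar>x \<bullet> b\<bar> \<le> r * (pi / (2 * r))" using r by (intro mult_left_mono) auto
    also have "\<dots> = pi / 2" using r by simp
    finally have "\<bar>r * (x \<bullet> b)\<bar> \<le> 2" using r pi_half_less_two by (simp add: abs_mult)
    from one_minus_cos_ge[OF this] have "r\<^sup>2 * (x \<bullet> b)\<^sup>2 \<le> 3 * (1 - cos (r * (x \<bullet> b)))"
      by (simp add: power_mult_distrib)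
    then show ?thesis using False by simp
  qed
  have "(\<integral>\<^sup>+x. ennreal (min 1 (r\<^sup>2 * (x \<bullet> b)\<^sup>2)) \<partial>N)
      \<le> (\<integral>\<^sup>+x. 3 * ennreal (1 - cos (r * (x \<bullet> b))) + indicator (S b) x + indicator (S (- b)) x \<partial>N)"
  proof (intro nn_integral_mono)
    fix x
    have "ennreal (min 1 (r\<^sup>2 * (x \<bullet> b)\<^sup>2))
       \<le> ennreal (3 * (1 - cos (r * (x \<bullet> b))) + indicator (S b) x + indicator (S (- b)) x)"
      by (rule ennreal_leI[OF pt])
    also have "\<dots> = 3 * ennreal (1 - cos (r * (x \<bullet> b))) + indicator (S b) x + indicator (S (- b)) x"
    proof -
      have e: "ennreal (3 * u + p + q) = 3 * ennreal u + ennreal p + ennreal q"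
        if "0 \<le> u" "0 \<le> p" "0 \<le> q" for u p q :: real
        using that by (simp add: ennreal_mult)
      show ?thesis by (subst e) (simp_all add: ennreal_indicator)
    qed
    finally show "ennreal (min 1 (r\<^sup>2 * (x \<bullet> b)\<^sup>2))
       \<le> 3 * ennreal (1 - cos (r * (x \<bullet> b))) + indicator (S b) x + indicator (S (- b)) x" .
  qed
  also have "\<dots> = 3 * (\<integral>\<^sup>+x. ennreal (1 - cos (r * (x \<bullet> b))) \<partial>N) + emeasure N (S b) + emeasure N (S (- b))"
    using sets_N by (simp add: nn_integral_add nn_integral_cmult)
  also have "\<dots> \<le> 3 * (\<integral>\<^sup>+x. ennreal (1 - cos (r * (x \<bullet> b))) \<partial>N)
      + (\<integral>\<^sup>+x. ennreal (1 - cos (r * (x \<bullet> b))) \<partial>N) + (\<integral>\<^sup>+x. ennreal (1 - cos (r * (x \<bullet> b))) \<partial>N)"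
    using halfspace_mass_le[OF b r] halfspace_mass_le[of "- b", OF _ r] b
    by (intro add_mono order_refl) (simp_all add: S_def)
  also have "\<dots> = 5 * (\<integral>\<^sup>+x. ennreal (1 - cos (r * (x \<bullet> b))) \<partial>N)"
  proof -
    have "(5::ennreal) = 3 + 1 + 1" by simp
    then show ?thesis by (simp only: distrib_right mult_1)
  qed
  finally show ?thesis .
qed

definition truncated_moment :: "real \<Rightarrow> real" where
  "truncated_moment r = (\<integral>x. min 1 (r\<^sup>2 * (norm x)\<^sup>2) \<partial>N)"

lemma truncated_moment_nonneg: "0 \<le> truncated_moment r"
  unfolding truncated_moment_def by (intro Bochner_Integration.integral_nonneg) auto

lemma nn_integral_truncated_moment:
  "(\<integral>\<^sup>+x. ennreal (min 1 (r\<^sup>2 * (norm x)\<^sup>2)) \<partial>N) = ennreal (truncated_moment r)"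
  unfolding truncated_moment_def
  by (rule nn_integral_eq_integral[OF integrable_scaled_min_N]) auto

text \<open>Summing over the coordinates bounds the truncated second moment of $N$ at scale $1/r$ by $\psi(r)$.
Together with the trivial converse \<open>psi_le_truncated_moment\<close> it makes $\psi$ comparable to
a function with obvious monotonicity and doubling properties.\<close>

lemma truncated_moment_le_psi:
  assumes r: "r > 0"
  shows "truncated_moment r + \<eta> * r\<^sup>2 \<le> 5 * DIM('a) * profile r"
proof -
  define I where "I = profile r - \<eta> * r\<^sup>2"
  have L: "(\<integral>\<^sup>+x. ennreal (1 - cos (r * (x \<bullet> b))) \<partial>N) = ennreal I" if "norm b = 1" for b
  proof -
    have "(\<integral>\<^sup>+x. ennreal (1 - cos (r * (x \<bullet> b))) \<partial>N) = ennreal (\<integral>x. 1 - cos ((r *\<^sub>R b) \<bullet> x) \<partial>N)"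
      by (subst nn_integral_eq_integral[OF integrable_one_minus_cos_N, symmetric])
        (auto simp: inner_commute)
    also have "(\<integral>x. 1 - cos ((r *\<^sub>R b) \<bullet> x) \<partial>N) = I"
      using psi_eq[of "r *\<^sub>R b"] psi_eq_profile[of "r *\<^sub>R b"] that r by (simp add: I_def)
    finally show ?thesis .
  qed
  have I: "0 \<le> I"
    using psi_eq[of "r *\<^sub>R axis_vector"] r
    by (simp add: I_def radial_profile_axis_vector)
  have "ennreal (truncated_moment r) \<le> (\<integral>\<^sup>+x. (\<Sum>b\<in>Basis. ennreal (min 1 (r\<^sup>2 * (x \<bullet> b)\<^sup>2))) \<partial>N)"
    unfolding nn_integral_truncated_moment[symmetric]
  proof (intro nn_integral_mono)
    fix x :: 'a
    have sub: "min 1 (\<Sum>b\<in>B. f b) \<le> (\<Sum>b\<in>B. min 1 (f b))"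
      if "finite B" "\<And>b. 0 \<le> f b" for B and f :: "'a \<Rightarrow> real"
      using that(1)
    proof induction
      case (insert b B)
      have "0 \<le> (\<Sum>b\<in>B. f b)" using that by (intro sum_nonneg) auto
      then show ?case using insert that(2)[of b] by (auto simp: min_def split: if_splits)
    qed simp
    have "(norm x)\<^sup>2 = (\<Sum>b\<in>Basis. (x \<bullet> b)\<^sup>2)"
      unfolding power2_norm_eq_inner by (subst euclidean_inner) (simp add: power2_eq_square)
    then have "min 1 (r\<^sup>2 * (norm x)\<^sup>2) \<le> (\<Sum>b\<in>Basis. min 1 (r\<^sup>2 * (x \<bullet> b)\<^sup>2))"
      using sub[of Basis "\<lambda>b. r\<^sup>2 * (x \<bullet> b)\<^sup>2"] by (simp add: sum_distrib_left)
    then show "ennreal (min 1 (r\<^sup>2 * (norm x)\<^sup>2)) \<le> (\<Sum>b\<in>Basis. ennreal (min 1 (r\<^sup>2 * (x \<bullet> b)\<^sup>2)))"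
      by (subst sum_ennreal) (auto intro!: ennreal_leI)
  qed
  also have "\<dots> = (\<Sum>b\<in>Basis. (\<integral>\<^sup>+x. ennreal (min 1 (r\<^sup>2 * (x \<bullet> b)\<^sup>2)) \<partial>N))"
    by (rule nn_integral_sum) auto
  also have "\<dots> \<le> (\<Sum>b\<in>(Basis::'a set). 5 * ennreal I)"
    using coordinate_truncated_moment_le[OF _ r] L by (intro sum_mono) (metis norm_Basis)
  also have "\<dots> = ennreal (DIM('a) * (5 * I))"
    using I by (simp add: ennreal_mult ennreal_of_nat_eq_real_of_nat)
  finally have "truncated_moment r \<le> DIM('a) * (5 * I)"
    using I by (subst (asm) ennreal_le_iff) auto
  moreover have "\<eta> * r\<^sup>2 \<le> DIM('a) * (5 * (\<eta> * r\<^sup>2))"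
  proof -
    have "1 * (\<eta> * r\<^sup>2) \<le> (DIM('a) * 5) * (\<eta> * r\<^sup>2)"
      using eta_nonneg DIM_positive[where 'a='a] by (intro mult_right_mono) (auto simp: real_of_nat_ge_one_iff Suc_le_eq intro: order_trans[of 1 "real DIM('a)"])
    then show ?thesis by (simp add: mult.assoc)
  qed
  ultimately show ?thesis by (simp add: I_def algebra_simps)
qed

lemma psi_le_truncated_moment: "profile r \<le> 2 * truncated_moment r + \<eta> * r\<^sup>2"
proof -
  have "(\<integral>x. (1 - cos ((r *\<^sub>R axis_vector) \<bullet> x)) \<partial>N) \<le> (\<integral>x. 2 * min 1 (r\<^sup>2 * (norm x)\<^sup>2) \<partial>N)"
    using one_minus_cos_inner_le[of "r *\<^sub>R axis_vector"] integrable_scaled_min_N[of r]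
    by (intro integral_mono integrable_one_minus_cos_N) (auto simp: power_mult_distrib)
  then show ?thesis
    by (simp add: radial_profile_axis_vector psi_eq truncated_moment_def)
qed

definition doubling_const :: real where
  "doubling_const = 10 * DIM('a)"

lemma doubling_const_ge: "1 \<le> doubling_const"
  using DIM_positive[where 'a='a] unfolding doubling_const_def by linarith

text \<open>The comparable function $\int \min(1, r^2|x|^2)\,N(dx) + \eta r^2$ grows by at most $\max(1, l^2)$ when $r$ is
multiplied by $l$.\<close>

lemma profile_scale_le:
  assumes r: "r > 0" and l: "l > 0"
  shows "profile (l * r) \<le> doubling_const * max 1 (l\<^sup>2) * profile r"
proof -
  have "truncated_moment (l * r) \<le> (\<integral>x. max 1 (l\<^sup>2) * min 1 (r\<^sup>2 * (norm x)\<^sup>2) \<partial>N)"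
    unfolding truncated_moment_def
  proof (intro integral_mono integrable_scaled_min_N)
    show "integrable N (\<lambda>x. max 1 (l\<^sup>2) * min 1 (r\<^sup>2 * (norm x)\<^sup>2))"
      using integrable_scaled_min_N by simp
    fix x show "min 1 ((l * r)\<^sup>2 * (norm x)\<^sup>2) \<le> max 1 (l\<^sup>2) * min 1 (r\<^sup>2 * (norm x)\<^sup>2)"
      using min_one_scale_le[of "l\<^sup>2" "r\<^sup>2 * (norm x)\<^sup>2"] by (simp add: power_mult_distrib mult.assoc)
  qed
  then have 1: "truncated_moment (l * r) \<le> max 1 (l\<^sup>2) * truncated_moment r"
    by (simp add: truncated_moment_def)
  have 2: "\<eta> * (l * r)\<^sup>2 \<le> max 1 (l\<^sup>2) * (\<eta> * r\<^sup>2)"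
  proof -
    have "l\<^sup>2 * (\<eta> * r\<^sup>2) \<le> max 1 (l\<^sup>2) * (\<eta> * r\<^sup>2)"
      using eta_nonneg by (intro mult_right_mono) auto
    then show ?thesis by (simp add: power_mult_distrib mult_ac)
  qed
  have "0 \<le> max 1 (l\<^sup>2) * (\<eta> * r\<^sup>2)" using eta_nonneg by (intro mult_nonneg_nonneg) auto
  then have "profile (l * r) \<le> 2 * (max 1 (l\<^sup>2) * (truncated_moment r + \<eta> * r\<^sup>2))"
    using psi_le_truncated_moment[of "l * r"] 1 2 by (simp add: distrib_left)
  also have "\<dots> \<le> 2 * (max 1 (l\<^sup>2) * (5 * DIM('a) * profile r))"
    using truncated_moment_le_psi[OF r] by (intro mult_left_mono) auto
  finally show ?thesis by (simp add: doubling_const_def mult_ac)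
qed

lemma profile_mono_up_to_const:
  assumes "0 < s" "s \<le> r"
  shows "profile s \<le> doubling_const * profile r"
proof -
  have "(s / r)\<^sup>2 \<le> 1" using assms by (intro power_le_one) auto
  then show ?thesis using profile_scale_le[of r "s / r"] assms by (simp add: max_def split: if_splits)
qed

text \<open>If $\psi$ vanishes at one positive radius, then by \<open>profile_scale_le\<close> it vanishes everywhere.\<close>

lemma profile_pos:
  assumes "profile r0 > 0" "r0 > 0" "r > 0"
  shows "profile r > 0"
proof (rule ccontr)
  assume "\<not> ?thesis"
  then have "profile r = 0" using profile_nonneg[of r] by simp
  then show False using profile_scale_le[of r "r0 / r"] assms by simp
qed

lemma profile_zero: "profile 0 = 0"
  by (simp add: radial_profile_def psi_eq)

text \<open>Dominated convergence in the Levy-Khintchine formula.\<close>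

lemma continuous_psi: "continuous_on UNIV \<psi>"
proof (unfold continuous_on_sequentially comp_def, intro ballI allI impI, elim conjE)
  fix \<xi> :: "nat \<Rightarrow> 'a" and \<zeta> assume "\<xi> \<longlonglongrightarrow> \<zeta>"
  then obtain B where B: "\<And>n. norm (\<xi> n) \<le> B" 
    using convergent_imp_Bseq[of \<xi>] by (auto simp: convergent_def Bseq_def)
  have "(\<lambda>n. \<integral>x. (1 - cos (\<xi> n \<bullet> x)) \<partial>N) \<longlonglongrightarrow> (\<integral>x. (1 - cos (\<zeta> \<bullet> x)) \<partial>N)"
  proof (rule integral_dominated_convergence)
    show "integrable N (\<lambda>x. 2 * min 1 (B\<^sup>2 * (norm x)\<^sup>2))"
      using integrable_scaled_min_N[of B] by simp
    show "AE x in N. (\<lambda>n. 1 - cos (\<xi> n \<bullet> x)) \<longlonglongrightarrow> 1 - cos (\<zeta> \<bullet> x)"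
      by (intro always_eventually allI tendsto_intros \<open>\<xi> \<longlonglongrightarrow> \<zeta>\<close>)
    show "AE x in N. norm (1 - cos (\<xi> n \<bullet> x)) \<le> 2 * min 1 (B\<^sup>2 * (norm x)\<^sup>2)" for n
    proof (intro always_eventually allI)
      fix x :: 'a
      have "(norm (\<xi> n))\<^sup>2 * (norm x)\<^sup>2 \<le> B\<^sup>2 * (norm x)\<^sup>2"
        using B by (intro mult_right_mono power_mono) auto
      then show "norm (1 - cos (\<xi> n \<bullet> x)) \<le> 2 * min 1 (B\<^sup>2 * (norm x)\<^sup>2)"
        using one_minus_cos_inner_le[of "\<xi> n" x] by simp
    qed
  qed auto
  then show "(\<lambda>n. \<psi> (\<xi> n)) \<longlonglongrightarrow> \<psi> \<zeta>"
    unfolding psi_eq by (intro tendsto_intros \<open>\<xi> \<longlonglongrightarrow> \<zeta>\<close>)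
qed

lemma psi_measurable [measurable]: "\<psi> \<in> borel_measurable borel"
  by (intro borel_measurable_continuous_onI continuous_psi)

lemma continuous_profile: "continuous_on UNIV profile"
  unfolding radial_profile_axis_vector[abs_def]
  by (intro continuous_on_compose2[OF continuous_psi] continuous_intros) auto

lemma profile_measurable [measurable]: "profile \<in> borel_measurable borel"
  by (intro borel_measurable_continuous_onI continuous_profile)

end

section \<open>The Gaussian distribution\<close>

text \<open>Only two features matter: the Fourier transform is a function of the norm and is
multiplicative in the square of the norm, so that its dilates become the powers of one variable.\<close>

definition gaussian :: "'a::euclidean_space measure" where
  "gaussian = distr (\<Pi>\<^sub>M b\<in>Basis. std_normal_distribution) borel (\<lambda>f. \<Sum>b\<in>Basis. f b *\<^sub>R b)"

lemma sets_gaussian [measurable_cong, simp]: "sets gaussian = sets borel"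
  and space_gaussian [simp]: "space gaussian = UNIV"
  by (simp_all add: gaussian_def)

lemma prob_space_std_normal: "prob_space std_normal_distribution"
  using real_dist_normal_dist by (simp add: real_distribution_def)

lemma sum_basis_measurable [measurable]:
  "(\<lambda>f. \<Sum>b\<in>Basis. f b *\<^sub>R b) \<in> (\<Pi>\<^sub>M b\<in>(Basis::'a::euclidean_space set). std_normal_distribution) \<rightarrow>\<^sub>M borel"
proof (intro borel_measurable_sum borel_measurable_scaleR)
  fix b :: 'a assume b: "b \<in> Basis"
  have "(\<lambda>f. f b) \<in> (\<Pi>\<^sub>M b\<in>(Basis::'a set). std_normal_distribution) \<rightarrow>\<^sub>M std_normal_distribution"
    by (rule measurable_component_singleton[OF b])
  then show "(\<lambda>f. f b) \<in> borel_measurable (\<Pi>\<^sub>M b\<in>(Basis::'a set). std_normal_distribution)"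
    by (simp cong: measurable_cong_sets)
qed simp

lemma prob_space_gaussian: "prob_space (gaussian :: 'a::euclidean_space measure)"
  unfolding gaussian_def
  by (intro prob_space.prob_space_distr prob_space_PiM prob_space_std_normal sum_basis_measurable)

lemma gaussian_iexp:
  "(\<integral>x. iexp (\<xi> \<bullet> x) \<partial>gaussian) = complex_of_real (exp (- (norm \<xi>)\<^sup>2 / 2))"
  for \<xi> :: "'a::euclidean_space"
proof -
  interpret prob_space std_normal_distribution by (rule prob_space_std_normal)
  interpret product_sigma_finite "\<lambda>_::'a. std_normal_distribution" by standard
  have "(\<integral>x. iexp (\<xi> \<bullet> x) \<partial>gaussian)
      = (\<integral>f. iexp (\<xi> \<bullet> (\<Sum>b\<in>Basis. f b *\<^sub>R b)) \<partial>(\<Pi>\<^sub>M b\<in>(Basis::'a set). std_normal_distribution))"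
    unfolding gaussian_def by (rule integral_distr) simp_all
  also have "\<dots> = (\<integral>f. (\<Prod>b\<in>Basis. iexp ((\<xi> \<bullet> b) * f b)) \<partial>(\<Pi>\<^sub>M b\<in>(Basis::'a set). std_normal_distribution))"
    by (intro Bochner_Integration.integral_cong refl)
      (simp add: inner_sum_right exp_sum[symmetric] sum_distrib_left of_real_sum mult.commute)
  also have "\<dots> = (\<Prod>b\<in>(Basis::'a set). \<integral>y. iexp ((\<xi> \<bullet> b) * y) \<partial>std_normal_distribution)"
    by (rule product_integral_prod) (auto intro!: integrable_iexp)
  also have "\<dots> = (\<Prod>b\<in>(Basis::'a set). complex_of_real (exp (- (\<xi> \<bullet> b)\<^sup>2 / 2)))"
    using char_std_normal_distribution by (intro prod.cong refl) (simp add: char_def fun_eq_iff)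
  also have "\<dots> = complex_of_real (exp (\<Sum>b\<in>Basis. - (\<xi> \<bullet> b)\<^sup>2 / 2))"
    by (simp add: exp_sum)
  also have "(\<Sum>b\<in>Basis. - (\<xi> \<bullet> b)\<^sup>2 / 2) = - (norm \<xi>)\<^sup>2 / 2"
    unfolding power2_norm_eq_inner
    by (subst euclidean_inner) (simp add: power2_eq_square sum_negf sum_divide_distrib[symmetric])
  finally show ?thesis .
qed

lemma integral_cos_eq_Re:
  fixes \<mu> :: "'a::euclidean_space measure"
  assumes "prob_space \<mu>" and [measurable_cong]: "sets \<mu> = sets borel"
  shows "(\<integral>x. cos (\<xi> \<bullet> x) \<partial>\<mu>) = Re (\<integral>x. iexp (\<xi> \<bullet> x) \<partial>\<mu>)"
proof -
  interpret prob_space \<mu> by fact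
  have "integrable \<mu> (\<lambda>x. iexp (\<xi> \<bullet> x))"
    by (intro integrable_iexp) simp_all
  from integral_Re[OF this] show ?thesis by (simp add: Re_exp)
qed

lemma gaussian_cos: "(\<integral>y. cos (s * (x \<bullet> y)) \<partial>gaussian) = exp (- s\<^sup>2 * (norm x)\<^sup>2 / 2)"
  for x :: "'a::euclidean_space"
proof -
  have "(\<integral>y. cos (s * (x \<bullet> y)) \<partial>gaussian) = Re (\<integral>y. iexp ((s *\<^sub>R x) \<bullet> y) \<partial>gaussian)"
    using integral_cos_eq_Re[OF prob_space_gaussian, of "s *\<^sub>R x"] by simp
  then show ?thesis unfolding gaussian_iexp by (simp add: power_mult_distrib)
qed

lemma integrable_gaussian_norm_square: "integrable gaussian (\<lambda>x::'a::euclidean_space. (norm x)\<^sup>2)"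
proof -
  interpret prob_space std_normal_distribution by (rule prob_space_std_normal)
  interpret product_prob_space "\<lambda>_::'a. std_normal_distribution" "Basis :: 'a set" by (rule product_prob_spaceI) (rule prob_space_std_normal)
  let ?P = "\<Pi>\<^sub>M b\<in>(Basis::'a set). std_normal_distribution"
  have "integrable ?P (\<lambda>f. (f b)\<^sup>2)" if b: "b \<in> (Basis::'a set)" for b
  proof -
    have "integrable (distr ?P std_normal_distribution (\<lambda>f. f b)) (\<lambda>y. y\<^sup>2)"
      unfolding PiM_component[OF b] by (rule integrable_std_normal_distribution_moment)
    then show ?thesis
      by (rule integrable_distr[OF measurable_component_singleton[OF b]])
  qed
  then have "integrable ?P (\<lambda>f. \<Sum>b\<in>(Basis::'a set). (f b)\<^sup>2)"
    by (intro Bochner_Integration.integrable_sum)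
  also have "(\<lambda>f. \<Sum>b\<in>(Basis::'a set). (f b)\<^sup>2) = (\<lambda>f. (norm (\<Sum>b\<in>(Basis::'a set). f b *\<^sub>R b))\<^sup>2)"
  proof
    fix f :: "'a \<Rightarrow> real"
    show "(\<Sum>b\<in>(Basis::'a set). (f b)\<^sup>2) = (norm (\<Sum>b\<in>(Basis::'a set). f b *\<^sub>R b))\<^sup>2"
      unfolding power2_norm_eq_inner
      by (subst euclidean_inner) (simp add: power2_eq_square inner_sum_left_Basis)
  qed
  finally show ?thesis
    unfolding gaussian_def by (subst integrable_distr_eq) auto
qed

text \<open>Otherwise the characteristic function would be constant.\<close>

lemma gaussian_not_AE_zero: "\<not> (AE x in gaussian. x = (0::'a::euclidean_space))"
proof
  assume *: "AE x in gaussian. x = (0::'a)"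
  interpret prob_space "gaussian :: 'a measure" by (rule prob_space_gaussian)
  have "(\<integral>(y::'a). cos (1 * (axis_vector \<bullet> y)) \<partial>gaussian) = (\<integral>(y::'a). 1 \<partial>gaussian)"
    by (rule integral_cong_AE) (use * in auto)
  then have "exp (- 1 / 2) = (1::real)"
    unfolding gaussian_cos by (simp add: prob_space[unfolded space_gaussian])
  then show False by simp
qed

lemma integrable_gaussian_max: "integrable gaussian (\<lambda>y::'a::euclidean_space. a * max 1 (b * (norm y)\<^sup>2))"
proof (rule integrable_mult_right, rule Bochner_Integration.integrable_bound)
  interpret prob_space "gaussian :: 'a measure" by (rule prob_space_gaussian)
  show "integrable gaussian (\<lambda>y::'a. 1 + \<bar>b\<bar> * (norm y)\<^sup>2)"
    by (intro Bochner_Integration.integrable_add integrable_const integrable_mult_right integrable_gaussian_norm_square)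
  show "AE y in gaussian. norm (max 1 (b * (norm (y::'a))\<^sup>2)) \<le> norm (1 + \<bar>b\<bar> * (norm y)\<^sup>2)"
  proof (intro always_eventually allI)
    fix y :: 'a
    have "0 \<le> \<bar>b\<bar> * (norm y)\<^sup>2" "b * (norm y)\<^sup>2 \<le> \<bar>b\<bar> * (norm y)\<^sup>2"
      by (auto intro: mult_right_mono)
    then show "norm (max 1 (b * (norm y)\<^sup>2)) \<le> norm (1 + \<bar>b\<bar> * (norm y)\<^sup>2)" by (simp add: max_def)
  qed
qed auto

section \<open>Convergence of exponential moments\<close>

text \<open>Since $v^k (1 - v) = (1 - v^{k+1}) - (1 - v^k)$, the integrals of all monomials against the weight $1 - v$
converge; linear combinations give all polynomials, and the Weierstrass theorem gives all
continuous functions, because the weights have bounded total mass.  The term $a \phi(1)$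
accounts for mass that concentrates at the value $1$ in the limit.\<close>

lemma moment_convergence:
  fixes P :: "nat \<Rightarrow> 'a::euclidean_space measure" and v :: "nat \<Rightarrow> 'a \<Rightarrow> real" and \<tau> :: "nat \<Rightarrow> real"
    and m :: "'a measure" and w :: "'a \<Rightarrow> real" and a :: real and \<phi> :: "real \<Rightarrow> real"
  assumes fin: "\<And>n. finite_measure (P n)"
    and v[measurable]: "\<And>n. v n \<in> borel_measurable (P n)" and v01: "\<And>n x. 0 \<le> v n x" "\<And>n x. v n x \<le> 1"
    and \<tau>: "\<And>n. \<tau> n > 0"
    and w[measurable]: "w \<in> borel_measurable m" and w01: "\<And>x. 0 \<le> w x" "\<And>x. w x \<le> 1"
    and int: "integrable m (\<lambda>x. 1 - w x)" and a: "0 \<le> a"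
    and lim: "\<And>k::nat. (\<lambda>n. (\<integral>x. (1 - v n x ^ k) \<partial>P n) / \<tau> n) \<longlonglongrightarrow> (\<integral>x. (1 - w x ^ k) \<partial>m) + a * k"
    and \<phi>: "continuous_on {0..1} \<phi>"
    and \<phi>v: "\<And>n. (\<lambda>x. \<phi> (v n x)) \<in> borel_measurable (P n)" and \<phi>w: "(\<lambda>x. \<phi> (w x)) \<in> borel_measurable m"
  shows "(\<lambda>n. (\<integral>x. \<phi> (v n x) * (1 - v n x) \<partial>P n) / \<tau> n) \<longlonglongrightarrow> (\<integral>x. \<phi> (w x) * (1 - w x) \<partial>m) + a * \<phi> 1"
proof -
  define L where "L n f = (\<integral>x. f (v n x) * (1 - v n x) \<partial>P n) / \<tau> n" for n f
  define Linf where "Linf f = (\<integral>x. f (w x) * (1 - w x) \<partial>m) + a * f 1" for f :: "real \<Rightarrow> real"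
  have iP: "integrable (P n) (\<lambda>x. f (v n x) * (1 - v n x))"
    if f: "(\<lambda>x. f (v n x)) \<in> borel_measurable (P n)" and B: "\<And>y. y \<in> {0..1} \<Longrightarrow> \<bar>f y\<bar> \<le> B" for f B n
  proof -
    interpret finite_measure "P n" by (rule fin)
    have "\<bar>f (v n x) * (1 - v n x)\<bar> \<le> B" for x
    proof -
      have "\<bar>f (v n x)\<bar> * \<bar>1 - v n x\<bar> \<le> B * 1"
        using v01[of n x] B[of "v n x"] by (intro mult_mono) auto
      then show ?thesis by (simp add: abs_mult)
    qed
    then show ?thesis using f by (intro integrable_const_bound[where B=B]) auto
  qed
  have im: "integrable m (\<lambda>x. f (w x) * (1 - w x))"
    if f: "(\<lambda>x. f (w x)) \<in> borel_measurable m" and B: "\<And>y. y \<in> {0..1} \<Longrightarrow> \<bar>f y\<bar> \<le> B" for f :: "real \<Rightarrow> real" and B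
  proof (rule Bochner_Integration.integrable_bound)
    show "integrable m (\<lambda>x. B * (1 - w x))" using int by simp
    show "(\<lambda>x. f (w x) * (1 - w x)) \<in> borel_measurable m" using f by simp
    show "AE x in m. norm (f (w x) * (1 - w x)) \<le> norm (B * (1 - w x))"
    proof (intro always_eventually allI)
      fix x
      have "\<bar>f (w x)\<bar> * \<bar>1 - w x\<bar> \<le> \<bar>B\<bar> * \<bar>1 - w x\<bar>"
        using w01[of x] B[of "w x"] by (intro mult_right_mono) auto
      then show "norm (f (w x) * (1 - w x)) \<le> norm (B * (1 - w x))" by (simp add: abs_mult)
    qed
  qed
  have pw1: "\<bar>y ^ k\<bar> \<le> 1" if "y \<in> {0..1}" for y :: real and k
    using that by (auto simp: power_abs intro: power_le_one)
  have imk: "integrable m (\<lambda>x. 1 - w x ^ k)" for k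
  proof (induction k)
    case (Suc k)
    have "integrable m (\<lambda>x. (1 - w x ^ k) + w x ^ k * (1 - w x))"
      by (intro Bochner_Integration.integrable_add Suc im[where f="\<lambda>y. y ^ k", OF _ pw1]) auto
    then show ?case by (simp add: algebra_simps)
  qed simp
  have monom: "(\<lambda>n. L n (\<lambda>y. y ^ k)) \<longlonglongrightarrow> Linf (\<lambda>y. y ^ k)" for k
  proof -
    have e: "L n (\<lambda>y. y ^ k) = (\<integral>x. (1 - v n x ^ Suc k) \<partial>P n) / \<tau> n - (\<integral>x. (1 - v n x ^ k) \<partial>P n) / \<tau> n" for n
    proof -
      interpret finite_measure "P n" by (rule fin)
      have i: "integrable (P n) (\<lambda>x. 1 - v n x ^ j)" for j
        using v01 by (intro integrable_const_bound[where B=1]) (auto simp: power_le_one)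
      have "(\<integral>x. v n x ^ k * (1 - v n x) \<partial>P n) = (\<integral>x. (1 - v n x ^ Suc k) - (1 - v n x ^ k) \<partial>P n)"
        by (intro Bochner_Integration.integral_cong refl) (simp add: algebra_simps)
      also have "\<dots> = (\<integral>x. (1 - v n x ^ Suc k) \<partial>P n) - (\<integral>x. (1 - v n x ^ k) \<partial>P n)"
        by (rule Bochner_Integration.integral_diff[OF i i])
      finally show ?thesis by (simp add: L_def diff_divide_distrib)
    qed
    have "(\<integral>x. w x ^ k * (1 - w x) \<partial>m) = (\<integral>x. (1 - w x ^ Suc k) - (1 - w x ^ k) \<partial>m)"
      by (intro Bochner_Integration.integral_cong refl) (simp add: algebra_simps)
    also have "\<dots> = (\<integral>x. (1 - w x ^ Suc k) \<partial>m) - (\<integral>x. (1 - w x ^ k) \<partial>m)"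
      by (rule Bochner_Integration.integral_diff[OF imk imk])
    finally have "Linf (\<lambda>y. y ^ k) = ((\<integral>x. (1 - w x ^ Suc k) \<partial>m) + a * real (Suc k)) - ((\<integral>x. (1 - w x ^ k) \<partial>m) + a * real k)"
      by (simp add: Linf_def algebra_simps)
    then show ?thesis unfolding e using tendsto_diff[OF lim[of "Suc k"] lim[of k]] by simp
  qed
  have poly: "(\<lambda>n. L n g) \<longlonglongrightarrow> Linf g" if "g = (\<lambda>y. \<Sum>i\<le>d. q i * y ^ i)" for g d and q :: "nat \<Rightarrow> real"
  proof -
    have 1: "L n g = (\<Sum>i\<le>d. q i * L n (\<lambda>y. y ^ i))" for n
    proof -
      have "(\<integral>x. g (v n x) * (1 - v n x) \<partial>P n) = (\<integral>x. (\<Sum>i\<le>d. q i * (v n x ^ i * (1 - v n x))) \<partial>P n)"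
        by (simp add: that sum_distrib_right mult.assoc)
      also have "\<dots> = (\<Sum>i\<le>d. q i * (\<integral>x. v n x ^ i * (1 - v n x) \<partial>P n))"
        by (subst Bochner_Integration.integral_sum) (auto intro!: integrable_mult_right iP[where f="\<lambda>y. y ^ i" for i, OF _ pw1])
      finally show ?thesis by (simp add: L_def sum_divide_distrib)
    qed
    have 2: "Linf g = (\<Sum>i\<le>d. q i * Linf (\<lambda>y. y ^ i))"
    proof -
      have "(\<integral>x. g (w x) * (1 - w x) \<partial>m) = (\<integral>x. (\<Sum>i\<le>d. q i * (w x ^ i * (1 - w x))) \<partial>m)"
        by (simp add: that sum_distrib_right mult.assoc)
      also have "\<dots> = (\<Sum>i\<le>d. q i * (\<integral>x. w x ^ i * (1 - w x) \<partial>m))"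
        by (subst Bochner_Integration.integral_sum) (auto intro!: integrable_mult_right im[where f="\<lambda>y. y ^ i" for i, OF _ pw1])
      finally show ?thesis by (simp add: Linf_def that distrib_left sum.distrib sum_distrib_left mult_ac)
    qed
    show ?thesis unfolding 1 2 by (intro tendsto_intros monom)
  qed
  obtain M where M: "\<And>y. y \<in> {0..1} \<Longrightarrow> \<bar>\<phi> y\<bar> \<le> M"
  proof -
    have "bounded (\<phi> ` {0..1})" by (intro compact_imp_bounded compact_continuous_image \<phi>) simp
    then obtain M where "\<forall>y\<in>{0..1}. \<bar>\<phi> y\<bar> \<le> M" by (auto simp: bounded_iff)
    then show ?thesis using that[of M] by blast
  qed
  have one: "Linf (\<lambda>y. y ^ 0) \<ge> 0"
    unfolding Linf_def using a w01 by (intro add_nonneg_nonneg Bochner_Integration.integral_nonneg) auto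
  have "(\<lambda>n. L n \<phi>) \<longlonglongrightarrow> Linf \<phi>"
  proof (rule LIMSEQ_I)
    fix e :: real assume e: "e > 0"
    define K where "K = Linf (\<lambda>y. y ^ 0) + 1"
    have K: "K > 0" using one by (simp add: K_def)
    define d where "d = e / (3 * K)"
    have d: "d > 0" using e K by (simp add: d_def)
    obtain g where g: "real_polynomial_function g" and gd: "\<And>y. y \<in> {0..1} \<Longrightarrow> \<bar>\<phi> y - g y\<bar> < d"
      using Stone_Weierstrass_real_polynomial_function[OF compact_Icc \<phi> d] by metis
    obtain q D where gq: "g = (\<lambda>y. \<Sum>i\<le>D. q i * y ^ i)"
      using g unfolding real_polynomial_function_iff_sum by blast
    have gcont: "continuous_on UNIV g" unfolding gq by (intro continuous_intros)
    then have [measurable]: "g \<in> borel_measurable borel" by (rule borel_measurable_continuous_onI)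
    have gM: "\<bar>g y\<bar> \<le> M + d" if "y \<in> {0..1}" for y using gd[OF that] M[OF that] by linarith
    have near: "\<bar>L n \<phi> - L n g\<bar> \<le> d * L n (\<lambda>y. y ^ 0)" for n
    proof -
      have i1: "integrable (P n) (\<lambda>x. \<phi> (v n x) * (1 - v n x))" by (rule iP[OF \<phi>v M])
      have i2: "integrable (P n) (\<lambda>x. g (v n x) * (1 - v n x))" by (rule iP[OF _ gM]) auto
      have i3: "integrable (P n) (\<lambda>x. v n x ^ 0 * (1 - v n x))" by (rule iP[where f="\<lambda>y. y ^ 0", OF _ pw1]) auto
      have "\<bar>\<integral>x. \<phi> (v n x) * (1 - v n x) - g (v n x) * (1 - v n x) \<partial>P n\<bar> \<le> (\<integral>x. d * (v n x ^ 0 * (1 - v n x)) \<partial>P n)"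
      proof (rule integral_abs_bound_integral)
        show "integrable (P n) (\<lambda>x. \<phi> (v n x) * (1 - v n x) - g (v n x) * (1 - v n x))" using i1 i2 by simp
        show "integrable (P n) (\<lambda>x. d * (v n x ^ 0 * (1 - v n x)))" using i3 by (rule integrable_mult_right)
        fix x
        have "\<bar>\<phi> (v n x) - g (v n x)\<bar> * (1 - v n x) \<le> d * (1 - v n x)"
          using gd[of "v n x"] v01[of n x] by (intro mult_right_mono) auto
        then show "\<bar>\<phi> (v n x) * (1 - v n x) - g (v n x) * (1 - v n x)\<bar> \<le> d * (v n x ^ 0 * (1 - v n x))"
          using v01[of n x] by (simp add: left_diff_distrib[symmetric] abs_mult)
      qed
      then have "\<bar>(\<integral>x. \<phi> (v n x) * (1 - v n x) \<partial>P n) - (\<integral>x. g (v n x) * (1 - v n x) \<partial>P n)\<bar> \<le> d * (\<integral>x. v n x ^ 0 * (1 - v n x) \<partial>P n)"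
        using i1 i2 by (simp add: Bochner_Integration.integral_diff)
      then show ?thesis using \<tau>[of n]
        by (simp add: L_def diff_divide_distrib[symmetric] abs_divide divide_right_mono)
    qed
    have near': "\<bar>Linf \<phi> - Linf g\<bar> \<le> d * Linf (\<lambda>y. y ^ 0)"
    proof -
      have i1: "integrable m (\<lambda>x. \<phi> (w x) * (1 - w x))" by (rule im[OF \<phi>w M])
      have i2: "integrable m (\<lambda>x. g (w x) * (1 - w x))" by (rule im[OF _ gM]) auto
      have "\<bar>\<integral>x. \<phi> (w x) * (1 - w x) - g (w x) * (1 - w x) \<partial>m\<bar> \<le> (\<integral>x. d * (1 - w x) \<partial>m)"
      proof (rule integral_abs_bound_integral)
        show "integrable m (\<lambda>x. \<phi> (w x) * (1 - w x) - g (w x) * (1 - w x))" using i1 i2 by simp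
        show "integrable m (\<lambda>x. d * (1 - w x))" using int by simp
        fix x
        have "\<bar>\<phi> (w x) - g (w x)\<bar> * (1 - w x) \<le> d * (1 - w x)"
          using gd[of "w x"] w01[of x] by (intro mult_right_mono) auto
        then show "\<bar>\<phi> (w x) * (1 - w x) - g (w x) * (1 - w x)\<bar> \<le> d * (1 - w x)"
          using w01[of x] by (simp add: left_diff_distrib[symmetric] abs_mult)
      qed
      then have 1: "\<bar>(\<integral>x. \<phi> (w x) * (1 - w x) \<partial>m) - (\<integral>x. g (w x) * (1 - w x) \<partial>m)\<bar> \<le> d * (\<integral>x. 1 - w x \<partial>m)"
        using i1 i2 by (simp add: Bochner_Integration.integral_diff)
      have "a * \<bar>\<phi> 1 - g 1\<bar> \<le> a * d" using gd[of 1] a by (intro mult_left_mono) auto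
      then have 2: "\<bar>a * \<phi> 1 - a * g 1\<bar> \<le> d * a" using a by (simp add: right_diff_distrib[symmetric] abs_mult mult.commute)
      show ?thesis using 1 2 unfolding Linf_def by (simp add: distrib_left)
    qed
    have ev1: "\<forall>\<^sub>F n in sequentially. L n (\<lambda>y. y ^ 0) < K"
      using order_tendstoD(2)[OF monom[of 0], of K] by (simp add: K_def)
    have ev2: "\<forall>\<^sub>F n in sequentially. \<bar>L n g - Linf g\<bar> < d * K"
      using poly[OF gq] d K unfolding tendsto_iff by (simp add: dist_real_def)
    have dK: "3 * (d * K) = e" using K by (simp add: d_def)
    have "\<forall>\<^sub>F n in sequentially. norm (L n \<phi> - Linf \<phi>) < e"
      using ev1 ev2
    proof eventually_elim
      case (elim n)
      have "d * L n (\<lambda>y. y ^ 0) \<le> d * K" "d * Linf (\<lambda>y. y ^ 0) \<le> d * K"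
        using elim d by (auto intro!: mult_left_mono simp: K_def)
      then show ?case using near[of n] near' elim(2) dK unfolding real_norm_def by linarith
    qed
    then show "\<exists>no. \<forall>n\<ge>no. norm (L n \<phi> - Linf \<phi>) < e" by (simp add: eventually_sequentially)
  qed
  then show ?thesis by (simp add: L_def Linf_def)
qed

section \<open>Radial bumps and unimodal densities\<close>

text \<open>The endpoints are those of the image of the shell $a < |y| < b$ under $y \mapsto e^{-|y|^2}$.\<close>

definition tent :: "real \<Rightarrow> real \<Rightarrow> real \<Rightarrow> real" where
  "tent a b v = max 0 (min (v - exp (- b\<^sup>2)) (exp (- a\<^sup>2) - v))"

text \<open>The factor $1 - e^{-|y|^2}$ brings the bump into the form required by \<open>moment_convergence\<close>; the bump
is supported by the shell $a < |y| < b$.\<close>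

definition bump :: "real \<Rightarrow> real \<Rightarrow> 'a::euclidean_space \<Rightarrow> real" where
  "bump a b y = tent a b (exp (- (norm y)\<^sup>2)) * (1 - exp (- (norm y)\<^sup>2))"

lemma continuous_tent: "continuous_on S (tent a b)"
  unfolding tent_def[abs_def] by (intro continuous_intros)

lemma tent_measurable [measurable]: "tent a b \<in> borel_measurable borel"
  by (intro borel_measurable_continuous_onI continuous_tent)

lemma tent_one: "tent a b 1 = 0"
proof -
  have "exp (- a\<^sup>2) \<le> 1" by simp
  then have "min (1 - exp (- b\<^sup>2)) (exp (- a\<^sup>2) - 1) \<le> 0" unfolding min_le_iff_disj by linarith
  then show ?thesis by (simp add: tent_def max_absorb1)
qed

lemma bump_measurable [measurable]: "bump a b \<in> borel_measurable borel"
  unfolding bump_def[abs_def] by measurable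

lemma bump_nonneg: "0 \<le> bump a b y"
  unfolding bump_def tent_def by (intro mult_nonneg_nonneg) auto

lemma bump_le_one: "bump a b y \<le> 1"
proof -
  have "exp (- (norm y)\<^sup>2) \<le> 1" by simp
  then have "tent a b (exp (- (norm y)\<^sup>2)) \<le> 1"
    unfolding tent_def using exp_gt_zero[of "- b\<^sup>2"] by linarith
  then show ?thesis unfolding bump_def by (intro mult_le_one) (auto simp: tent_def)
qed

lemma bump_zero [simp]: "bump a b 0 = 0"
  by (simp add: bump_def)

lemma bump_eq_zero:
  assumes "0 \<le> a" "0 \<le> b" "\<not> (a < norm y \<and> norm y < b)"
  shows "bump a b y = 0"
proof -
  have "norm y \<le> a \<or> b \<le> norm y" using assms by auto
  then have "(norm y)\<^sup>2 \<le> a\<^sup>2 \<or> b\<^sup>2 \<le> (norm y)\<^sup>2" using assms by (auto intro: power_mono)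
  then have "exp (- a\<^sup>2) \<le> exp (- (norm y)\<^sup>2) \<or> exp (- (norm y)\<^sup>2) \<le> exp (- b\<^sup>2)" by simp
  then have "min (exp (- (norm y)\<^sup>2) - exp (- b\<^sup>2)) (exp (- a\<^sup>2) - exp (- (norm y)\<^sup>2)) \<le> 0"
    unfolding min_le_iff_disj by linarith
  then have "tent a b (exp (- (norm y)\<^sup>2)) = 0" by (simp add: tent_def max_absorb1)
  then show ?thesis by (simp add: bump_def)
qed

lemma bump_pos:
  assumes "0 \<le> a" "a < norm y" "norm y < b"
  shows "0 < bump a b y"
proof -
  have "a\<^sup>2 < (norm y)\<^sup>2" "(norm y)\<^sup>2 < b\<^sup>2" "0 < (norm y)\<^sup>2" using assms by (auto intro!: power_strict_mono)
  then show ?thesis by (auto simp: bump_def tent_def intro!: mult_pos_pos)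
qed

lemma nn_integral_bump:
  assumes "0 \<le> a" "a < b"
  shows "0 < (\<integral>\<^sup>+(y::'a::euclidean_space). ennreal (bump a b y) \<partial>lborel)"
    and "(\<integral>\<^sup>+(y::'a::euclidean_space). ennreal (bump a b y) \<partial>lborel) < \<infinity>"
proof -
  have "(\<integral>\<^sup>+(y::'a). ennreal (bump a b y) \<partial>lborel) \<le> (\<integral>\<^sup>+(y::'a). indicator (cball 0 b) y \<partial>lborel)"
  proof (intro nn_integral_mono)
    fix y :: 'a
    show "ennreal (bump a b y) \<le> indicator (cball 0 b) y"
    proof (cases "a < norm y \<and> norm y < b")
      case True
      then show ?thesis using bump_le_one[of a b y] by simp
    next
      case False
      then have "bump a b y = 0" using assms by (intro bump_eq_zero) auto
      then show ?thesis by simp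
    qed
  qed
  then show "(\<integral>\<^sup>+(y::'a). ennreal (bump a b y) \<partial>lborel) < \<infinity>"
    using emeasure_lborel_cball_finite[of "0::'a" b] by (simp add: less_top[symmetric] top_unique) (metis infinity_ennreal_def leD top.not_eq_extremum)
  show "0 < (\<integral>\<^sup>+(y::'a). ennreal (bump a b y) \<partial>lborel)"
  proof (rule ccontr)
    assume "\<not> ?thesis"
    then have "(\<integral>\<^sup>+(y::'a). ennreal (bump a b y) \<partial>lborel) = 0" by simp
    then have "AE y in lborel. ennreal (bump a b (y::'a)) = 0" by (subst (asm) nn_integral_0_iff_AE) auto
    then have "AE y in lborel. y \<notin> (ball 0 b - cball 0 a :: 'a set)"
    proof eventually_elim
      case (elim y)
      then have "bump a b y \<le> 0" by (simp add: ennreal_eq_0_iff)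
      then have "\<not> (a < norm y \<and> norm y < b)" using bump_pos[of a y b] assms by linarith
      then show ?case by auto
    qed
    then have "emeasure lborel (ball 0 b - cball 0 a :: 'a set) = 0"
      by (subst (asm) AE_iff_measurable[where N="ball 0 b - cball 0 a"]) auto
    moreover have "((a + b) / 2) *\<^sub>R axis_vector \<in> (ball 0 b - cball 0 a :: 'a set)" using assms by simp
    then have "emeasure lborel (ball 0 b - cball 0 a :: 'a set) > 0"
      by (intro emeasure_lborel_open_pos open_Diff open_ball closed_cball) blast
    ultimately show False by simp
  qed
qed

lemma integrable_bump_lborel:
  assumes "0 \<le> a" "a < b"
  shows "integrable lborel (bump a b :: 'a::euclidean_space \<Rightarrow> real)"
  using nn_integral_bump(2)[OF assms, where 'a='a] bump_nonneg by (intro integrableI_nonneg) auto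

lemma integral_bump_pos:
  assumes "0 \<le> a" "a < b"
  shows "0 < (\<integral>(y::'a::euclidean_space). bump a b y \<partial>lborel)"
proof -
  have "ennreal (\<integral>(y::'a). bump a b y \<partial>lborel) = (\<integral>\<^sup>+(y::'a). ennreal (bump a b y) \<partial>lborel)"
    using bump_nonneg by (intro nn_integral_eq_integral[symmetric] integrable_bump_lborel assms) auto
  then have "0 < ennreal (\<integral>(y::'a). bump a b y \<partial>lborel)" using nn_integral_bump(1)[OF assms, where 'a='a] by simp
  then show ?thesis by simp
qed

lemma integrable_bump_scaled:
  assumes "0 \<le> a" "a < b" "r > 0"
  shows "integrable lborel (\<lambda>y::'a::euclidean_space. bump a b ((1 / r) *\<^sub>R y))"
    and "(\<integral>(y::'a). bump a b ((1 / r) *\<^sub>R y) \<partial>lborel) = r ^ DIM('a) * (\<integral>(y::'a). bump a b y \<partial>lborel)"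
proof -
  define J where "J = (\<integral>(y::'a). bump a b y \<partial>lborel)"
  have J: "0 \<le> J" unfolding J_def using bump_nonneg by (intro Bochner_Integration.integral_nonneg) auto
  have "(\<integral>\<^sup>+(y::'a). ennreal (bump a b ((1 / r) *\<^sub>R y)) \<partial>lborel) = ennreal (r ^ DIM('a)) * (\<integral>\<^sup>+(y::'a). ennreal (bump a b y) \<partial>lborel)"
    using assms by (subst nn_integral_lborel_scaleR[where a=r]) auto
  also have "(\<integral>\<^sup>+(y::'a). ennreal (bump a b y) \<partial>lborel) = ennreal J"
    unfolding J_def using bump_nonneg assms by (intro nn_integral_eq_integral integrable_bump_lborel) auto
  finally have *: "(\<integral>\<^sup>+(y::'a). ennreal (bump a b ((1 / r) *\<^sub>R y)) \<partial>lborel) = ennreal (r ^ DIM('a) * J)"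
    using assms J by (simp add: ennreal_mult)
  then show "integrable lborel (\<lambda>y::'a. bump a b ((1 / r) *\<^sub>R y))"
    using bump_nonneg by (intro integrableI_nonneg) auto
  show "(\<integral>(y::'a). bump a b ((1 / r) *\<^sub>R y) \<partial>lborel) = r ^ DIM('a) * (\<integral>(y::'a). bump a b y \<partial>lborel)"
    using * J bump_nonneg assms by (subst integral_eq_nn_integral) (auto simp: J_def)
qed

text \<open>Integrals of bumps see only the values of the density on the shell that carries the bump.  Boundedness
of the density there also gives integrability, although the measure may be infinite near $0$.\<close>

lemma integral_bump_density_le:
  fixes \<mu> :: "'a::euclidean_space measure"
  assumes f: "isotropic_unimodal_density \<mu> f" and sets: "sets \<mu> = sets borel"
    and ab: "0 \<le> a" "a < b" and r: "r > 0" and \<kappa>: "0 \<le> \<kappa>"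
    and le: "\<And>y. a * r < norm y \<Longrightarrow> norm y < b * r \<Longrightarrow> f y \<le> \<kappa>"
  shows "(\<integral>y. bump a b ((1 / r) *\<^sub>R y) \<partial>\<mu>) \<le> \<kappa> * (r ^ DIM('a) * (\<integral>(y::'a). bump a b y \<partial>lborel))"
    and "integrable \<mu> (\<lambda>y. bump a b ((1 / r) *\<^sub>R y))"
proof -
  note [measurable_cong] = sets
  define J where "J = r ^ DIM('a) * (\<integral>(y::'a). bump a b y \<partial>lborel)"
  have J: "0 \<le> J" unfolding J_def using r bump_nonneg by (intro mult_nonneg_nonneg Bochner_Integration.integral_nonneg) auto
  have "(\<integral>\<^sup>+y. ennreal (bump a b ((1 / r) *\<^sub>R y)) \<partial>\<mu>) = (\<integral>\<^sup>+y. ennreal (f y) * ennreal (bump a b ((1 / r) *\<^sub>R y)) \<partial>lborel)"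
    by (rule nn_integral_isotropic_unimodal_density[OF f sets]) simp_all
  also have "\<dots> \<le> (\<integral>\<^sup>+(y::'a). ennreal \<kappa> * ennreal (bump a b ((1 / r) *\<^sub>R y)) \<partial>lborel)"
  proof (intro nn_integral_mono)
    fix y :: 'a
    show "ennreal (f y) * ennreal (bump a b ((1 / r) *\<^sub>R y)) \<le> ennreal \<kappa> * ennreal (bump a b ((1 / r) *\<^sub>R y))"
    proof (cases "a * r < norm y \<and> norm y < b * r")
      case True
      then show ?thesis using le by (intro mult_right_mono ennreal_leI) auto
    next
      case False
      then have "bump a b ((1 / r) *\<^sub>R y) = 0"
        using ab r by (intro bump_eq_zero) (auto simp: field_simps)
      then show ?thesis by simp
    qed
  qed
  also have "\<dots> = ennreal \<kappa> * (\<integral>\<^sup>+(y::'a). ennreal (bump a b ((1 / r) *\<^sub>R y)) \<partial>lborel)"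
    by (rule nn_integral_cmult) simp
  also have "\<dots> = ennreal \<kappa> * ennreal J"
    using integrable_bump_scaled[OF ab r, where 'a='a] bump_nonneg
    by (subst nn_integral_eq_integral) (auto simp: J_def)
  also have "\<dots> = ennreal (\<kappa> * J)" using \<kappa> J by (simp add: ennreal_mult)
  finally have le': "(\<integral>\<^sup>+y. ennreal (bump a b ((1 / r) *\<^sub>R y)) \<partial>\<mu>) \<le> ennreal (\<kappa> * J)" .
  show int: "integrable \<mu> (\<lambda>y. bump a b ((1 / r) *\<^sub>R y))"
    using le' bump_nonneg by (intro integrableI_nonneg) (auto intro: le_less_trans)
  have "ennreal (\<integral>y. bump a b ((1 / r) *\<^sub>R y) \<partial>\<mu>) \<le> ennreal (\<kappa> * J)"
    using le' by (subst nn_integral_eq_integral[OF int, symmetric]) (simp_all add: bump_nonneg)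
  then show "(\<integral>y. bump a b ((1 / r) *\<^sub>R y) \<partial>\<mu>) \<le> \<kappa> * (r ^ DIM('a) * (\<integral>(y::'a). bump a b y \<partial>lborel))"
    using \<kappa> J by (subst (asm) ennreal_le_iff) (auto simp: J_def)
qed

lemma integral_bump_density_ge:
  fixes \<mu> :: "'a::euclidean_space measure"
  assumes f: "isotropic_unimodal_density \<mu> f" and sets: "sets \<mu> = sets borel"
    and ab: "0 \<le> a" "a < b" and r: "r > 0" and \<kappa>: "0 \<le> \<kappa>"
    and ge: "\<And>y. a * r < norm y \<Longrightarrow> norm y < b * r \<Longrightarrow> \<kappa> \<le> f y"
    and int: "integrable \<mu> (\<lambda>y. bump a b ((1 / r) *\<^sub>R y))"
  shows "\<kappa> * (r ^ DIM('a) * (\<integral>(y::'a). bump a b y \<partial>lborel)) \<le> (\<integral>y. bump a b ((1 / r) *\<^sub>R y) \<partial>\<mu>)"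
proof -
  define J where "J = r ^ DIM('a) * (\<integral>(y::'a). bump a b y \<partial>lborel)"
  have J: "0 \<le> J" unfolding J_def using r bump_nonneg by (intro mult_nonneg_nonneg Bochner_Integration.integral_nonneg) auto
  have "ennreal (\<kappa> * J) = ennreal \<kappa> * ennreal J" using \<kappa> J by (simp add: ennreal_mult)
  also have "\<dots> = ennreal \<kappa> * (\<integral>\<^sup>+(y::'a). ennreal (bump a b ((1 / r) *\<^sub>R y)) \<partial>lborel)"
    using integrable_bump_scaled[OF ab r, where 'a='a] bump_nonneg
    by (subst nn_integral_eq_integral) (auto simp: J_def)
  also have "\<dots> = (\<integral>\<^sup>+(y::'a). ennreal \<kappa> * ennreal (bump a b ((1 / r) *\<^sub>R y)) \<partial>lborel)"
    by (rule nn_integral_cmult[symmetric]) simp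
  also have "\<dots> \<le> (\<integral>\<^sup>+y. ennreal (f y) * ennreal (bump a b ((1 / r) *\<^sub>R y)) \<partial>lborel)"
  proof (intro nn_integral_mono)
    fix y :: 'a
    show "ennreal \<kappa> * ennreal (bump a b ((1 / r) *\<^sub>R y)) \<le> ennreal (f y) * ennreal (bump a b ((1 / r) *\<^sub>R y))"
    proof (cases "a * r < norm y \<and> norm y < b * r")
      case True
      then show ?thesis using ge by (intro mult_right_mono ennreal_leI) auto
    next
      case False
      then have "bump a b ((1 / r) *\<^sub>R y) = 0"
        using ab r by (intro bump_eq_zero) (auto simp: field_simps)
      then show ?thesis by simp
    qed
  qed
  also have "\<dots> = (\<integral>\<^sup>+y. ennreal (bump a b ((1 / r) *\<^sub>R y)) \<partial>\<mu>)"
    by (rule nn_integral_isotropic_unimodal_density[OF f sets, symmetric]) simp_all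
  also have "\<dots> = ennreal (\<integral>y. bump a b ((1 / r) *\<^sub>R y) \<partial>\<mu>)"
    by (rule nn_integral_eq_integral[OF int]) (simp add: bump_nonneg)
  finally show ?thesis
    using bump_nonneg by (subst (asm) ennreal_le_iff) (auto simp: J_def intro!: Bochner_Integration.integral_nonneg)
qed

section \<open>Gaussian averages of the exponent and of the semigroup\<close>

context unimodal_exponent
begin

lemma sigma_finite_N: "sigma_finite_measure N"
proof -
  have "N = density lborel (\<lambda>x. ennreal (\<nu> x))"
  proof (rule measure_eqI)
    fix A assume "A \<in> sets N"
    then have [measurable]: "A \<in> sets borel" using sets_N by simp
    have "emeasure N A = (\<integral>\<^sup>+x. indicator A x \<partial>N)" using \<open>A \<in> sets N\<close> by simp
    also have "\<dots> = (\<integral>\<^sup>+x. ennreal (\<nu> x) * indicator A x \<partial>lborel)" by (rule nn_integral_N) simp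
    finally show "emeasure N A = emeasure (density lborel (\<lambda>x. ennreal (\<nu> x))) A"
      by (simp add: emeasure_density)
  qed (simp add: sets_N)
  moreover have "sigma_finite_measure (density lborel (\<lambda>x. ennreal (\<nu> x)))"
    by (subst sigma_finite_measure.sigma_finite_iff_density_finite[OF sigma_finite_lborel]) auto
  ultimately show ?thesis by simp
qed

lemma psi_scaled_bound:
  assumes "s > 0"
  shows "\<psi> (s *\<^sub>R y) \<le> doubling_const * profile s * max 1 (1 * (norm y)\<^sup>2)"
proof (cases "y = 0")
  case True
  then show ?thesis using profile_nonneg doubling_const_ge by (simp add: psi_eq)
next
  case False
  then show ?thesis
    using profile_scale_le[of s "norm y"] assms by (simp add: psi_eq_profile mult_ac)
qed

lemma integrable_gaussian_psi:
  assumes "s > 0"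
  shows "integrable gaussian (\<lambda>y. \<psi> (s *\<^sub>R y))"
proof (rule Bochner_Integration.integrable_bound)
  show "integrable gaussian (\<lambda>y::'a. doubling_const * profile s * max 1 (1 * (norm y)\<^sup>2))"
    by (rule integrable_gaussian_max)
  show "AE y in gaussian. norm (\<psi> (s *\<^sub>R y)) \<le> norm (doubling_const * profile s * max 1 (1 * (norm y)\<^sup>2))"
  proof (intro always_eventually allI)
    fix y
    have "\<psi> (s *\<^sub>R y) \<le> \<bar>doubling_const * profile s * max 1 (1 * (norm y)\<^sup>2)\<bar>"
      using psi_scaled_bound[OF assms, of y] by linarith
    then show "norm (\<psi> (s *\<^sub>R y)) \<le> norm (doubling_const * profile s * max 1 (1 * (norm y)\<^sup>2))"
      using psi_nonneg[of "s *\<^sub>R y"] by simp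
  qed
qed auto

lemma integrable_one_minus_exp_N: "integrable N (\<lambda>x. 1 - exp (- (b * (norm x)\<^sup>2)))" if b: "0 \<le> b"
proof (rule Bochner_Integration.integrable_bound)
  show "integrable N (\<lambda>x. max 1 b * min 1 ((norm x)\<^sup>2))" using integrable_min_N by simp
  show "AE x in N. norm (1 - exp (- (b * (norm x)\<^sup>2))) \<le> norm (max 1 b * min 1 ((norm x)\<^sup>2))"
  proof (intro always_eventually allI)
    fix x :: 'a
    have "1 - exp (- (b * (norm x)\<^sup>2)) \<le> min 1 (b * (norm x)\<^sup>2)"
      using exp_ge_add_one_self[of "- (b * (norm x)\<^sup>2)"] exp_gt_zero[of "- (b * (norm x)\<^sup>2)"] by linarith
    also have "\<dots> \<le> max 1 b * min 1 ((norm x)\<^sup>2)" by (rule min_one_scale_le[OF b]) simp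
    finally have "1 - exp (- (b * (norm x)\<^sup>2)) \<le> max 1 b * min 1 ((norm x)\<^sup>2)" .
    moreover have "0 \<le> 1 - exp (- (b * (norm x)\<^sup>2))" using b by simp
    ultimately show "norm (1 - exp (- (b * (norm x)\<^sup>2))) \<le> norm (max 1 b * min 1 ((norm x)\<^sup>2))" by simp
  qed
qed auto

text \<open>Tonelli's theorem for $1 - \cos\langle sy, x\rangle$ on the product of the Gaussian and the Levy measure.\<close>

lemma gaussian_average_psi:
  assumes s: "s > 0"
  shows "(\<integral>y. \<psi> (s *\<^sub>R y) \<partial>gaussian)
    = (\<integral>x. (1 - exp (- (s\<^sup>2 / 2 * (norm x)\<^sup>2))) \<partial>N) + \<eta> * s\<^sup>2 * (\<integral>(y::'a). (norm y)\<^sup>2 \<partial>gaussian)"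
proof -
  interpret N: sigma_finite_measure N by (rule sigma_finite_N)
  interpret gauss: prob_space "gaussian :: 'a measure" by (rule prob_space_gaussian)
  interpret NG: pair_sigma_finite N "gaussian :: 'a measure" ..
  define q where "q y = \<psi> (s *\<^sub>R y) - \<eta> * s\<^sup>2 * (norm y)\<^sup>2" for y
  have q: "q y = (\<integral>x. (1 - cos ((s *\<^sub>R y) \<bullet> x)) \<partial>N)" for y
    using s by (simp add: q_def psi_eq power_mult_distrib)
  have q0: "0 \<le> q y" for y unfolding q by (intro Bochner_Integration.integral_nonneg) auto
  have iq: "integrable gaussian q"
    unfolding q_def[abs_def]
    by (intro Bochner_Integration.integrable_diff integrable_gaussian_psi s integrable_mult_right integrable_gaussian_norm_square)
  have [measurable]: "(\<lambda>z. ennreal (1 - cos (s * (fst z \<bullet> snd z)))) \<in> borel_measurable (N \<Otimes>\<^sub>M (gaussian :: 'a measure))"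
    by measurable
  have "ennreal (\<integral>y. q y \<partial>gaussian) = (\<integral>\<^sup>+y. ennreal (q y) \<partial>gaussian)"
    using q0 by (intro nn_integral_eq_integral[symmetric] iq) auto
  also have "\<dots> = (\<integral>\<^sup>+y. (\<integral>\<^sup>+x. ennreal (1 - cos (s * (x \<bullet> y))) \<partial>N) \<partial>gaussian)"
  proof (intro nn_integral_cong)
    fix y
    have "(\<integral>\<^sup>+x. ennreal (1 - cos ((s *\<^sub>R y) \<bullet> x)) \<partial>N) = ennreal (q y)"
      unfolding q by (intro nn_integral_eq_integral integrable_one_minus_cos_N) auto
    then show "ennreal (q y) = (\<integral>\<^sup>+x. ennreal (1 - cos (s * (x \<bullet> y))) \<partial>N)" by (simp add: inner_commute)
  qed
  also have "\<dots> = (\<integral>\<^sup>+x. (\<integral>\<^sup>+y. ennreal (1 - cos (s * (x \<bullet> y))) \<partial>gaussian) \<partial>N)"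
    using NG.Fubini[of "\<lambda>z. ennreal (1 - cos (s * (fst z \<bullet> snd z)))"] by simp
  also have "\<dots> = (\<integral>\<^sup>+x. ennreal (1 - exp (- (s\<^sup>2 / 2 * (norm x)\<^sup>2))) \<partial>N)"
  proof (intro nn_integral_cong)
    fix x :: 'a
    have i: "integrable gaussian (\<lambda>y::'a. cos (s * (x \<bullet> y)))"
      by (intro gauss.integrable_const_bound[where B=1]) auto
    have "(\<integral>\<^sup>+y. ennreal (1 - cos (s * (x \<bullet> y))) \<partial>gaussian) = ennreal (\<integral>y. 1 - cos (s * (x \<bullet> y)) \<partial>gaussian)"
      using i by (intro nn_integral_eq_integral) auto
    also have "(\<integral>y. 1 - cos (s * (x \<bullet> y)) \<partial>gaussian) = 1 - exp (- (s\<^sup>2 / 2 * (norm x)\<^sup>2))"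
      using i by (simp add: gaussian_cos gauss.prob_space[unfolded space_gaussian])
    finally show "(\<integral>\<^sup>+y. ennreal (1 - cos (s * (x \<bullet> y))) \<partial>gaussian) = ennreal (1 - exp (- (s\<^sup>2 / 2 * (norm x)\<^sup>2)))" .
  qed
  also have "\<dots> = ennreal (\<integral>x. (1 - exp (- (s\<^sup>2 / 2 * (norm x)\<^sup>2))) \<partial>N)"
    by (intro nn_integral_eq_integral integrable_one_minus_exp_N) auto
  finally have "(\<integral>y. q y \<partial>gaussian) = (\<integral>x. (1 - exp (- (s\<^sup>2 / 2 * (norm x)\<^sup>2))) \<partial>N)"
    using q0 by (subst (asm) ennreal_inj) (auto intro!: Bochner_Integration.integral_nonneg)
  moreover have "(\<integral>y. q y \<partial>gaussian) = (\<integral>y. \<psi> (s *\<^sub>R y) \<partial>gaussian) - (\<integral>(y::'a). \<eta> * s\<^sup>2 * (norm y)\<^sup>2 \<partial>gaussian)"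
    unfolding q_def by (intro Bochner_Integration.integral_diff integrable_gaussian_psi s integrable_mult_right integrable_gaussian_norm_square)
  ultimately show ?thesis by simp
qed

end

text \<open>The one-dimensional distributions of the process, reduced to the properties that the limit theorems use.\<close>

locale unimodal_semigroup = unimodal_exponent +
  fixes P :: "real \<Rightarrow> 'a measure" and p :: "real \<Rightarrow> 'a \<Rightarrow> real"
  assumes prob: "\<And>t. t > 0 \<Longrightarrow> prob_space (P t)"
    and sets_P: "\<And>t. t > 0 \<Longrightarrow> sets (P t) = sets borel"
    and cos_P: "\<And>t \<xi>. t > 0 \<Longrightarrow> (\<integral>x. cos (\<xi> \<bullet> x) \<partial>P t) = exp (- t * \<psi> \<xi>)"
    and density_P: "\<And>t. t > 0 \<Longrightarrow> isotropic_unimodal_density (P t) (p t)"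
begin

text \<open>Fubini's theorem for $\cos\langle sx, y\rangle$ identifies the Gaussian average of the characteristic function with
the integral of a Gaussian function of $x$.\<close>

lemma gaussian_average_P:
  assumes t: "t > 0"
  shows "(\<integral>x. (1 - exp (- (s\<^sup>2 / 2 * (norm x)\<^sup>2))) \<partial>P t) = (\<integral>y. (1 - exp (- t * \<psi> (s *\<^sub>R y))) \<partial>gaussian)"
proof -
  note [measurable_cong] = sets_P[OF t]
  interpret Pt: prob_space "P t" by (rule prob[OF t])
  interpret gauss: prob_space "gaussian :: 'a measure" by (rule prob_space_gaussian)
  interpret PG: pair_prob_space "P t" "gaussian :: 'a measure" ..
  have "(\<integral>y. (\<integral>x. cos (s * (x \<bullet> y)) \<partial>P t) \<partial>gaussian) = (\<integral>x. (\<integral>y. cos (s * (x \<bullet> y)) \<partial>gaussian) \<partial>P t)"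
  proof (rule PG.Fubini_integral)
    show "integrable (P t \<Otimes>\<^sub>M gaussian) (\<lambda>(x, y). cos (s * (x \<bullet> y)))"
      by (intro PG.P.integrable_const_bound[where B=1]) (auto simp: split_beta')
  qed
  moreover have "(\<integral>x. cos (s * (x \<bullet> y)) \<partial>P t) = exp (- t * \<psi> (s *\<^sub>R y))" for y
    using cos_P[OF t, of "s *\<^sub>R y"] by (simp add: inner_commute)
  moreover have "(\<integral>y. cos (s * (x \<bullet> y)) \<partial>gaussian) = exp (- (s\<^sup>2 / 2 * (norm x)\<^sup>2))" for x :: 'a
    by (simp add: gaussian_cos)
  ultimately have eq: "(\<integral>y. exp (- t * \<psi> (s *\<^sub>R y)) \<partial>gaussian) = (\<integral>x. exp (- (s\<^sup>2 / 2 * (norm x)\<^sup>2)) \<partial>P t)"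
    by simp
  have "integrable (P t) (\<lambda>x. exp (- (s\<^sup>2 / 2 * (norm x)\<^sup>2)))"
    by (intro Pt.integrable_const_bound[where B=1]) auto
  moreover have "integrable gaussian (\<lambda>y. exp (- t * \<psi> (s *\<^sub>R y)))"
    using t psi_nonneg by (intro gauss.integrable_const_bound[where B=1]) auto
  ultimately show ?thesis
    using eq by (simp add: Pt.prob_space gauss.prob_space[unfolded space_gaussian])
qed

text \<open>For $v = e^{-|x|^2/r^2}$ the power $v^k$ is the Gaussian function with $s^2/2 = k/r^2$, so \<open>gaussian_average_P\<close>
expresses all the moments in terms of $\psi$.  The bumps vanish near the origin and do not see the
part of the limit with coefficient \<open>drift\<close>, which sits there.\<close>

lemma bump_limit:
  fixes t r \<tau> :: "nat \<Rightarrow> real" and drift :: real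
  assumes t: "\<And>n. t n > 0" and r: "\<And>n. r n > 0" and \<tau>: "\<And>n. \<tau> n > 0"
    and m: "sets m = sets borel" and drift: "drift \<ge> 0"
    and int: "integrable m (\<lambda>x::'a. 1 - exp (- (norm x)\<^sup>2))"
    and lim: "\<And>k::nat. (\<lambda>n. (\<integral>y. (1 - exp (- t n * \<psi> ((sqrt (2 * k) / r n) *\<^sub>R y))) \<partial>gaussian) / \<tau> n)
      \<longlonglongrightarrow> (\<integral>x. (1 - exp (- (norm x)\<^sup>2) ^ k) \<partial>m) + drift * k"
  shows "(\<lambda>n. (\<integral>x. bump a b ((1 / r n) *\<^sub>R x) \<partial>P (t n)) / \<tau> n) \<longlonglongrightarrow> (\<integral>x. bump a b x \<partial>m)"
proof -
  note [measurable_cong] = m sets_P[OF t]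
  have "(\<lambda>n. (\<integral>x. tent a b (exp (- (norm ((1 / r n) *\<^sub>R x))\<^sup>2)) * (1 - exp (- (norm ((1 / r n) *\<^sub>R x))\<^sup>2)) \<partial>P (t n)) / \<tau> n)
    \<longlonglongrightarrow> (\<integral>x. tent a b (exp (- (norm x)\<^sup>2)) * (1 - exp (- (norm x)\<^sup>2)) \<partial>m) + drift * tent a b 1"
  proof (rule moment_convergence[where v="\<lambda>n x. exp (- (norm ((1 / r n) *\<^sub>R x))\<^sup>2)"])
    show "finite_measure (P (t n))" for n using prob[OF t] by (simp add: prob_space_def)
    show "(\<lambda>n. (\<integral>x. (1 - exp (- (norm ((1 / r n) *\<^sub>R x))\<^sup>2) ^ k) \<partial>P (t n)) / \<tau> n)
        \<longlonglongrightarrow> (\<integral>x. (1 - exp (- (norm x)\<^sup>2) ^ k) \<partial>m) + drift * k" for k :: nat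
    proof -
      have "(\<integral>x. (1 - exp (- (norm ((1 / r n) *\<^sub>R x))\<^sup>2) ^ k) \<partial>P (t n))
          = (\<integral>y. (1 - exp (- t n * \<psi> ((sqrt (2 * k) / r n) *\<^sub>R y))) \<partial>gaussian)" for n
      proof -
        have "exp (- (norm ((1 / r n) *\<^sub>R x))\<^sup>2) ^ k = exp (- ((sqrt (2 * k) / r n)\<^sup>2 / 2 * (norm x)\<^sup>2))" for x :: 'a
          using r[of n] by (simp add: exp_of_nat_mult[symmetric] power_divide field_simps)
        then show ?thesis using gaussian_average_P[OF t[of n], of "sqrt (2 * k) / r n"] by simp
      qed
      then show ?thesis using lim[of k] by simp
    qed
  qed (use \<tau> drift int in \<open>auto intro!: continuous_tent\<close>)
  then show ?thesis by (simp add: bump_def[abs_def] tent_one)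
qed

end

text \<open>Both follow from $1 + x \le e^x$.\<close>

lemma one_minus_exp_bounds:
  fixes u :: real
  assumes "0 \<le> u"
  shows "u / (1 + u) \<le> 1 - exp (- u)" "1 - exp (- u) \<le> u"
proof -
  have "exp (- u) \<le> 1 / (1 + u)"
    using exp_ge_add_one_self[of u] assms by (simp add: exp_minus divide_inverse le_imp_inverse_le)
  moreover have "u / (1 + u) = 1 - 1 / (1 + u)" using assms by (simp add: field_simps)
  ultimately show "u / (1 + u) \<le> 1 - exp (- u)" by simp
  show "1 - exp (- u) \<le> u" using exp_ge_add_one_self[of "- u"] by simp
qed

lemma one_minus_exp_quotient_tendsto:
  fixes u \<tau> :: "nat \<Rightarrow> real"
  assumes u: "\<And>n. 0 \<le> u n" and \<tau>: "\<And>n. 0 < \<tau> n" "\<tau> \<longlonglongrightarrow> 0" and lim: "u \<longlonglongrightarrow> l"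
  shows "(\<lambda>n. (1 - exp (- (\<tau> n * u n))) / \<tau> n) \<longlonglongrightarrow> l"
proof (rule tendsto_sandwich)
  have b: "\<tau> n * u n / (1 + \<tau> n * u n) \<le> 1 - exp (- (\<tau> n * u n))" "1 - exp (- (\<tau> n * u n)) \<le> \<tau> n * u n" for n
    using one_minus_exp_bounds[of "\<tau> n * u n"] u[of n] \<tau>(1)[of n] by simp_all
  have lo: "u n / (1 + \<tau> n * u n) \<le> (1 - exp (- (\<tau> n * u n))) / \<tau> n" for n
    using divide_right_mono[OF b(1)[of n], of "\<tau> n"] \<tau>(1)[of n] by simp
  then show "\<forall>\<^sub>F n in sequentially. u n / (1 + \<tau> n * u n) \<le> (1 - exp (- (\<tau> n * u n))) / \<tau> n" by simp
  show "\<forall>\<^sub>F n in sequentially. (1 - exp (- (\<tau> n * u n))) / \<tau> n \<le> u n"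
    using b(2) \<tau>(1) by (simp add: divide_le_eq mult.commute)
  have "(\<lambda>n. u n / (1 + \<tau> n * u n)) \<longlonglongrightarrow> l / (1 + 0 * l)"
    by (intro tendsto_divide tendsto_add tendsto_mult tendsto_const lim \<tau>(2)) simp
  then show "(\<lambda>n. u n / (1 + \<tau> n * u n)) \<longlonglongrightarrow> l" by simp
qed (rule lim)

section \<open>From regular variation to the transition density\<close>

definition stable_kernel :: "real \<Rightarrow> real \<Rightarrow> 'a::euclidean_space \<Rightarrow> real" where
  "stable_kernel \<alpha> b x = (1 - exp (- (b * (norm x)\<^sup>2))) * norm x powr - \<alpha>"

lemma stable_kernel_measurable [measurable]: "stable_kernel \<alpha> b \<in> borel_measurable borel"
  unfolding stable_kernel_def[abs_def] by measurable

lemma integrable_stable_kernel: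
  assumes \<alpha>: "0 < \<alpha>" "\<alpha> < 2" and b: "0 \<le> b"
  shows "integrable dilation_measure (stable_kernel \<alpha> b :: 'a::euclidean_space \<Rightarrow> real)"
proof (rule Bochner_Integration.integrable_bound)
  show "integrable dilation_measure (\<lambda>x::'a. max 1 b * (min 1 ((norm x)\<^sup>2) * norm x powr - \<alpha>))"
    using integrable_min_powr[OF \<alpha>] by (rule integrable_mult_right)
  show "AE x in dilation_measure. norm (stable_kernel \<alpha> b (x::'a)) \<le> norm (max 1 b * (min 1 ((norm x)\<^sup>2) * norm x powr - \<alpha>))"
  proof (intro always_eventually allI)
    fix x :: 'a
    have "1 - exp (- (b * (norm x)\<^sup>2)) \<le> min 1 (b * (norm x)\<^sup>2)"
      using exp_ge_add_one_self[of "- (b * (norm x)\<^sup>2)"] exp_gt_zero[of "- (b * (norm x)\<^sup>2)"] by linarith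
    also have "\<dots> \<le> max 1 b * min 1 ((norm x)\<^sup>2)" by (rule min_one_scale_le[OF b]) simp
    finally have "stable_kernel \<alpha> b x \<le> max 1 b * min 1 ((norm x)\<^sup>2) * norm x powr - \<alpha>"
      unfolding stable_kernel_def by (rule mult_right_mono) simp
    moreover have "0 \<le> stable_kernel \<alpha> b x"
      unfolding stable_kernel_def using b by (intro mult_nonneg_nonneg) auto
    ultimately show "norm (stable_kernel \<alpha> b x) \<le> norm (max 1 b * (min 1 ((norm x)\<^sup>2) * norm x powr - \<alpha>))"
      by (simp add: mult.assoc)
  qed
qed simp

text \<open>The substitution $x \mapsto \sqrt{k}\,x$ under the dilation-invariant measure.  The identity at $k = 0$ holds
because $0$ raised to a positive power is $0$.\<close>

lemma integral_stable_kernel_scale: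
  assumes "0 < \<alpha>"
  shows "(\<integral>(x::'a::euclidean_space). stable_kernel \<alpha> (real k) x \<partial>dilation_measure)
    = real k powr (\<alpha> / 2) * (\<integral>(x::'a). stable_kernel \<alpha> 1 x \<partial>dilation_measure)"
proof (cases "k = 0")
  case True
  then show ?thesis using assms by (simp add: stable_kernel_def)
next
  case False
  define a where "a = sqrt (real k)"
  have a: "a > 0" "a\<^sup>2 = real k" using False by (auto simp: a_def)
  have aa: "a powr \<alpha> = real k powr (\<alpha> / 2)"
    using False by (simp add: a_def powr_half_sqrt[symmetric] powr_powr)
  have "(\<integral>(x::'a). stable_kernel \<alpha> 1 x \<partial>dilation_measure) = (\<integral>(x::'a). stable_kernel \<alpha> 1 (a *\<^sub>R x) \<partial>dilation_measure)"
    using integral_dilation_measure_scaleR[of "stable_kernel \<alpha> 1 :: 'a \<Rightarrow> real" a] a by simp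
  also have "\<dots> = (\<integral>(x::'a). a powr - \<alpha> * stable_kernel \<alpha> (real k) x \<partial>dilation_measure)"
    using a by (intro Bochner_Integration.integral_cong refl) (simp add: stable_kernel_def power_mult_distrib powr_mult)
  finally have "(\<integral>(x::'a). stable_kernel \<alpha> 1 x \<partial>dilation_measure) = a powr - \<alpha> * (\<integral>(x::'a). stable_kernel \<alpha> (real k) x \<partial>dilation_measure)"
    by simp
  then show ?thesis using a by (simp add: aa[symmetric] powr_minus)
qed

lemma integral_stable_kernel_pos:
  assumes "0 < \<alpha>" "\<alpha> < 2"
  shows "0 < (\<integral>(x::'a::euclidean_space). stable_kernel \<alpha> 1 x \<partial>dilation_measure)"
proof -
  have nn: "0 \<le> stable_kernel \<alpha> 1 (x::'a)" for x
    unfolding stable_kernel_def by (intro mult_nonneg_nonneg) auto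
  have "(\<integral>(x::'a). stable_kernel \<alpha> 1 x \<partial>dilation_measure) \<noteq> 0"
  proof
    assume "(\<integral>(x::'a). stable_kernel \<alpha> 1 x \<partial>dilation_measure) = 0"
    then have "AE x in dilation_measure. stable_kernel \<alpha> 1 (x::'a) = 0"
      using integrable_stable_kernel[OF assms, of 1, where 'a='a] nn
      by (subst (asm) integral_nonneg_eq_0_iff_AE) auto
    then have "AE x in (dilation_measure :: 'a measure). x \<notin> shell 1 2"
    proof eventually_elim
      case (elim x)
      then show ?case by (auto simp: stable_kernel_def shell_def)
    qed
    then have "emeasure dilation_measure (shell 1 2 :: 'a set) = 0"
      by (subst (asm) AE_iff_measurable[where N="shell 1 2"]) auto
    then show False using emeasure_shell_pos[of 1 2, where 'a='a] by simp
  qed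
  then show ?thesis using Bochner_Integration.integral_nonneg[of dilation_measure "stable_kernel \<alpha> 1 :: 'a \<Rightarrow> real"] nn
    by (auto simp: less_le)
qed

lemma integrable_gaussian_powr:
  assumes "0 < \<alpha>" "\<alpha> < 2"
  shows "integrable gaussian (\<lambda>y::'a::euclidean_space. norm y powr \<alpha>)"
proof (rule Bochner_Integration.integrable_bound)
  show "integrable gaussian (\<lambda>y::'a. 1 * max 1 (1 * (norm y)\<^sup>2))" by (rule integrable_gaussian_max)
  show "AE y in gaussian. norm (norm (y::'a) powr \<alpha>) \<le> norm (1 * max 1 (1 * (norm y)\<^sup>2))"
  proof (intro always_eventually allI)
    fix y :: 'a
    show "norm (norm y powr \<alpha>) \<le> norm (1 * max 1 (1 * (norm y)\<^sup>2))"
    proof (cases "norm y \<le> 1")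
      case True
      then have "norm y powr \<alpha> \<le> 1 powr \<alpha>" using assms by (intro powr_mono2) auto
      then show ?thesis by (simp add: max_def)
    next
      case False
      then have "norm y powr \<alpha> \<le> norm y powr 2" using assms by (intro powr_mono) auto
      then show ?thesis using False by (simp add: max_def)
    qed
  qed
qed auto

lemma integral_gaussian_powr_pos:
  assumes "0 < \<alpha>" "\<alpha> < 2"
  shows "0 < (\<integral>(y::'a::euclidean_space). norm y powr \<alpha> \<partial>gaussian)"
proof -
  have "(\<integral>(y::'a). norm y powr \<alpha> \<partial>gaussian) \<noteq> 0"
  proof
    assume "(\<integral>(y::'a). norm y powr \<alpha> \<partial>gaussian) = 0"
    then have "AE y in gaussian. norm (y::'a) powr \<alpha> = 0"
      using integrable_gaussian_powr[OF assms, where 'a='a]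
      by (subst (asm) integral_nonneg_eq_0_iff_AE) auto
    then have "AE y in gaussian. y = (0::'a)" by eventually_elim simp
    then show False using gaussian_not_AE_zero by blast
  qed
  then show ?thesis using Bochner_Integration.integral_nonneg[of gaussian "\<lambda>y::'a. norm y powr \<alpha>"]
    by (auto simp: less_le)
qed

text \<open>The Levy measure $c|x|^{-d-\alpha}dx$ of an isotropic stable process, written with the dilation-invariant measure.\<close>

definition stable_measure :: "real \<Rightarrow> real \<Rightarrow> 'a::euclidean_space measure" where
  "stable_measure c \<alpha> = density dilation_measure (\<lambda>x. ennreal (c * norm x powr - \<alpha>))"

lemma sets_stable_measure [measurable_cong, simp]: "sets (stable_measure c \<alpha>) = sets borel"
  by (simp add: stable_measure_def)

lemma integral_stable_measure:
  fixes f :: "'a::euclidean_space \<Rightarrow> real"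
  assumes "c \<ge> 0" and f: "f \<in> borel_measurable borel"
  shows "(\<integral>(x::'a). f x \<partial>stable_measure c \<alpha>) = (\<integral>(x::'a). c * norm x powr - \<alpha> * f x \<partial>dilation_measure)"
    and "integrable (stable_measure c \<alpha>) f \<longleftrightarrow> integrable dilation_measure (\<lambda>x. c * norm x powr - \<alpha> * f x)"
proof -
  have "AE x in dilation_measure. 0 \<le> c * norm (x::'a) powr - \<alpha>" using assms by simp
  then show "(\<integral>(x::'a). f x \<partial>stable_measure c \<alpha>) = (\<integral>(x::'a). c * norm x powr - \<alpha> * f x \<partial>dilation_measure)"
    "integrable (stable_measure c \<alpha>) f \<longleftrightarrow> integrable dilation_measure (\<lambda>x. c * norm x powr - \<alpha> * f x)"
    unfolding stable_measure_def using f by (simp_all add: integral_density integrable_density)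
qed

lemma stable_measure_density:
  assumes "c \<ge> 0" "\<alpha> > 0"
  shows "isotropic_unimodal_density (stable_measure c \<alpha> :: 'a::euclidean_space measure)
    (\<lambda>x. c * norm x powr - \<alpha> * inverse (norm x) ^ DIM('a))"
  unfolding isotropic_unimodal_density_def
proof (intro conjI allI impI ballI)
  show "(\<lambda>x::'a. c * norm x powr - \<alpha> * inverse (norm x) ^ DIM('a)) \<in> borel_measurable borel" by measurable
  show "0 \<le> c * norm x powr - \<alpha> * inverse (norm x) ^ DIM('a)" for x :: 'a using assms by simp
  show "c * norm y powr - \<alpha> * inverse (norm y) ^ DIM('a) \<le> c * norm x powr - \<alpha> * inverse (norm x) ^ DIM('a)"
    if "x \<noteq> 0 \<and> norm x \<le> norm y" for x y :: 'a
    using that assms by (intro mult_mono mult_left_mono powr_mono2' power_mono le_imp_inverse_le) auto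
  show "emeasure (stable_measure c \<alpha>) A = (\<integral>\<^sup>+x\<in>A. ennreal (c * norm x powr - \<alpha> * inverse (norm x) ^ DIM('a)) \<partial>lborel)"
    if A[measurable]: "A \<in> sets borel" for A :: "'a set"
  proof -
    have "emeasure (stable_measure c \<alpha>) A = (\<integral>\<^sup>+x. ennreal (c * norm x powr - \<alpha>) * indicator A x \<partial>dilation_measure)"
      unfolding stable_measure_def by (subst emeasure_density) auto
    also have "\<dots> = (\<integral>\<^sup>+x. ennreal (inverse (norm x) ^ DIM('a)) * (ennreal (c * norm x powr - \<alpha>) * indicator A x) \<partial>lborel)"
      by (rule nn_integral_dilation_measure) simp
    also have "\<dots> = (\<integral>\<^sup>+x\<in>A. ennreal (c * norm x powr - \<alpha> * inverse (norm x) ^ DIM('a)) \<partial>lborel)"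
      using assms by (intro nn_integral_cong) (simp add: ennreal_mult mult_ac)
    finally show ?thesis .
  qed
qed

context unimodal_semigroup
begin

text \<open>The value of $c$ for which the measure \<open>stable_measure\<close> has exponent $|\xi|^\alpha$, read off after averaging the
exponent over the Gaussian.\<close>

definition limit_const :: "real \<Rightarrow> real" where
  "limit_const \<alpha> = 2 powr (\<alpha> / 2) * (\<integral>(y::'a). norm y powr \<alpha> \<partial>gaussian) / (\<integral>(x::'a). stable_kernel \<alpha> 1 x \<partial>dilation_measure)"

lemma limit_const_pos: "0 < \<alpha> \<Longrightarrow> \<alpha> < 2 \<Longrightarrow> 0 < limit_const \<alpha>"
  unfolding limit_const_def
  by (intro divide_pos_pos mult_pos_pos integral_gaussian_powr_pos integral_stable_kernel_pos) auto

text \<open>After division by $t\psi(1/r)$ the integrand $1 - e^{-t\psi(\kappa y/r)}$ converges to $(\kappa|y|)^\alpha$ because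
$t\psi(1/r)$ tends to $0$, and \<open>profile_scale_le\<close> provides a multiple of $\max(1, \kappa^2|y|^2)$ as a dominating
function.\<close>

lemma bump_limit_regularly_varying:
  fixes t r :: "nat \<Rightarrow> real"
  assumes \<alpha>: "0 < \<alpha>" "\<alpha> < 2" and rv: "regularly_varying \<alpha> profile"
    and t: "\<And>n. t n > 0" and r: "\<And>n. r n > 0" "r \<longlonglongrightarrow> 0"
    and pos: "\<And>s. s > 0 \<Longrightarrow> profile s > 0"
    and tr: "(\<lambda>n. t n * profile (1 / r n)) \<longlonglongrightarrow> 0"
  shows "(\<lambda>n. (\<integral>x. bump a b ((1 / r n) *\<^sub>R x) \<partial>P (t n)) / (t n * profile (1 / r n)))
     \<longlonglongrightarrow> (\<integral>(x::'a). bump a b x \<partial>stable_measure (limit_const \<alpha>) \<alpha>)"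
proof (rule bump_limit[where drift=0])
  define c where "c = limit_const \<alpha>"
  define \<tau> where "\<tau> n = t n * profile (1 / r n)" for n
  define I where "I = (\<integral>(x::'a). stable_kernel \<alpha> 1 x \<partial>dilation_measure)"
  define K where "K = (\<integral>(y::'a). norm y powr \<alpha> \<partial>gaussian)"
  have I: "I > 0" unfolding I_def by (rule integral_stable_kernel_pos[OF \<alpha>])
  have cI: "c * I = 2 powr (\<alpha> / 2) * K" using I by (simp add: c_def limit_const_def I_def K_def)
  have c: "c \<ge> 0" using limit_const_pos[OF \<alpha>] by (simp add: c_def)
  have rinf: "filterlim (\<lambda>n. 1 / r n) at_top sequentially"
    using r unfolding divide_inverse
    by (simp add: filterlim_inverse_at_top)
  show \<tau>pos: "0 < t n * profile (1 / r n)" for n using t pos r by simp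
  show "integrable (stable_measure (limit_const \<alpha>) \<alpha>) (\<lambda>x::'a. 1 - exp (- (norm x)\<^sup>2))"
  proof (subst integral_stable_measure(2))
    show "0 \<le> limit_const \<alpha>" using c by (simp add: c_def)
    have "integrable dilation_measure (\<lambda>x::'a. limit_const \<alpha> * stable_kernel \<alpha> 1 x)"
      using integrable_stable_kernel[OF \<alpha>, of 1] by (intro integrable_mult_right) auto
    then show "integrable dilation_measure (\<lambda>x::'a. limit_const \<alpha> * norm x powr - \<alpha> * (1 - exp (- (norm x)\<^sup>2)))"
      by (simp add: stable_kernel_def mult_ac)
  qed simp
  fix k :: nat
  show "(\<lambda>n. (\<integral>y. (1 - exp (- t n * \<psi> ((sqrt (2 * k) / r n) *\<^sub>R y))) \<partial>gaussian) / (t n * profile (1 / r n)))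
      \<longlonglongrightarrow> (\<integral>(x::'a). (1 - exp (- (norm x)\<^sup>2) ^ k) \<partial>stable_measure (limit_const \<alpha>) \<alpha>) + 0 * real k"
  proof -
    define \<kappa> where "\<kappa> = sqrt (2 * real k)"
    have "(\<integral>(x::'a). (1 - exp (- (norm x)\<^sup>2) ^ k) \<partial>stable_measure c \<alpha>) = (\<integral>(x::'a). c * stable_kernel \<alpha> (real k) x \<partial>dilation_measure)"
      by (subst integral_stable_measure(1)[OF c], measurable)
        (simp add: stable_kernel_def exp_of_nat_mult[symmetric] mult_ac)
    also have "\<dots> = real k powr (\<alpha> / 2) * (c * I)"
      using integral_stable_kernel_scale[OF \<alpha>(1), of k, where 'a='a] by (simp add: I_def)
    also have "\<dots> = \<kappa> powr \<alpha> * K"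
    proof -
      have "\<kappa> powr \<alpha> = (2 * real k) powr (\<alpha> / 2)"
        by (cases "k = 0") (simp_all add: \<kappa>_def powr_half_sqrt[symmetric] powr_powr)
      then show ?thesis by (simp add: cI powr_mult)
    qed
    also have "\<dots> = (\<integral>(y::'a). (\<kappa> * norm y) powr \<alpha> \<partial>gaussian)"
      by (simp add: K_def powr_mult \<kappa>_def)
    finally have lim: "(\<integral>(x::'a). (1 - exp (- (norm x)\<^sup>2) ^ k) \<partial>stable_measure c \<alpha>) = (\<integral>(y::'a). (\<kappa> * norm y) powr \<alpha> \<partial>gaussian)" .
    have "(\<lambda>n. \<integral>(y::'a). (1 - exp (- t n * \<psi> ((\<kappa> / r n) *\<^sub>R y))) / \<tau> n \<partial>gaussian) \<longlonglongrightarrow> (\<integral>(y::'a). (\<kappa> * norm y) powr \<alpha> \<partial>gaussian)"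
    proof (rule integral_dominated_convergence)
      have eq: "t n * \<psi> ((\<kappa> / r n) *\<^sub>R y) = \<tau> n * (profile (\<kappa> * norm y * (1 / r n)) / profile (1 / r n))" for n and y :: 'a
        using pos[of "1 / r n"] r(1)[of n] by (simp add: psi_eq_profile \<tau>_def \<kappa>_def mult_ac)
      have nn: "0 \<le> profile (\<kappa> * norm y * (1 / r n)) / profile (1 / r n)" for n and y :: 'a
        using profile_nonneg by simp
      show "integrable gaussian (\<lambda>y::'a. doubling_const * max 1 (\<kappa>\<^sup>2 * (norm y)\<^sup>2))" by (rule integrable_gaussian_max)
      show "AE y in gaussian. (\<lambda>n. (1 - exp (- t n * \<psi> ((\<kappa> / r n) *\<^sub>R y))) / \<tau> n) \<longlonglongrightarrow> (\<kappa> * norm (y::'a)) powr \<alpha>"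
      proof (intro always_eventually allI)
        fix y :: 'a
        have "(\<lambda>n. profile (\<kappa> * norm y * (1 / r n)) / profile (1 / r n)) \<longlonglongrightarrow> (\<kappa> * norm y) powr \<alpha>"
        proof (cases "\<kappa> * norm y = 0")
          case True
          show ?thesis unfolding True by (simp add: profile_zero)
        next
          case False
          then have "0 < \<kappa> * norm y" by (simp add: \<kappa>_def zero_less_mult_iff)
          then have "((\<lambda>s. profile (\<kappa> * norm y * s) / profile s) \<longlongrightarrow> (\<kappa> * norm y) powr \<alpha>) at_top"
            using rv unfolding regularly_varying_def by blast
          then show ?thesis by (rule filterlim_compose[OF _ rinf])
        qed
        from one_minus_exp_quotient_tendsto[OF nn[of y] _ _ this, of \<tau>] \<tau>pos tr
        show "(\<lambda>n. (1 - exp (- t n * \<psi> ((\<kappa> / r n) *\<^sub>R y))) / \<tau> n) \<longlonglongrightarrow> (\<kappa> * norm y) powr \<alpha>"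
          by (simp add: eq \<tau>_def[abs_def])
      qed
      show "AE y in gaussian. norm ((1 - exp (- t n * \<psi> ((\<kappa> / r n) *\<^sub>R (y::'a)))) / \<tau> n) \<le> doubling_const * max 1 (\<kappa>\<^sup>2 * (norm y)\<^sup>2)" for n
      proof (intro always_eventually allI)
        fix y :: 'a
        let ?q = "profile (\<kappa> * norm y * (1 / r n)) / profile (1 / r n)"
        have \<tau>0: "\<tau> n > 0" using \<tau>pos by (simp add: \<tau>_def)
        have "0 \<le> \<tau> n * ?q" by (intro mult_nonneg_nonneg nn less_imp_le[OF \<tau>0])
        from one_minus_exp_bounds(2)[OF this]
        have "(1 - exp (- (\<tau> n * ?q))) / \<tau> n \<le> ?q" using \<tau>0 by (simp only: pos_divide_le_eq mult.commute)
        also have "?q \<le> doubling_const * max 1 (\<kappa>\<^sup>2 * (norm y)\<^sup>2)"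
        proof (cases "\<kappa> * norm y = 0")
          case True
          then have q0: "?q = 0" by (simp only: mult_zero_left profile_zero)
          show ?thesis unfolding q0 using doubling_const_ge by (intro mult_nonneg_nonneg) auto
        next
          case False
          then have "0 < \<kappa> * norm y" by (simp add: \<kappa>_def zero_less_mult_iff)
          then have "profile (\<kappa> * norm y * (1 / r n)) \<le> doubling_const * max 1 ((\<kappa> * norm y)\<^sup>2) * profile (1 / r n)"
            using r(1)[of n] by (intro profile_scale_le) auto
          then show ?thesis using pos[of "1 / r n"] r(1)[of n] by (simp only: power_mult_distrib) (simp add: pos_divide_le_eq)
        qed
        finally have "(1 - exp (- (\<tau> n * ?q))) / \<tau> n \<le> doubling_const * max 1 (\<kappa>\<^sup>2 * (norm y)\<^sup>2)" .
        moreover have "0 \<le> (1 - exp (- (\<tau> n * ?q))) / \<tau> n" using \<open>0 \<le> \<tau> n * ?q\<close> \<tau>0 by simp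
        ultimately show "norm ((1 - exp (- t n * \<psi> ((\<kappa> / r n) *\<^sub>R y))) / \<tau> n) \<le> doubling_const * max 1 (\<kappa>\<^sup>2 * (norm y)\<^sup>2)"
          using eq[of n y] by simp
      qed
    qed auto
    then show ?thesis using lim by (simp add: \<tau>_def c_def \<kappa>_def)
  qed
qed (use t r in auto)

text \<open>Averages over a thin shell just outside $x$ are at most $p(t,x)$, those over a shell just inside are at least
$p(t,x)$; by \<open>bump_limit_regularly_varying\<close> both are governed by the stable density, which is
continuous at radius $1$.\<close>

lemma density_quotient_tendsto:
  fixes t :: "nat \<Rightarrow> real" and x :: "nat \<Rightarrow> 'a"
  assumes \<alpha>: "0 < \<alpha>" "\<alpha> < 2" and rv: "regularly_varying \<alpha> profile"
    and t: "\<And>n. t n > 0" and x: "\<And>n. x n \<noteq> 0" "x \<longlonglongrightarrow> 0"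
    and tx: "(\<lambda>n. t n * profile (inverse (norm (x n)))) \<longlonglongrightarrow> 0"
  shows "(\<lambda>n. p (t n) (x n) / (inverse (norm (x n)) ^ DIM('a) * t n * profile (inverse (norm (x n))))) \<longlonglongrightarrow> limit_const \<alpha>"
proof -
  define c where "c = limit_const \<alpha>"
  have c: "c > 0" unfolding c_def by (rule limit_const_pos[OF \<alpha>])
  define r where "r n = norm (x n)" for n
  have r: "r n > 0" for n using x by (simp add: r_def)
  have r0: "r \<longlonglongrightarrow> 0" unfolding r_def by (rule tendsto_norm_zero[OF x(2)])
  have pos: "profile s > 0" if "s > 0" for s
  proof -
    obtain x0 where "x0 > 0" "\<forall>x\<ge>x0. profile x > 0" using rv unfolding regularly_varying_def by blast
    then show ?thesis using profile_pos[of x0 s] that by auto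
  qed
  define \<tau> where "\<tau> n = t n * profile (1 / r n)" for n
  have \<tau>: "\<tau> n > 0" for n using t pos r by (simp add: \<tau>_def)
  define Q where "Q n = p (t n) (x n) * r n ^ DIM('a) / \<tau> n" for n
  have Q: "p (t n) (x n) / (inverse (norm (x n)) ^ DIM('a) * t n * profile (inverse (norm (x n)))) = Q n" for n
    using r[of n] by (simp add: Q_def \<tau>_def r_def power_inverse divide_inverse mult_ac)
  have p0: "0 \<le> p (t n) (x n)" for n
    by (rule isotropic_unimodal_density_nonneg[OF density_P[OF t] x(1)])
  define J where "J a b = (\<integral>(y::'a). bump a b y \<partial>lborel)" for a b
  define L where "L a b n = (\<integral>y. bump a b ((1 / r n) *\<^sub>R y) \<partial>P (t n)) / \<tau> n" for a b n
  have L: "L a b \<longlonglongrightarrow> (\<integral>(y::'a). bump a b y \<partial>stable_measure c \<alpha>)" for a b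
    unfolding L_def \<tau>_def c_def
    by (rule bump_limit_regularly_varying[OF \<alpha> rv t r r0 pos]) (use tx in \<open>simp_all add: r_def inverse_eq_divide\<close>)
  define f where "f s = c * s powr - \<alpha> * inverse s ^ DIM('a)" for s
  have f0: "0 \<le> f s" if "s > 0" for s using that c by (simp add: f_def)
  have fmono: "f s \<le> f s'" if "0 < s'" "s' \<le> s" for s s'
    unfolding f_def using that c \<alpha> by (intro mult_mono mult_left_mono powr_mono2' power_mono le_imp_inverse_le) auto
  have stab: "isotropic_unimodal_density (stable_measure c \<alpha> :: 'a measure) (\<lambda>x. f (norm x))"
    unfolding f_def using stable_measure_density[of c \<alpha>, where 'a='a] c \<alpha> by simp
  have fcont: "isCont f 1" unfolding f_def by (intro continuous_intros) auto
  have f1: "f 1 = c" by (simp add: f_def)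
  have istab: "integrable (stable_measure c \<alpha>) (\<lambda>y::'a. bump a b ((1 / 1) *\<^sub>R y))" if "0 < a" "a < b" for a b
    by (rule integral_bump_density_le(2)[OF stab, of a b 1 "f a"]) (use that f0 fmono in auto)
  have "Q \<longlonglongrightarrow> c"
  proof (rule order_tendstoI)
    fix y assume "y < c"
    then have "\<forall>\<^sub>F s in at_right 1. y < f s"
      using fcont f1 by (intro order_tendstoD(1)[of f c]) (auto simp: isCont_def intro: tendsto_mono[OF at_le])
    moreover have "\<forall>\<^sub>F s in at_right 1. (1::real) < s" by (rule eventually_at_right_less)
    ultimately have "\<forall>\<^sub>F s in at_right (1::real). y < f s \<and> 1 < s" by (rule eventually_conj)
    then obtain b where b: "y < f b" "1 < b" using eventually_happens trivial_limit_at_right_real by blast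
    have J: "J 1 b > 0" unfolding J_def using b by (intro integral_bump_pos) auto
    have "f b * (1 ^ DIM('a) * J 1 b) \<le> (\<integral>(y::'a). bump 1 b ((1 / 1) *\<^sub>R y) \<partial>stable_measure c \<alpha>)"
      unfolding J_def using b f0[of b] fmono[of _ b] istab[of 1 b]
      by (intro integral_bump_density_ge[OF stab]) (auto intro!: fmono)
    then have "y * J 1 b < (\<integral>(y::'a). bump 1 b y \<partial>stable_measure c \<alpha>)"
      using mult_strict_right_mono[OF b(1) J] by simp
    from order_tendstoD(1)[OF L this] show "\<forall>\<^sub>F n in sequentially. y < Q n"
    proof eventually_elim
      case (elim n)
      have "(\<integral>y. bump 1 b ((1 / r n) *\<^sub>R y) \<partial>P (t n)) \<le> p (t n) (x n) * (r n ^ DIM('a) * J 1 b)"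
        unfolding J_def using b r p0 x
        by (intro integral_bump_density_le(1)[OF density_P[OF t] sets_P[OF t]])
          (auto simp: r_def intro!: isotropic_unimodal_density_mono[OF density_P[OF t]])
      then have "L 1 b n \<le> Q n * J 1 b"
        using \<tau>[of n] by (simp add: L_def Q_def divide_right_mono mult.assoc)
      with elim have "y * J 1 b < Q n * J 1 b" by linarith
      then show ?case using J by simp
    qed
  next
    fix y assume "c < y"
    then have "\<forall>\<^sub>F s in at_left 1. f s < y"
      using fcont f1 by (intro order_tendstoD(2)[of f c]) (auto simp: isCont_def intro: tendsto_mono[OF at_le])
    moreover have "\<forall>\<^sub>F s in at_left 1. s \<in> {0<..<(1::real)}" by (rule eventually_at_left_real) simp
    ultimately have "\<forall>\<^sub>F s in at_left (1::real). f s < y \<and> s \<in> {0<..<1}" by (rule eventually_conj)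
    then obtain a where a: "f a < y" "0 < a" "a < 1" using eventually_happens trivial_limit_at_left_real by fastforce
    have J: "J a 1 > 0" unfolding J_def using a by (intro integral_bump_pos) auto
    have "(\<integral>(y::'a). bump a 1 ((1 / 1) *\<^sub>R y) \<partial>stable_measure c \<alpha>) \<le> f a * (1 ^ DIM('a) * J a 1)"
      unfolding J_def using a f0[of a]
      by (intro integral_bump_density_le(1)[OF stab]) (auto intro!: fmono)
    then have "(\<integral>(y::'a). bump a 1 y \<partial>stable_measure c \<alpha>) < y * J a 1"
      using mult_strict_right_mono[OF a(1) J] by simp
    from order_tendstoD(2)[OF L this] show "\<forall>\<^sub>F n in sequentially. Q n < y"
    proof eventually_elim
      case (elim n)
      have int: "integrable (P (t n)) (\<lambda>y. bump a 1 ((1 / r n) *\<^sub>R y))"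
      proof -
        interpret prob_space "P (t n)" by (rule prob[OF t])
        note [measurable_cong] = sets_P[OF t]
        show ?thesis by (intro integrable_const_bound[where B=1]) (auto simp: abs_of_nonneg bump_nonneg bump_le_one)
      qed
      have "p (t n) (x n) * (r n ^ DIM('a) * J a 1) \<le> (\<integral>y. bump a 1 ((1 / r n) *\<^sub>R y) \<partial>P (t n))"
        unfolding J_def
      proof (rule integral_bump_density_ge[OF density_P[OF t] sets_P[OF t] _ _ r p0 _ int])
        fix y :: 'a assume "a * r n < norm y" "norm y < 1 * r n"
        moreover have "0 < a * r n" using a r by simp
        ultimately show "p (t n) (x n) \<le> p (t n) y"
          by (intro isotropic_unimodal_density_mono[OF density_P[OF t]]) (auto simp: r_def)
      qed (use a in auto)
      then have "Q n * J a 1 \<le> L a 1 n"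
        using \<tau>[of n] by (simp add: L_def Q_def divide_right_mono mult.assoc)
      with elim have "Q n * J a 1 < y * J a 1" by linarith
      then show ?case using J by simp
    qed
  qed
  then show ?thesis by (simp add: Q c_def)
qed

text \<open>A failure of the joint limit would produce sequences that contradict \<open>density_quotient_tendsto\<close>.\<close>

theorem transition_density_asymptotics:
  assumes \<alpha>: "0 < \<alpha>" "\<alpha> < 2" and rv: "regularly_varying \<alpha> profile" and \<epsilon>: "\<epsilon> > 0"
  shows "\<exists>\<delta>>0. \<forall>t>0. \<forall>x. 0 < norm x \<and> norm x \<le> \<delta> \<and> t * profile (inverse (norm x)) \<le> \<delta> \<longrightarrow>
          \<bar>p t x / (inverse (norm x) ^ DIM('a) * t * profile (inverse (norm x))) - limit_const \<alpha>\<bar> \<le> \<epsilon>"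
proof (rule ccontr)
  assume *: "\<not> ?thesis"
  have "\<exists>t x. t > 0 \<and> 0 < norm x \<and> norm x \<le> 1 / Suc n \<and> t * profile (inverse (norm x)) \<le> 1 / Suc n \<and>
     \<epsilon> < \<bar>p t x / (inverse (norm x) ^ DIM('a) * t * profile (inverse (norm x))) - limit_const \<alpha>\<bar>" for n
  proof -
    have "(0::real) < 1 / Suc n" by simp
    with * show ?thesis by (meson not_le)
  qed
  then obtain t x where tx: "\<And>n. t n > 0" "\<And>n. 0 < norm (x n)" "\<And>n. norm (x n) \<le> 1 / Suc n"
    "\<And>n. t n * profile (inverse (norm (x n))) \<le> 1 / Suc n"
    "\<And>n. \<epsilon> < \<bar>p (t n) (x n) / (inverse (norm (x n)) ^ DIM('a) * t n * profile (inverse (norm (x n)))) - limit_const \<alpha>\<bar>"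
    by metis
  have z: "(\<lambda>n. 1 / real (Suc n)) \<longlonglongrightarrow> 0" using LIMSEQ_inverse_real_of_nat by (simp add: inverse_eq_divide)
  have x0: "x \<longlonglongrightarrow> 0" by (rule Lim_null_comparison[OF _ z]) (use tx(3) in auto)
  have t0: "(\<lambda>n. t n * profile (inverse (norm (x n)))) \<longlonglongrightarrow> 0"
    by (rule Lim_null_comparison[OF _ z]) (use tx(1,4) profile_nonneg in \<open>auto simp: abs_mult less_imp_le\<close>)
  have "(\<lambda>n. p (t n) (x n) / (inverse (norm (x n)) ^ DIM('a) * t n * profile (inverse (norm (x n))))) \<longlonglongrightarrow> limit_const \<alpha>"
    using tx(2) by (intro density_quotient_tendsto[OF \<alpha> rv tx(1) _ x0 t0]) auto
  from LIMSEQ_D[OF this \<epsilon>] obtain n where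
    "norm (p (t n) (x n) / (inverse (norm (x n)) ^ DIM('a) * t n * profile (inverse (norm (x n)))) - limit_const \<alpha>) < \<epsilon>" by blast
  then show False using tx(5)[of n] by simp
qed

section \<open>From the transition density to the Levy density\<close>

text \<open>Now $(1 - e^{-t\psi})/t \to \psi$, and the Gaussian average of $\psi$ is the corresponding integral of the Levy
measure plus a contribution of $\eta$ that is linear in $k$.\<close>

lemma bump_limit_small_time:
  "(\<lambda>n. (\<integral>x. bump a b x \<partial>P (1 / Suc n)) / (1 / Suc n)) \<longlonglongrightarrow> (\<integral>x. bump a b x \<partial>N)"
proof -
  define M where "M = (\<integral>(y::'a). (norm y)\<^sup>2 \<partial>gaussian)"
  define t where "t n = 1 / real (Suc n)" for n
  have t: "t n > 0" for n by (simp add: t_def)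
  have t0: "t \<longlonglongrightarrow> 0" unfolding t_def using LIMSEQ_inverse_real_of_nat by (simp add: inverse_eq_divide)
  have "(\<lambda>n. (\<integral>x. bump a b ((1 / 1) *\<^sub>R x) \<partial>P (t n)) / t n) \<longlonglongrightarrow> (\<integral>x. bump a b x \<partial>N)"
  proof (rule bump_limit[where drift="2 * \<eta> * M"])
    have "0 \<le> M" unfolding M_def by (intro Bochner_Integration.integral_nonneg) auto
    then show "0 \<le> 2 * \<eta> * M" using eta_nonneg by simp
    show "integrable N (\<lambda>x. 1 - exp (- (norm x)\<^sup>2))" using integrable_one_minus_exp_N[of 1] by simp
    fix k :: nat
    show "(\<lambda>n. (\<integral>y. (1 - exp (- t n * \<psi> ((sqrt (2 * k) / 1) *\<^sub>R y))) \<partial>gaussian) / t n)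
      \<longlonglongrightarrow> (\<integral>x. (1 - exp (- (norm x)\<^sup>2) ^ k) \<partial>N) + 2 * \<eta> * M * real k"
    proof (cases "k = 0")
      case True
      then show ?thesis by (simp add: psi_eq)
    next
      case False
      define \<kappa> where "\<kappa> = sqrt (2 * real k)"
      have \<kappa>: "\<kappa> > 0" "\<kappa>\<^sup>2 = 2 * real k" using False by (auto simp: \<kappa>_def)
      have "(\<lambda>n. \<integral>y. (1 - exp (- t n * \<psi> (\<kappa> *\<^sub>R y))) / t n \<partial>gaussian) \<longlonglongrightarrow> (\<integral>y. \<psi> (\<kappa> *\<^sub>R y) \<partial>gaussian)"
      proof (rule integral_dominated_convergence)
        show "integrable gaussian (\<lambda>y. \<psi> (\<kappa> *\<^sub>R y))" by (rule integrable_gaussian_psi[OF \<kappa>(1)])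
        show "AE y in gaussian. (\<lambda>n. (1 - exp (- t n * \<psi> (\<kappa> *\<^sub>R y))) / t n) \<longlonglongrightarrow> \<psi> (\<kappa> *\<^sub>R y)"
        proof (intro always_eventually allI)
          fix y
          show "(\<lambda>n. (1 - exp (- t n * \<psi> (\<kappa> *\<^sub>R y))) / t n) \<longlonglongrightarrow> \<psi> (\<kappa> *\<^sub>R y)"
            using one_minus_exp_quotient_tendsto[of "\<lambda>_. \<psi> (\<kappa> *\<^sub>R y)" t, OF psi_nonneg t t0 tendsto_const] by simp
        qed
        show "AE y in gaussian. norm ((1 - exp (- t n * \<psi> (\<kappa> *\<^sub>R y))) / t n) \<le> \<psi> (\<kappa> *\<^sub>R y)" for n
        proof (intro always_eventually allI)
          fix y
          have "0 \<le> t n * \<psi> (\<kappa> *\<^sub>R y)" using t[of n] psi_nonneg by simp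
          then show "norm ((1 - exp (- t n * \<psi> (\<kappa> *\<^sub>R y))) / t n) \<le> \<psi> (\<kappa> *\<^sub>R y)"
            using one_minus_exp_bounds(2)[of "t n * \<psi> (\<kappa> *\<^sub>R y)"] t[of n] by (simp add: pos_divide_le_eq mult.commute)
        qed
      qed auto
      moreover have "(\<integral>y. \<psi> (\<kappa> *\<^sub>R y) \<partial>gaussian) = (\<integral>x. (1 - exp (- (norm x)\<^sup>2) ^ k) \<partial>N) + 2 * \<eta> * M * real k"
        unfolding gaussian_average_psi[OF \<kappa>(1)] by (simp add: \<kappa>(2) M_def exp_of_nat_mult[symmetric] mult_ac)
      ultimately show ?thesis by (simp add: \<kappa>_def)
    qed
  qed (use t sets_N in auto)
  then show ?thesis by (simp add: t_def)
qed

text \<open>For points of a thin shell near $x$ the two-sided bound on $p(t,\cdot)/t$ holds as soon as $t$ is small; letting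
$t$ tend to $0$ carries it to the averages of $\nu$, and monotonicity of $\nu$ and continuity of $\psi$
carry it to the point $x$.\<close>

theorem levy_density_asymptotics:
  assumes c: "c > 0"
    and lim: "\<And>\<epsilon>. \<epsilon> > 0 \<Longrightarrow> \<exists>\<delta>>0. \<forall>t>0. \<forall>x. 0 < norm x \<and> norm x \<le> \<delta> \<and> t * profile (inverse (norm x)) \<le> \<delta> \<longrightarrow>
          \<bar>p t x / (inverse (norm x) ^ DIM('a) * t * profile (inverse (norm x))) - c\<bar> \<le> \<epsilon>"
  shows "((\<lambda>x. \<nu> x / (inverse (norm x) ^ DIM('a) * profile (inverse (norm x)))) \<longlongrightarrow> c) (at 0)"
proof -
  define g where "g s = inverse s ^ DIM('a) * profile (inverse s)" for s
  have main: "\<exists>\<delta>>0. \<forall>x. 0 < norm x \<and> norm x < \<delta> \<longrightarrow> \<bar>\<nu> x / g (norm x) - c\<bar> \<le> \<epsilon>"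
    if \<epsilon>: "0 < \<epsilon>" "\<epsilon> < c" for \<epsilon>
  proof -
    obtain \<delta> where \<delta>: "\<delta> > 0" and bd: "\<And>t x. t > 0 \<Longrightarrow> 0 < norm x \<Longrightarrow> norm x \<le> \<delta> \<Longrightarrow> t * profile (inverse (norm x)) \<le> \<delta> \<Longrightarrow>
          \<bar>p t x / (inverse (norm x) ^ DIM('a) * t * profile (inverse (norm x))) - c\<bar> \<le> \<epsilon>"
      using lim[OF \<epsilon>(1)] by blast
    have pos: "profile s > 0" if "s > 0" for s
    proof -
      define x :: 'a where "x = \<delta> *\<^sub>R axis_vector"
      have nx: "norm x = \<delta>" using \<delta> by (simp add: x_def)
      have "profile (inverse \<delta>) \<noteq> 0"
      proof
        assume z: "profile (inverse \<delta>) = 0"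
        then have "\<bar>0 - c\<bar> \<le> \<epsilon>" using bd[of 1 x] nx \<delta> by simp
        then show False using \<epsilon> c by simp
      qed
      then have "profile (inverse \<delta>) > 0" using profile_nonneg[of "inverse \<delta>"] by linarith
      from profile_pos[OF this _ that] \<delta> show ?thesis by simp
    qed
    have gpos: "g s > 0" if "s > 0" for s using pos that by (simp add: g_def)
    have gcont: "isCont g s" if "s > 0" for s
    proof -
      have "isCont profile (inverse s)" using continuous_profile by (simp add: continuous_on_eq_continuous_at)
      moreover have "isCont inverse s" using that by (intro continuous_intros) auto
      ultimately have "isCont (\<lambda>s. profile (inverse s)) s" by (rule isCont_o2[rotated])
      then show ?thesis unfolding g_def using that by (intro continuous_intros) auto
    qed
    have p_bd: "(c - \<epsilon>) * g (norm y) * t \<le> p t y \<and> p t y \<le> (c + \<epsilon>) * g (norm y) * t"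
      if "t > 0" "0 < norm y" "norm y \<le> \<delta>" "t * profile (inverse (norm y)) \<le> \<delta>" for t y
    proof -
      have gt: "0 < g (norm y) * t" using gpos that by simp
      have "\<bar>p t y / (g (norm y) * t) - c\<bar> \<le> \<epsilon>" using bd[OF that] by (simp add: g_def mult_ac)
      then have "c - \<epsilon> \<le> p t y / (g (norm y) * t)" "p t y / (g (norm y) * t) \<le> c + \<epsilon>" unfolding abs_le_iff by linarith+
      then show ?thesis using gt by (simp add: le_divide_eq divide_le_eq mult.assoc)
    qed
    define J where "J a b = (\<integral>(y::'a). bump a b y \<partial>lborel)" for a b
    have small: "\<forall>\<^sub>F n in sequentially. 1 / real (Suc n) * B \<le> \<delta>" for B
    proof -
      have "(\<lambda>n. 1 / real (Suc n) * B) \<longlonglongrightarrow> 0 * B"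
        using LIMSEQ_inverse_real_of_nat by (intro tendsto_mult tendsto_const) (simp add: inverse_eq_divide)
      then have "\<forall>\<^sub>F n in sequentially. 1 / real (Suc n) * B < \<delta>" using \<delta> by (intro order_tendstoD) auto
      then show ?thesis by eventually_elim simp
    qed
    have intN: "integrable N (\<lambda>y. bump a b ((1 / 1) *\<^sub>R y))" if ab: "0 < a" "a < b" for a b
    proof (rule integral_bump_density_le(2)[OF density sets_N, of a b 1 "\<nu> (a *\<^sub>R axis_vector)"])
      have ne: "a *\<^sub>R axis_vector \<noteq> (0::'a)" using ab axis_vector_in_Basis[where 'a='a] by auto
      then show "0 \<le> \<nu> (a *\<^sub>R axis_vector)" by (rule isotropic_unimodal_density_nonneg[OF density])
      show "\<nu> y \<le> \<nu> (a *\<^sub>R axis_vector)" if "a * 1 < norm y" for y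
        using that ne ab by (intro isotropic_unimodal_density_mono[OF density]) auto
    qed (use ab in auto)
    have upper: "\<nu> x \<le> (c + \<epsilon>) * g (norm x)" if x: "0 < norm x" "norm x < \<delta>" for x
    proof (rule field_le_epsilon)
      fix e :: real assume e: "e > 0"
      define \<rho> where "\<rho> = norm x"
      define e' where "e' = e / (c + \<epsilon>)"
      have ce: "c + \<epsilon> > 0" using c \<epsilon> by simp
      have e': "e' > 0" using e ce by (simp add: e'_def)
      have "\<forall>\<^sub>F s in at_left \<rho>. g s < g \<rho> + e'"
        using gcont[of \<rho>] x e' by (intro order_tendstoD(2)[of g "g \<rho>"]) (auto simp: \<rho>_def isCont_def intro: tendsto_mono[OF at_le])
      then obtain a0 where a0: "a0 < \<rho>" "\<And>s. a0 < s \<Longrightarrow> s < \<rho> \<Longrightarrow> g s < g \<rho> + e'"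
        unfolding eventually_at_left_field by blast
      define a where "a = max a0 (\<rho> / 2)"
      have a: "0 < a" "a < \<rho>" "\<And>s. a < s \<Longrightarrow> s < \<rho> \<Longrightarrow> g s < g \<rho> + e'"
        using a0 x by (auto simp: a_def \<rho>_def less_max_iff_disj)
      have J: "J a \<rho> > 0" unfolding J_def using a by (intro integral_bump_pos) auto
      define \<kappa> where "\<kappa> = (c + \<epsilon>) * (g \<rho> + e')"
      have \<kappa>: "0 \<le> \<kappa>" using ce e' gpos[of \<rho>] x by (simp add: \<kappa>_def \<rho>_def)
      have "\<nu> x * (1 ^ DIM('a) * J a \<rho>) \<le> (\<integral>y. bump a \<rho> ((1 / 1) *\<^sub>R y) \<partial>N)"
        unfolding J_def
      proof (rule integral_bump_density_ge[OF density sets_N _ _ _ _ _ intN])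
        show "0 \<le> \<nu> x" using x by (intro isotropic_unimodal_density_nonneg[OF density]) auto
        show "\<nu> x \<le> \<nu> y" if "a * 1 < norm y" "norm y < \<rho> * 1" for y
          using that a by (intro isotropic_unimodal_density_mono[OF density]) (auto simp: \<rho>_def)
      qed (use a in auto)
      also have "(\<integral>y. bump a \<rho> ((1 / 1) *\<^sub>R y) \<partial>N) \<le> \<kappa> * J a \<rho>"
      proof (rule tendsto_upperbound[OF _ _ sequentially_bot])
        show "(\<lambda>n. (\<integral>y. bump a \<rho> y \<partial>P (1 / Suc n)) / (1 / Suc n)) \<longlonglongrightarrow> (\<integral>y. bump a \<rho> ((1 / 1) *\<^sub>R y) \<partial>N)"
          using bump_limit_small_time by simp
        show "\<forall>\<^sub>F n in sequentially. (\<integral>y. bump a \<rho> y \<partial>P (1 / Suc n)) / (1 / Suc n) \<le> \<kappa> * J a \<rho>"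
          using small[of "(g \<rho> + e') * \<rho> ^ DIM('a)"]
        proof eventually_elim
          case (elim n)
          define t where "t = 1 / real (Suc n)"
          have t: "t > 0" by (simp add: t_def)
          have "(\<integral>y. bump a \<rho> ((1 / 1) *\<^sub>R y) \<partial>P t) \<le> (\<kappa> * t) * (1 ^ DIM('a) * J a \<rho>)"
            unfolding J_def
          proof (rule integral_bump_density_le(1)[OF density_P[OF t] sets_P[OF t]])
            show "p t y \<le> \<kappa> * t" if y: "a * 1 < norm y" "norm y < \<rho> * 1" for y
            proof -
              have ny: "0 < norm y" "a < norm y" "norm y < \<rho>" using y a by auto
              have gy: "g (norm y) < g \<rho> + e'" using a(3) ny by simp
              have "profile (inverse (norm y)) = g (norm y) * norm y ^ DIM('a)"
                using ny by (simp add: g_def power_inverse)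
              also have "\<dots> \<le> (g \<rho> + e') * \<rho> ^ DIM('a)"
                using gy gpos[OF ny(1)] ny by (intro mult_mono power_mono) auto
              finally have "t * profile (inverse (norm y)) \<le> t * ((g \<rho> + e') * \<rho> ^ DIM('a))" using t by (intro mult_left_mono) auto
              also have "\<dots> \<le> \<delta>" using elim by (simp add: t_def)
              finally have "p t y \<le> (c + \<epsilon>) * g (norm y) * t" using p_bd[OF t ny(1)] ny x by (simp add: \<rho>_def)
              also have "\<dots> \<le> \<kappa> * t" unfolding \<kappa>_def using gy ce t by (intro mult_right_mono mult_left_mono) auto
              finally show ?thesis .
            qed
          qed (use a \<kappa> t in auto)
          then have "(\<integral>y. bump a \<rho> y \<partial>P t) / t \<le> \<kappa> * J a \<rho>" using t by (simp add: pos_divide_le_eq mult_ac)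
          then show ?case by (simp only: t_def)
        qed
      qed
      finally have "\<nu> x \<le> \<kappa>" using J by simp
      also have "\<kappa> = (c + \<epsilon>) * g (norm x) + e" using ce by (simp add: \<kappa>_def e'_def \<rho>_def distrib_left)
      finally show "\<nu> x \<le> (c + \<epsilon>) * g (norm x) + e" .
    qed
    have lower: "(c - \<epsilon>) * g (norm x) \<le> \<nu> x" if x: "0 < norm x" "norm x < \<delta>" for x
    proof (rule field_le_epsilon)
      fix e :: real assume e: "e > 0"
      define \<rho> where "\<rho> = norm x"
      have ce: "c - \<epsilon> > 0" using \<epsilon> by simp
      \<comment> \<open>The second bound keeps the lower bound for the density nonnegative.\<close>
      define e' where "e' = min (e / (c - \<epsilon>)) (g \<rho> / 2)"
      have g\<rho>: "g \<rho> > 0" using gpos x by (simp add: \<rho>_def)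
      have e': "e' > 0" using e ce g\<rho> by (simp add: e'_def)
      have e'_less: "e' < g \<rho>"
        unfolding e'_def using g\<rho> by (intro le_less_trans[OF min.cobounded2]) simp
      have "\<forall>\<^sub>F s in at_right \<rho>. g \<rho> - e' < g s \<and> g s < g \<rho> + e'"
        using gcont[of \<rho>] x e'
        by (intro eventually_conj order_tendstoD[of g "g \<rho>"]) (auto simp: \<rho>_def isCont_def intro: tendsto_mono[OF at_le])
      then obtain b0 where b0: "b0 > \<rho>" "\<And>s. \<rho> < s \<Longrightarrow> s < b0 \<Longrightarrow> g \<rho> - e' < g s \<and> g s < g \<rho> + e'"
        unfolding eventually_at_right_field by blast
      define b where "b = min b0 \<delta>"
      have b: "\<rho> < b" "b \<le> \<delta>" "\<And>s. \<rho> < s \<Longrightarrow> s < b \<Longrightarrow> g \<rho> - e' < g s \<and> g s < g \<rho> + e'"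
        using b0 x by (auto simp: b_def \<rho>_def)
      have \<rho>0: "0 < \<rho>" using x by (simp add: \<rho>_def)
      have J: "J \<rho> b > 0" unfolding J_def using b \<rho>0 by (intro integral_bump_pos) auto
      define \<kappa> where "\<kappa> = (c - \<epsilon>) * (g \<rho> - e')"
      have \<kappa>: "0 \<le> \<kappa>" using ce e'_less by (simp add: \<kappa>_def)
      have "\<kappa> * J \<rho> b \<le> (\<integral>y. bump \<rho> b ((1 / 1) *\<^sub>R y) \<partial>N)"
      proof (rule tendsto_lowerbound[OF _ _ sequentially_bot])
        show "(\<lambda>n. (\<integral>y. bump \<rho> b y \<partial>P (1 / Suc n)) / (1 / Suc n)) \<longlonglongrightarrow> (\<integral>y. bump \<rho> b ((1 / 1) *\<^sub>R y) \<partial>N)"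
          using bump_limit_small_time by simp
        show "\<forall>\<^sub>F n in sequentially. \<kappa> * J \<rho> b \<le> (\<integral>y. bump \<rho> b y \<partial>P (1 / Suc n)) / (1 / Suc n)"
          using small[of "(g \<rho> + e') * b ^ DIM('a)"]
        proof eventually_elim
          case (elim n)
          define t where "t = 1 / real (Suc n)"
          have t: "t > 0" by (simp add: t_def)
          have "(\<kappa> * t) * (1 ^ DIM('a) * J \<rho> b) \<le> (\<integral>y. bump \<rho> b ((1 / 1) *\<^sub>R y) \<partial>P t)"
            unfolding J_def
          proof (rule integral_bump_density_ge[OF density_P[OF t] sets_P[OF t]])
            show "\<kappa> * t \<le> p t y" if y: "\<rho> * 1 < norm y" "norm y < b * 1" for y
            proof -
              have ny: "0 < norm y" "\<rho> < norm y" "norm y < b" using y \<rho>0 by auto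
              have gy: "g \<rho> - e' < g (norm y)" "g (norm y) < g \<rho> + e'" using b(3)[of "norm y"] ny by auto
              have "profile (inverse (norm y)) = g (norm y) * norm y ^ DIM('a)"
                using ny by (simp add: g_def power_inverse)
              also have "\<dots> \<le> (g \<rho> + e') * b ^ DIM('a)"
                using gy gpos[OF ny(1)] ny by (intro mult_mono power_mono) auto
              finally have "t * profile (inverse (norm y)) \<le> t * ((g \<rho> + e') * b ^ DIM('a))" using t by (intro mult_left_mono) auto
              also have "\<dots> \<le> \<delta>" using elim by (simp add: t_def)
              finally have "(c - \<epsilon>) * g (norm y) * t \<le> p t y" using p_bd[OF t ny(1)] ny b by simp
              moreover have "\<kappa> * t \<le> (c - \<epsilon>) * g (norm y) * t" unfolding \<kappa>_def using gy ce t by (intro mult_right_mono mult_left_mono) auto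
              ultimately show ?thesis by linarith
            qed
            interpret prob_space "P t" by (rule prob[OF t])
            note [measurable_cong] = sets_P[OF t]
            show "integrable (P t) (\<lambda>y. bump \<rho> b ((1 / 1) *\<^sub>R y))"
              by (intro integrable_const_bound[where B=1]) (auto simp: abs_of_nonneg bump_nonneg bump_le_one)
          qed (use b \<rho>0 \<kappa> t in auto)
          then have "\<kappa> * J \<rho> b \<le> (\<integral>y. bump \<rho> b y \<partial>P t) / t" using t by (simp add: pos_le_divide_eq mult_ac)
          then show ?case by (simp only: t_def)
        qed
      qed
      also have "\<dots> \<le> \<nu> x * (1 ^ DIM('a) * J \<rho> b)"
        unfolding J_def
      proof (rule integral_bump_density_le(1)[OF density sets_N])
        show "0 \<le> \<nu> x" using x by (intro isotropic_unimodal_density_nonneg[OF density]) auto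
        show "\<nu> y \<le> \<nu> x" if "\<rho> * 1 < norm y" for y
          using that x by (intro isotropic_unimodal_density_mono[OF density]) (auto simp: \<rho>_def)
      qed (use b \<rho>0 in auto)
      finally have "\<kappa> \<le> \<nu> x" using J by simp
      moreover have "(c - \<epsilon>) * e' \<le> e"
      proof -
        have "(c - \<epsilon>) * e' \<le> (c - \<epsilon>) * (e / (c - \<epsilon>))" using ce by (intro mult_left_mono) (auto simp: e'_def)
        then show ?thesis using ce by simp
      qed
      ultimately show "(c - \<epsilon>) * g (norm x) \<le> \<nu> x + e" by (simp add: \<kappa>_def \<rho>_def right_diff_distrib)
    qed
    show ?thesis
    proof (intro exI[of _ \<delta>] conjI allI impI \<delta>)
      fix x :: 'a assume x: "0 < norm x \<and> norm x < \<delta>"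
      then have "c - \<epsilon> \<le> \<nu> x / g (norm x)" "\<nu> x / g (norm x) \<le> c + \<epsilon>"
        using upper[of x] lower[of x] gpos[of "norm x"] by (simp_all add: le_divide_eq divide_le_eq)
      then show "\<bar>\<nu> x / g (norm x) - c\<bar> \<le> \<epsilon>" unfolding abs_le_iff by linarith
    qed
  qed
  show ?thesis
    unfolding tendsto_iff
  proof (intro allI impI)
    fix e :: real assume e: "e > 0"
    have "0 < min (e / 2) (c / 2)" "min (e / 2) (c / 2) < c" using e c by auto
    from main[OF this] obtain \<delta> where "\<delta> > 0"
      and d: "\<And>x. 0 < norm x \<Longrightarrow> norm x < \<delta> \<Longrightarrow> \<bar>\<nu> x / g (norm x) - c\<bar> \<le> min (e / 2) (c / 2)" by blast
    have "dist (\<nu> x / (inverse (norm x) ^ DIM('a) * profile (inverse (norm x)))) c < e"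
      if "x \<noteq> 0" "norm x < \<delta>" for x
      using d[of x] that e by (simp add: g_def dist_real_def)
    then show "\<forall>\<^sub>F x in at 0. dist (\<nu> x / (inverse (norm x) ^ DIM('a) * profile (inverse (norm x)))) c < e"
      unfolding eventually_at using \<open>\<delta> > 0\<close> by (auto simp: dist_norm)
  qed
qed

end

section \<open>The cosine equation\<close>

text \<open>Equicontinuity is required only from some index on, which depends on the point and on the error; this is what is
available for approximate solutions.  The convergence is continuous convergence: the arguments may vary
with the index.\<close>

lemma arzela_ascoli_pointwise:
  fixes f :: "nat \<Rightarrow> real \<Rightarrow> real"
  assumes bd: "\<And>l. l > 0 \<Longrightarrow> \<exists>B. \<forall>n. \<bar>f n l\<bar> \<le> B"
    and equi: "\<And>l e. l > 0 \<Longrightarrow> e > 0 \<Longrightarrow>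
      \<exists>d>0. \<exists>n0. \<forall>n\<ge>n0. \<forall>m>0. \<bar>m - l\<bar> < d \<longrightarrow> \<bar>f n m - f n l\<bar> < e"
  obtains k g where "strict_mono (k :: nat \<Rightarrow> nat)" "continuous_on {0<..} g"
    "\<And>s l. l > 0 \<Longrightarrow> s \<longlonglongrightarrow> l \<Longrightarrow> (\<lambda>n. f (k n) (s n)) \<longlonglongrightarrow> g l"
proof -
  obtain B where B: "\<And>l n. l > 0 \<Longrightarrow> \<bar>f n l\<bar> \<le> B l" using bd by metis
  define S where "S = {q \<in> \<rat>. q > (0::real)}"
  have cS: "countable S" unfolding S_def
    by (rule countable_subset[OF _ countable_rat]) auto
  have nb: "norm (f n x / (\<bar>B x\<bar> + 1)) \<le> 1" if "x \<in> S" for n x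
    using B[of x n] that by (auto simp: S_def abs_divide)
  obtain k where k: "strict_mono k"
    and kl: "\<And>x. x \<in> S \<Longrightarrow> \<exists>l. (\<lambda>n. f (k n) x / (\<bar>B x\<bar> + 1)) \<longlonglongrightarrow> l"
    using function_convergent_subsequence[OF cS, of "\<lambda>n x. f n x / (\<bar>B x\<bar> + 1)" 1] nb by blast
  have S_conv: "convergent (\<lambda>n. f (k n) x)" if x: "x \<in> S" for x
  proof -
    obtain l where "(\<lambda>n. f (k n) x / (\<bar>B x\<bar> + 1)) \<longlonglongrightarrow> l" using kl[OF x] by blast
    then have "(\<lambda>n. f (k n) x / (\<bar>B x\<bar> + 1) * (\<bar>B x\<bar> + 1)) \<longlonglongrightarrow> l * (\<bar>B x\<bar> + 1)"
      by (rule tendsto_mult_right)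
    moreover have "\<bar>B x\<bar> + 1 \<noteq> 0" by linarith
    ultimately have "(\<lambda>n. f (k n) x) \<longlonglongrightarrow> l * (\<bar>B x\<bar> + 1)" by simp
    then show ?thesis by (auto simp: convergent_def)
  qed
  have conv: "convergent (\<lambda>n. f (k n) l)" if l: "l > 0" for l
  proof (rule Cauchy_convergent, rule CauchyI)
    fix e :: real assume e: "e > 0"
    obtain d n0 where d: "d > 0" "\<And>n m. n \<ge> n0 \<Longrightarrow> m > 0 \<Longrightarrow> \<bar>m - l\<bar> < d \<Longrightarrow> \<bar>f n m - f n l\<bar> < e / 3"
      using equi[OF l, of "e/3"] e by auto
    obtain q where q: "q \<in> \<rat>" "l < q" "q < l + d" using Rats_dense_in_real[of l "l + d"] d by auto
    then have "q \<in> S" using l by (simp add: S_def)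
    then obtain n1 where n1: "\<And>n m. n \<ge> n1 \<Longrightarrow> m \<ge> n1 \<Longrightarrow> \<bar>f (k n) q - f (k m) q\<bar> < e / 3"
      using CauchyD[OF convergent_Cauchy[OF S_conv], of q "e/3"] e by (auto simp: real_norm_def)
    show "\<exists>M. \<forall>m\<ge>M. \<forall>n\<ge>M. norm (f (k m) l - f (k n) l) < e"
    proof (intro exI allI impI)
      fix m n assume m: "m \<ge> max n0 n1" and n: "n \<ge> max n0 n1"
      have "k m \<ge> n0" "k n \<ge> n0" using seq_suble[OF k, of m] seq_suble[OF k, of n] m n by auto
      then have "\<bar>f (k m) q - f (k m) l\<bar> < e / 3" "\<bar>f (k n) q - f (k n) l\<bar> < e / 3"
        using d(2)[of "k m" q] d(2)[of "k n" q] q l by auto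
      moreover have "\<bar>f (k m) q - f (k n) q\<bar> < e / 3" using n1 m n by auto
      ultimately show "norm (f (k m) l - f (k n) l) < e" by (simp only: real_norm_def)
    qed
  qed
  define g where "g l = lim (\<lambda>n. f (k n) l)" for l
  have lim: "(\<lambda>n. f (k n) l) \<longlonglongrightarrow> g l" if "l > 0" for l
    using conv[OF that] by (simp add: g_def convergent_LIMSEQ_iff)
  have lims: "(\<lambda>n. f (k n) (s n)) \<longlonglongrightarrow> g l" if l: "l > 0" and s: "s \<longlonglongrightarrow> l" for s l
  proof -
    have "(\<lambda>n. f (k n) (s n) - f (k n) l) \<longlonglongrightarrow> 0"
    proof (rule LIMSEQ_I)
      fix e :: real assume e: "e > 0"
      obtain d n0 where d: "d > 0" "\<And>n m. n \<ge> n0 \<Longrightarrow> m > 0 \<Longrightarrow> \<bar>m - l\<bar> < d \<Longrightarrow> \<bar>f n m - f n l\<bar> < e"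
        using equi[OF l e] by auto
      obtain n1 where n1: "\<And>n. n \<ge> n1 \<Longrightarrow> \<bar>s n - l\<bar> < min d l"
        using LIMSEQ_D[OF s, of "min d l"] d l by (auto simp: real_norm_def)
      show "\<exists>no. \<forall>n\<ge>no. norm (f (k n) (s n) - f (k n) l - 0) < e"
      proof (intro exI allI impI)
        fix n assume n: "n \<ge> max n0 n1"
        then have "k n \<ge> n0" using seq_suble[OF k, of n] by auto
        moreover have "\<bar>s n - l\<bar> < d" "\<bar>s n - l\<bar> < l" using n1[of n] n by auto
        ultimately show "norm (f (k n) (s n) - f (k n) l - 0) < e"
          using d(2)[of "k n" "s n"] by auto
      qed
    qed
    from tendsto_add[OF this lim[OF l]] show ?thesis by simp
  qed
  have "continuous_on {0<..} g"
    unfolding continuous_on_iff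
  proof (intro ballI allI impI)
    fix l e :: real assume "l \<in> {0<..}" and e: "e > 0"
    then have l: "l > 0" by simp
    obtain d n0 where d: "d > 0" "\<And>n m. n \<ge> n0 \<Longrightarrow> m > 0 \<Longrightarrow> \<bar>m - l\<bar> < d \<Longrightarrow> \<bar>f n m - f n l\<bar> < e / 2"
      using equi[OF l, of "e/2"] e by auto
    show "\<exists>d>0. \<forall>m\<in>{0<..}. dist m l < d \<longrightarrow> dist (g m) (g l) < e"
    proof (intro exI conjI ballI impI)
      fix m assume m: "m \<in> {0<..}" "dist m l < d"
      have "(\<lambda>n. \<bar>f (k n) m - f (k n) l\<bar>) \<longlonglongrightarrow> \<bar>g m - g l\<bar>"
        using m l by (intro tendsto_intros lim) auto
      then have "\<bar>g m - g l\<bar> \<le> e / 2"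
      proof (rule LIMSEQ_le_const2, intro exI allI impI)
        fix n assume "n \<ge> n0"
        then have "k n \<ge> n0" using seq_suble[OF k, of n] by auto
        then show "\<bar>f (k n) m - f (k n) l\<bar> \<le> e / 2"
          using d(2)[of "k n" m] m by (auto simp: dist_real_def)
      qed
      then show "dist (g m) (g l) < e" using e by (simp add: dist_real_def)
    qed (rule d)
  qed
  with k lims that show ?thesis by blast
qed

text \<open>For $0 < \epsilon < 2$ both exponents lie strictly between $0$ and $2$.  This is the range in which powers are integrable against
the kernel, so multiples of this function dominate.\<close>

definition growth :: "real \<Rightarrow> real \<Rightarrow> real" where
  "growth \<epsilon> x = x powr \<epsilon> + x powr (2 - \<epsilon>)"

lemma growth_nonneg: "0 \<le> growth \<epsilon> x"
  by (simp add: growth_def)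

lemma growth_measurable [measurable]: "growth \<epsilon> \<in> borel_measurable borel"
  unfolding growth_def[abs_def] by measurable

text \<open>In the variables $\log l$ and $\log|z|$ the transform below is a convolution with a nonnegative kernel, and
\<open>\<kappa>\<close> is the Mellin transform of this kernel.\<close>

locale cosine_convolution =
  fixes e :: "'a::euclidean_space" and c :: real
  assumes norm_e: "norm e = 1" and c_pos: "c > 0"
begin

abbreviation H :: "'a measure" where "H \<equiv> dilation_measure"

definition cosine_transform :: "(real \<Rightarrow> real) \<Rightarrow> real \<Rightarrow> real" where
  "cosine_transform g l = (\<integral>z. (1 - cos (z \<bullet> e)) * g (l / norm z) \<partial>H)"

definition \<kappa> :: "real \<Rightarrow> real" where
  "\<kappa> \<rho> = (\<integral>z. (1 - cos (z \<bullet> e)) * norm z powr - \<rho> \<partial>H)"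

text \<open>Integrability is part of the notion, so that solutions form a vector space that is invariant under
dilations.\<close>

definition solution :: "(real \<Rightarrow> real) \<Rightarrow> bool" where
  "solution g \<longleftrightarrow> continuous_on {0<..} g \<and>
     (\<forall>l>0. integrable H (\<lambda>z. (1 - cos (z \<bullet> e)) * g (l / norm z)) \<and> g l = c * cosine_transform g l)"

lemma weight_le: "1 - cos (s * (z \<bullet> e)) \<le> 2 * max 1 (s\<^sup>2) * min 1 ((norm z)\<^sup>2)"
proof -
  have "1 - cos (s * (z \<bullet> e)) \<le> 2 * min 1 (s\<^sup>2 * (norm z)\<^sup>2)"
    using one_minus_cos_inner_le[of "s *\<^sub>R e" z] norm_e by (simp add: inner_commute power_mult_distrib)
  also have "\<dots> \<le> 2 * (max 1 (s\<^sup>2) * min 1 ((norm z)\<^sup>2))"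
    using min_one_scale_le[of "s\<^sup>2" "(norm z)\<^sup>2"] by simp
  finally show ?thesis by simp
qed

lemma powr_quotient: "l > 0 \<Longrightarrow> (l / norm z) powr \<rho> = l powr \<rho> * norm (z :: 'a) powr - \<rho>"
  by (simp add: powr_divide powr_minus field_simps)

lemma integrable_weight_powr:
  assumes "0 < \<rho>" "\<rho> < 2"
  shows "integrable H (\<lambda>z. (1 - cos (z \<bullet> e)) * norm z powr - \<rho>)"
proof (rule Bochner_Integration.integrable_bound)
  show "integrable H (\<lambda>z. 2 * (min 1 ((norm z)\<^sup>2) * norm z powr - \<rho>))"
    using integrable_min_powr[OF assms] by simp
  show "AE z in H. norm ((1 - cos (z \<bullet> e)) * norm z powr - \<rho>)
      \<le> norm (2 * (min 1 ((norm z)\<^sup>2) * norm z powr - \<rho>))"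
  proof (intro always_eventually allI)
    fix z
    have "(1 - cos (z \<bullet> e)) * norm z powr - \<rho> \<le> (2 * min 1 ((norm z)\<^sup>2)) * norm z powr - \<rho>"
      using weight_le[of 1 z] by (intro mult_right_mono) auto
    then show "norm ((1 - cos (z \<bullet> e)) * norm z powr - \<rho>)
      \<le> norm (2 * (min 1 ((norm z)\<^sup>2) * norm z powr - \<rho>))" by (simp add: mult.assoc)
  qed
qed auto

lemma integrable_min_growth:
  assumes \<epsilon>: "0 < \<epsilon>" "\<epsilon> < 2" and l: "l > 0"
  shows "integrable H (\<lambda>z. min 1 ((norm z)\<^sup>2) * growth \<epsilon> (l / norm z))"
proof -
  have "integrable H (\<lambda>z::'a. l powr \<epsilon> * (min 1 ((norm z)\<^sup>2) * norm z powr - \<epsilon>)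
      + l powr (2 - \<epsilon>) * (min 1 ((norm z)\<^sup>2) * norm z powr - (2 - \<epsilon>)))"
    using \<epsilon> by (intro Bochner_Integration.integrable_add integrable_mult_right integrable_min_powr) auto
  then show ?thesis
    by (rule Bochner_Integration.integrable_cong[THEN iffD1, rotated -1])
       (simp_all only: growth_def powr_quotient[OF l] distrib_left mult_ac refl)
qed

lemma integrable_cosine_transform:
  assumes \<epsilon>: "0 < \<epsilon>" "\<epsilon> < 2" and l: "l > 0"
    and v: "(\<lambda>x. indicator {0<..} x * v x) \<in> borel_measurable borel"
    and bd: "\<And>x. x > 0 \<Longrightarrow> \<bar>v x\<bar> \<le> C * growth \<epsilon> x"
  shows "integrable H (\<lambda>z. (1 - cos (z \<bullet> e)) * v (l / norm z))"
proof (rule Bochner_Integration.integrable_bound)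
  show "integrable H (\<lambda>z. (2 * C) * (min 1 ((norm z)\<^sup>2) * growth \<epsilon> (l / norm z)))"
    using integrable_min_growth[OF \<epsilon> l] by simp
  have "(\<lambda>z. (1 - cos (z \<bullet> e)) * (\<lambda>x. indicator {0<..} x * v x) (l / norm z)) \<in> borel_measurable H"
    by (intro borel_measurable_times measurable_compose[OF _ v]) simp_all
  also have "(\<lambda>z. (1 - cos (z \<bullet> e)) * (\<lambda>x. indicator {0<..} x * v x) (l / norm z))
      = (\<lambda>z. (1 - cos (z \<bullet> e)) * v (l / norm z))"
    using l by (auto simp: fun_eq_iff indicator_def zero_less_divide_iff)
  finally show "(\<lambda>z. (1 - cos (z \<bullet> e)) * v (l / norm z)) \<in> borel_measurable H" .
  show "AE z in H. norm ((1 - cos (z \<bullet> e)) * v (l / norm z))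
      \<le> norm ((2 * C) * (min 1 ((norm z)\<^sup>2) * growth \<epsilon> (l / norm z)))"
  proof (intro always_eventually allI)
    fix z :: 'a
    show "norm ((1 - cos (z \<bullet> e)) * v (l / norm z))
      \<le> norm ((2 * C) * (min 1 ((norm z)\<^sup>2) * growth \<epsilon> (l / norm z)))"
    proof (cases "z = 0")
      case False
      then have "\<bar>v (l / norm z)\<bar> \<le> C * growth \<epsilon> (l / norm z)" using l by (intro bd) auto
      then have "(1 - cos (z \<bullet> e)) * \<bar>v (l / norm z)\<bar>
          \<le> (2 * min 1 ((norm z)\<^sup>2)) * (C * growth \<epsilon> (l / norm z))"
        using weight_le[of 1 z] by (intro mult_mono) auto
      also have "\<dots> = (2 * C) * (min 1 ((norm z)\<^sup>2) * growth \<epsilon> (l / norm z))" by simp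
      also have "\<dots> \<le> norm \<dots>" by (simp only: real_norm_def abs_ge_self)
      finally show ?thesis by (simp add: abs_mult)
    qed simp
  qed
qed

lemma continuous_on_positive_measurable:
  fixes g :: "real \<Rightarrow> real"
  assumes "continuous_on {0<..} g"
  shows "(\<lambda>x. indicator {0<..} x * g x) \<in> borel_measurable borel"
  using borel_measurable_continuous_on_indicator[OF _ assms] by simp

lemma cosine_transform_powr:
  assumes "l > 0"
  shows "cosine_transform (\<lambda>x. x powr \<rho>) l = l powr \<rho> * \<kappa> \<rho>"
proof -
  have "cosine_transform (\<lambda>x. x powr \<rho>) l = (\<integral>z. l powr \<rho> * ((1 - cos (z \<bullet> e)) * norm z powr - \<rho>) \<partial>H)"
    unfolding cosine_transform_def powr_quotient[OF assms] by (simp only: mult_ac)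
  then show ?thesis by (simp add: \<kappa>_def)
qed

lemma solution_powr:
  assumes "0 < \<rho>" "\<rho> < 2" "c * \<kappa> \<rho> = 1"
  shows "solution (\<lambda>l. l powr \<rho>)"
  unfolding solution_def
proof (intro conjI allI impI)
  show "continuous_on {0<..} (\<lambda>l. l powr \<rho>)" by (intro continuous_intros) auto
  fix l :: real assume l: "l > 0"
  have "integrable H (\<lambda>z. l powr \<rho> * ((1 - cos (z \<bullet> e)) * norm z powr - \<rho>))"
    using integrable_weight_powr[OF assms(1,2)] by simp
  then show "integrable H (\<lambda>z. (1 - cos (z \<bullet> e)) * (l / norm z) powr \<rho>)"
    unfolding powr_quotient[OF l] by (simp only: mult_ac)
  show "l powr \<rho> = c * cosine_transform (\<lambda>l. l powr \<rho>) l"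
    using assms(3) by (simp add: cosine_transform_powr[OF l])
qed

lemma solution_cmult:
  assumes "solution f"
  shows "solution (\<lambda>l. a * f l)"
  using assms unfolding solution_def cosine_transform_def
  by (auto intro!: continuous_intros simp: mult.left_commute[of _ a])

lemma solution_add:
  assumes f: "solution f" and g: "solution g"
  shows "solution (\<lambda>l. f l + g l)"
  using assms unfolding solution_def cosine_transform_def
  by (auto intro!: continuous_intros simp: distrib_left Bochner_Integration.integral_add)

lemma solution_diff:
  assumes f: "solution f" and g: "solution g"
  shows "solution (\<lambda>l. f l - g l)"
  using solution_add[OF f solution_cmult[OF g, of "-1"]] by simp

lemma solution_scale:
  assumes "solution f" "k > 0"
  shows "solution (\<lambda>l. f (k * l))"
  unfolding solution_def
proof (intro conjI allI impI)
  show "continuous_on {0<..} (\<lambda>l. f (k * l))"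
  proof (rule continuous_on_compose2[of "{0<..}" f "{0<..}" "\<lambda>l. k * l"])
    show "continuous_on {0<..} f" using assms by (simp add: solution_def)
    show "continuous_on {0<..} (\<lambda>l. k * l)" by (intro continuous_intros)
    show "(\<lambda>l. k * l) ` {0<..} \<subseteq> {0<..}" using assms by auto
  qed
  fix l :: real assume l: "l > 0"
  have "k * l > 0" using l assms by simp
  then show "integrable H (\<lambda>z. (1 - cos (z \<bullet> e)) * f (k * (l / norm z)))"
    "f (k * l) = c * cosine_transform (\<lambda>l. f (k * l)) l"
    using assms(1) unfolding solution_def cosine_transform_def by (simp_all add: mult.assoc)
qed

text \<open>The strong maximum principle.  At a zero $l_0$ the equation states that the integral of the nonnegative function
$(1 - \cos\langle z,e\rangle) f(l_0/|z|)$ is $0$.  The first factor vanishes only on countably many hyperplanes,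
and $l_0/|z|$ covers all positive reals.\<close>

lemma solution_nonneg_zero:
  assumes f: "solution f" and nn: "\<And>l. l > 0 \<Longrightarrow> 0 \<le> f l"
    and l0: "l0 > 0" "f l0 = 0" and l1: "l1 > 0"
  shows "f l1 = 0"
proof (rule ccontr)
  assume "f l1 \<noteq> 0"
  have cont: "continuous_on {0<..} f" using f by (simp add: solution_def)
  have int: "integrable H (\<lambda>z. (1 - cos (z \<bullet> e)) * f (l0 / norm z))" 
    and "f l0 = c * cosine_transform f l0" using f l0 by (auto simp: solution_def)
  then have "(\<integral>z. (1 - cos (z \<bullet> e)) * f (l0 / norm z) \<partial>H) = 0" using l0 c_pos by (simp add: cosine_transform_def)
  moreover have "AE z in H. 0 \<le> (1 - cos (z \<bullet> e)) * f (l0 / norm z)"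
    using AE_dilation_measure_nonzero
    by eventually_elim (use l0 in \<open>auto intro!: mult_nonneg_nonneg nn simp: zero_less_divide_iff\<close>)
  ultimately have "AE z in H. (1 - cos (z \<bullet> e)) * f (l0 / norm z) = 0"
    using integral_nonneg_eq_0_iff_AE[OF int] by simp
  then have "AE (z::'a) in lborel. z \<noteq> 0 \<longrightarrow> (1 - cos (z \<bullet> e)) * f (l0 / norm z) = 0"
    unfolding AE_dilation_measure .
  moreover have "AE (z::'a) in lborel. cos (z \<bullet> e) \<noteq> 1"
  proof -
    have "e \<noteq> 0" using norm_e by auto
    have "{z. e \<bullet> z = real_of_int n * (2 * pi)} \<in> null_sets lebesgue" for n :: int
      using negligible_hyperplane[of e] \<open>e \<noteq> 0\<close> by (simp add: negligible_iff_null_sets)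
    then have "(\<Union>n::int. {z. e \<bullet> z = real_of_int n * (2 * pi)}) \<in> null_sets lebesgue"
      by (intro null_sets_UN') auto
    also have "(\<Union>n::int. {z. e \<bullet> z = real_of_int n * (2 * pi)}) = {z. cos (z \<bullet> e) = 1}"
      by (auto simp: cos_one_2pi_int inner_commute)
    finally have "{z. cos (z \<bullet> e) = 1} \<in> null_sets lebesgue" .
    then have "{z. cos (z \<bullet> e) = 1} \<in> null_sets lborel"
      by (subst (asm) null_sets_completion_iff) auto
    then show ?thesis by (rule AE_I') auto
  qed
  ultimately have AE0: "AE (z::'a) in lborel. z \<noteq> 0 \<longrightarrow> f (l0 / norm z) = 0"
    by eventually_elim auto
  define S where "S = {z::'a. z \<noteq> 0 \<and> f (l0 / norm z) \<in> {0<..}}"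
  have "open S"
  proof -
    have "continuous_on (- {0::'a}) (\<lambda>z. f (l0 / norm z))"
      using l0 by (intro continuous_on_compose2[OF cont] continuous_intros) (auto simp: zero_less_divide_iff)
    then have "open (- {0::'a} \<inter> (\<lambda>z. f (l0 / norm z)) -` {0<..})"
      by (rule continuous_open_preimage) auto
    also have "- {0::'a} \<inter> (\<lambda>z. f (l0 / norm z)) -` {0<..} = S" by (auto simp: S_def)
    finally show ?thesis .
  qed
  moreover have "(l0 / l1) *\<^sub>R e \<in> S"
    using l0 l1 norm_e nn[OF l1] \<open>f l1 \<noteq> 0\<close> by (auto simp: S_def)
  ultimately have "emeasure lborel S > 0" by (intro emeasure_lborel_open_pos) auto
  moreover have "AE (z::'a) in lborel. z \<notin> S" using AE0 by eventually_elim (auto simp: S_def)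
  then have "emeasure lborel S = 0"
    using \<open>open S\<close> by (subst (asm) AE_iff_measurable[where N=S]) auto
  ultimately show False by simp
qed

end

section \<open>Compactness of families of solutions\<close>

context cosine_convolution
begin

text \<open>The dependence on $l$ is moved from the function, about whose regularity nothing is known, to the kernel.\<close>

lemma cosine_transform_rescaled:
  assumes v: "(\<lambda>x. indicator {0<..} x * v x) \<in> borel_measurable borel" and l: "l > 0"
  shows "cosine_transform v l = (\<integral>y. (1 - cos (l * (y \<bullet> e))) * v (1 / norm y) \<partial>H)"
proof -
  define F where "F z = (1 - cos (z \<bullet> e)) * v (l / norm z)" for z
  have "(\<lambda>z. (1 - cos (z \<bullet> e)) * (\<lambda>x. indicator {0<..} x * v x) (l / norm z)) \<in> borel_measurable borel"
    by (intro borel_measurable_times measurable_compose[OF _ v]) simp_all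
  also have "(\<lambda>z. (1 - cos (z \<bullet> e)) * (\<lambda>x. indicator {0<..} x * v x) (l / norm z)) = F"
    using l by (auto simp: fun_eq_iff F_def indicator_def zero_less_divide_iff)
  finally have "F \<in> borel_measurable borel" .
  from integral_dilation_measure_scaleR[OF this l] have "cosine_transform v l = (\<integral>y. F (l *\<^sub>R y) \<partial>H)"
    by (simp add: cosine_transform_def F_def)
  also have "\<dots> = (\<integral>y. (1 - cos (l * (y \<bullet> e))) * v (1 / norm y) \<partial>H)"
    using l by (simp add: F_def)
  finally show ?thesis .
qed

lemma integrable_cosine_transform_rescaled:
  assumes v: "(\<lambda>x. indicator {0<..} x * v x) \<in> borel_measurable borel" and l: "l > 0"
    and \<epsilon>: "0 < \<epsilon>" "\<epsilon> < 2" and bd: "\<And>x. x > 0 \<Longrightarrow> \<bar>v x\<bar> \<le> C * growth \<epsilon> x"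
  shows "integrable H (\<lambda>y. (1 - cos (l * (y \<bullet> e))) * v (1 / norm y))"
proof -
  define F where "F z = (1 - cos (z \<bullet> e)) * v (l / norm z)" for z
  have i: "integrable H F" unfolding F_def[abs_def] by (rule integrable_cosine_transform[OF \<epsilon> l v bd])
  then have "F \<in> borel_measurable borel"
    using borel_measurable_integrable[OF i] by simp
  from integrable_dilation_measure_scaleR[OF this l] i
  have "integrable H (\<lambda>y. F (l *\<^sub>R y))" by simp
  then show ?thesis using l by (simp add: F_def)
qed

text \<open>A modulus of continuity shared by the transforms of all functions below a multiple of the growth
function.\<close>

definition modulus :: "real \<Rightarrow> real \<Rightarrow> real \<Rightarrow> real" where
  "modulus \<epsilon> l m = (\<integral>y. \<bar>cos (m * (y \<bullet> e)) - cos (l * (y \<bullet> e))\<bar> * growth \<epsilon> (1 / norm y) \<partial>H)"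

lemma modulus_bound:
  assumes "\<bar>l\<bar> \<le> L" "\<bar>m\<bar> \<le> L"
  shows "\<bar>cos (m * (y \<bullet> e)) - cos (l * (y \<bullet> e))\<bar> * growth \<epsilon> (1 / norm y)
     \<le> 4 * max 1 (L\<^sup>2) * (min 1 ((norm y)\<^sup>2) * growth \<epsilon> (1 / norm y))"
proof -
  have w: "1 - cos (s * (y \<bullet> e)) \<le> 2 * (max 1 (L\<^sup>2) * min 1 ((norm y)\<^sup>2))" if "\<bar>s\<bar> \<le> L" for s
  proof -
    have "s\<^sup>2 \<le> L\<^sup>2" using that power_mono[of "\<bar>s\<bar>" L 2] by simp
    then have "2 * max 1 (s\<^sup>2) * min 1 ((norm y)\<^sup>2) \<le> 2 * max 1 (L\<^sup>2) * min 1 ((norm y)\<^sup>2)"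
      by (intro mult_right_mono) auto
    then show ?thesis using weight_le[of s y] by simp
  qed
  have "\<bar>cos (m * (y \<bullet> e)) - cos (l * (y \<bullet> e))\<bar> \<le> 4 * (max 1 (L\<^sup>2) * min 1 ((norm y)\<^sup>2))"
    using w[OF assms(1)] w[OF assms(2)] cos_le_one[of "m * (y \<bullet> e)"] cos_le_one[of "l * (y \<bullet> e)"]
    by linarith
  then have "\<bar>cos (m * (y \<bullet> e)) - cos (l * (y \<bullet> e))\<bar> * growth \<epsilon> (1 / norm y)
     \<le> 4 * (max 1 (L\<^sup>2) * min 1 ((norm y)\<^sup>2)) * growth \<epsilon> (1 / norm y)"
    by (intro mult_right_mono growth_nonneg)
  then show ?thesis by (simp add: mult.assoc)
qed

lemma integrable_min_growth_1:
  assumes "0 < \<epsilon>" "\<epsilon> < 2"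
  shows "integrable H (\<lambda>y. a * (min 1 ((norm y)\<^sup>2) * growth \<epsilon> (1 / norm y)))"
  using integrable_min_growth[OF assms, of 1] by simp

lemma modulus_tendsto:
  assumes \<epsilon>: "0 < \<epsilon>" "\<epsilon> < 2" and l: "l > 0" and d: "\<delta> > 0"
  shows "\<exists>d>0. \<forall>m>0. \<bar>m - l\<bar> < d \<longrightarrow> modulus \<epsilon> l m < \<delta>"
proof (rule ccontr)
  assume *: "\<not> ?thesis"
  have "\<exists>m. m > 0 \<and> \<bar>m - l\<bar> < 1 / Suc n \<and> \<not> modulus \<epsilon> l m < \<delta>" for n
    using * by (auto dest: spec[of _ "1 / Suc n"])
  then obtain s where s: "\<And>n. s n > 0" "\<And>n. \<bar>s n - l\<bar> < 1 / Suc n" "\<And>n. \<not> modulus \<epsilon> l (s n) < \<delta>"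
    by metis
  have sl: "s \<longlonglongrightarrow> l"
  proof (rule LIM_zero_cancel, rule tendsto_rabs_zero_cancel,
      rule tendsto_sandwich[of "\<lambda>_. 0" _ _ "\<lambda>n. 1 / real (Suc n)"])
    show "(\<lambda>n. 1 / real (Suc n)) \<longlonglongrightarrow> 0" using LIMSEQ_inverse_real_of_nat by (simp add: inverse_eq_divide)
  qed (use s(2) in \<open>auto intro!: always_eventually less_imp_le\<close>)
  have "(\<lambda>n. modulus \<epsilon> l (s n)) \<longlonglongrightarrow> (\<integral>y. 0 \<partial>H)"
    unfolding modulus_def
  proof (rule integral_dominated_convergence)
    show "integrable H (\<lambda>y. 4 * max 1 ((l + 1)\<^sup>2) * (min 1 ((norm y)\<^sup>2) * growth \<epsilon> (1 / norm y)))"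
      by (rule integrable_min_growth_1[OF \<epsilon>])
    show "AE y in H. (\<lambda>n. \<bar>cos (s n * (y \<bullet> e)) - cos (l * (y \<bullet> e))\<bar> * growth \<epsilon> (1 / norm y)) \<longlonglongrightarrow> 0"
    proof (intro always_eventually allI)
      fix y
      have "(\<lambda>n. \<bar>cos (s n * (y \<bullet> e)) - cos (l * (y \<bullet> e))\<bar> * growth \<epsilon> (1 / norm y))
         \<longlonglongrightarrow> \<bar>cos (l * (y \<bullet> e)) - cos (l * (y \<bullet> e))\<bar> * growth \<epsilon> (1 / norm y)"
        by (intro tendsto_intros sl)
      then show "(\<lambda>n. \<bar>cos (s n * (y \<bullet> e)) - cos (l * (y \<bullet> e))\<bar> * growth \<epsilon> (1 / norm y)) \<longlonglongrightarrow> 0" by simp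
    qed
    fix n
    have "1 / real (Suc n) \<le> 1" by simp
    then have "\<bar>s n\<bar> \<le> l + 1" using s(1)[of n] s(2)[of n] by linarith
    then show "AE y in H. norm (\<bar>cos (s n * (y \<bullet> e)) - cos (l * (y \<bullet> e))\<bar> * growth \<epsilon> (1 / norm y))
      \<le> 4 * max 1 ((l + 1)\<^sup>2) * (min 1 ((norm y)\<^sup>2) * growth \<epsilon> (1 / norm y))"
      using l modulus_bound[of l "l + 1" "s n"]
      by (intro always_eventually allI) (simp add: abs_mult growth_nonneg)
  qed auto
  then have "\<exists>n. modulus \<epsilon> l (s n) < \<delta>"
    using d by (auto dest!: order_tendstoD(2)[where a=\<delta>] eventually_happens)
  then show False using s(3) by blast
qed

lemma cosine_transform_difference_le:
  assumes \<epsilon>: "0 < \<epsilon>" "\<epsilon> < 2" and l: "l > 0" "m > 0"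
    and v: "(\<lambda>x. indicator {0<..} x * v x) \<in> borel_measurable borel"
    and bd: "\<And>x. x > 0 \<Longrightarrow> \<bar>v x\<bar> \<le> C * growth \<epsilon> x"
  shows "\<bar>cosine_transform v m - cosine_transform v l\<bar> \<le> C * modulus \<epsilon> l m"
proof -
  note i = integrable_cosine_transform_rescaled[OF v _ \<epsilon> bd]
  have imod: "integrable H (\<lambda>y. \<bar>cos (m * (y \<bullet> e)) - cos (l * (y \<bullet> e))\<bar> * growth \<epsilon> (1 / norm y))"
  proof (rule Bochner_Integration.integrable_bound)
    show "integrable H (\<lambda>y. 4 * max 1 ((max l m)\<^sup>2) * (min 1 ((norm y)\<^sup>2) * growth \<epsilon> (1 / norm y)))"
      by (rule integrable_min_growth_1[OF \<epsilon>])
    show "AE y in H. norm (\<bar>cos (m * (y \<bullet> e)) - cos (l * (y \<bullet> e))\<bar> * growth \<epsilon> (1 / norm y))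
      \<le> norm (4 * max 1 ((max l m)\<^sup>2) * (min 1 ((norm y)\<^sup>2) * growth \<epsilon> (1 / norm y)))"
      using l modulus_bound[of l "max l m" m]
      by (intro always_eventually allI) (simp add: abs_mult growth_nonneg)
  qed auto
  have "cosine_transform v m - cosine_transform v l = (\<integral>y. (cos (l * (y \<bullet> e)) - cos (m * (y \<bullet> e))) * v (1 / norm y) \<partial>H)"
    unfolding cosine_transform_rescaled[OF v l(1)] cosine_transform_rescaled[OF v l(2)]
    by (subst Bochner_Integration.integral_diff[symmetric]) (use l i in \<open>auto simp: algebra_simps intro!: Bochner_Integration.integral_cong\<close>)
  also have "\<bar>\<dots>\<bar> \<le> (\<integral>y. C * (\<bar>cos (m * (y \<bullet> e)) - cos (l * (y \<bullet> e))\<bar> * growth \<epsilon> (1 / norm y)) \<partial>H)"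
  proof (rule integral_abs_bound_integral)
    have "integrable H (\<lambda>y. (1 - cos (m * (y \<bullet> e))) * v (1 / norm y) - (1 - cos (l * (y \<bullet> e))) * v (1 / norm y))"
      using i l by (intro Bochner_Integration.integrable_diff) auto
    then show "integrable H (\<lambda>y. (cos (l * (y \<bullet> e)) - cos (m * (y \<bullet> e))) * v (1 / norm y))"
      by (rule Bochner_Integration.integrable_cong[THEN iffD1, rotated -1]) (auto simp: algebra_simps)
    show "integrable H (\<lambda>y. C * (\<bar>cos (m * (y \<bullet> e)) - cos (l * (y \<bullet> e))\<bar> * growth \<epsilon> (1 / norm y)))"
      using imod by simp
    fix y assume "y \<in> space H"
    show "\<bar>(cos (l * (y \<bullet> e)) - cos (m * (y \<bullet> e))) * v (1 / norm y)\<bar>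
      \<le> C * (\<bar>cos (m * (y \<bullet> e)) - cos (l * (y \<bullet> e))\<bar> * growth \<epsilon> (1 / norm y))"
    proof (cases "y = 0")
      case False
      then have "\<bar>v (1 / norm y)\<bar> \<le> C * growth \<epsilon> (1 / norm y)" by (intro bd) simp
      then have "\<bar>cos (m * (y \<bullet> e)) - cos (l * (y \<bullet> e))\<bar> * \<bar>v (1 / norm y)\<bar>
        \<le> \<bar>cos (m * (y \<bullet> e)) - cos (l * (y \<bullet> e))\<bar> * (C * growth \<epsilon> (1 / norm y))"
        by (intro mult_left_mono) auto
      then show ?thesis by (simp add: abs_mult abs_minus_commute mult_ac)
    qed simp
  qed
  finally show ?thesis by (simp add: modulus_def)
qed

text \<open>The common modulus of continuity gives precompactness, and the growth function dominates, so
that the equation passes to the limit.\<close>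

lemma approximate_solutions_compact:
  fixes f v :: "nat \<Rightarrow> real \<Rightarrow> real"
  assumes \<epsilon>: "0 < \<epsilon>" "\<epsilon> < 2" and C: "C \<ge> 0"
    and err: "err \<longlonglongrightarrow> (0::real)"
    and v: "\<And>n. (\<lambda>x. indicator {0<..} x * v n x) \<in> borel_measurable borel"
    and bd: "\<And>n x. x > 0 \<Longrightarrow> \<bar>v n x\<bar> \<le> C * growth \<epsilon> x"
    and fT: "\<And>n l. l > 0 \<Longrightarrow> \<bar>f n l - c * cosine_transform (v n) l\<bar> \<le> err n"
    and fv: "\<And>l. l > 0 \<Longrightarrow> (\<lambda>n. v n l - f n l) \<longlonglongrightarrow> 0"
  obtains k g where "strict_mono (k :: nat \<Rightarrow> nat)" "continuous_on {0<..} g"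
    "\<And>s l. l > 0 \<Longrightarrow> s \<longlonglongrightarrow> l \<Longrightarrow> (\<lambda>n. f (k n) (s n)) \<longlonglongrightarrow> g l"
    "\<And>l. l > 0 \<Longrightarrow> g l = c * cosine_transform g l"
proof -
  have bdd: "\<exists>B. \<forall>n. \<bar>f n l\<bar> \<le> B" if l: "l > 0" for l
  proof -
    obtain K where K: "\<And>n. \<bar>v n l - f n l\<bar> \<le> K"
      using convergent_imp_Bseq[of "\<lambda>n. v n l - f n l"] fv[OF l]
      by (auto simp: convergent_def Bseq_def)
    have "\<bar>f n l\<bar> \<le> K + C * growth \<epsilon> l" for n
      using K[of n] bd[OF l, of n] by linarith
    then show ?thesis by blast
  qed
  have equi: "\<exists>d>0. \<exists>n0. \<forall>n\<ge>n0. \<forall>m>0. \<bar>m - l\<bar> < d \<longrightarrow> \<bar>f n m - f n l\<bar> < \<delta>"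
    if l: "l > 0" and \<delta>: "\<delta> > 0" for l \<delta>
  proof -
    have cC: "0 < c * C + 1" using c_pos C by (simp add: add_nonneg_pos)
    obtain d where d: "d > 0" "\<And>m. m > 0 \<Longrightarrow> \<bar>m - l\<bar> < d \<Longrightarrow> modulus \<epsilon> l m < \<delta> / 2 / (c * C + 1)"
      using modulus_tendsto[OF \<epsilon> l, of "\<delta> / 2 / (c * C + 1)"] \<delta> cC by auto
    obtain n0 where n0: "\<And>n. n \<ge> n0 \<Longrightarrow> err n < \<delta> / 4"
      using order_tendstoD(2)[OF err, of "\<delta>/4"] \<delta> by (auto simp: eventually_sequentially)
    show ?thesis
    proof (intro exI conjI allI impI)
      fix n m assume n: "n \<ge> n0" and m: "m > 0" "\<bar>m - l\<bar> < d"
      have mod0: "0 \<le> modulus \<epsilon> l m" unfolding modulus_def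
        by (intro Bochner_Integration.integral_nonneg mult_nonneg_nonneg growth_nonneg) auto
      have "\<bar>c * cosine_transform (v n) m - c * cosine_transform (v n) l\<bar> = c * \<bar>cosine_transform (v n) m - cosine_transform (v n) l\<bar>"
        using c_pos by (simp add: right_diff_distrib[symmetric] abs_mult)
      also have "\<dots> \<le> c * (C * modulus \<epsilon> l m)"
        using c_pos cosine_transform_difference_le[OF \<epsilon> l m(1) v bd] by simp
      also have "\<dots> \<le> (c * C + 1) * modulus \<epsilon> l m" using mod0 by (simp add: distrib_right)
      also have "\<dots> < (c * C + 1) * (\<delta> / 2 / (c * C + 1))"
        using d(2)[OF m] cC by (intro mult_strict_left_mono) auto
      also have "\<dots> = \<delta> / 2"
      proof -
        have "D * (\<delta> / 2 / D) = \<delta> / 2" if "0 < D" for D :: real using that by simp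
        from this[OF cC] show ?thesis .
      qed
      finally show "\<bar>f n m - f n l\<bar> < \<delta>"
        using n0[OF n] fT[OF l, of n] fT[OF m(1), of n] by linarith
    qed (rule d)
  qed
  obtain k g where k: "strict_mono (k :: nat \<Rightarrow> nat)" and g: "continuous_on {0<..} g"
    and lim: "\<And>s l. l > 0 \<Longrightarrow> s \<longlonglongrightarrow> l \<Longrightarrow> (\<lambda>n. f (k n) (s n)) \<longlonglongrightarrow> g l"
    by (rule arzela_ascoli_pointwise[of f, OF bdd equi]) (assumption | rule that)+
  have "g l = c * cosine_transform g l" if l: "l > 0" for l
  proof -
    have limv: "(\<lambda>n. v (k n) x) \<longlonglongrightarrow> g x" if x: "x > 0" for x
      using tendsto_add[OF LIMSEQ_subseq_LIMSEQ[OF fv[OF x] k] lim[OF x tendsto_const]] by (simp add: o_def)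
    have "(\<lambda>n. cosine_transform (v (k n)) l) \<longlonglongrightarrow> cosine_transform g l"
      unfolding cosine_transform_def
    proof (rule integral_dominated_convergence)
      show "integrable H (\<lambda>z. (2 * C) * (min 1 ((norm z)\<^sup>2) * growth \<epsilon> (l / norm z)))"
        using integrable_min_growth[OF \<epsilon> l] by simp
      show "(\<lambda>z. (1 - cos (z \<bullet> e)) * v (k n) (l / norm z)) \<in> borel_measurable H" for n
        by (rule borel_measurable_integrable[OF integrable_cosine_transform[OF \<epsilon> l v bd]])
      have gb: "\<bar>g x\<bar> \<le> C * growth \<epsilon> x" if x: "x > 0" for x
      proof -
        have "(\<lambda>n. \<bar>v (k n) x\<bar>) \<longlonglongrightarrow> \<bar>g x\<bar>" by (intro tendsto_intros limv x)
        then show ?thesis by (rule LIMSEQ_le_const2) (use bd[OF x] in auto)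
      qed
      show "(\<lambda>z. (1 - cos (z \<bullet> e)) * g (l / norm z)) \<in> borel_measurable H"
        by (rule borel_measurable_integrable[OF integrable_cosine_transform[OF \<epsilon> l continuous_on_positive_measurable[OF g] gb]])
      show "AE z in H. (\<lambda>n. (1 - cos (z \<bullet> e)) * v (k n) (l / norm z)) \<longlonglongrightarrow> (1 - cos (z \<bullet> e)) * g (l / norm z)"
        using AE_dilation_measure_nonzero by eventually_elim (use l in \<open>auto intro!: tendsto_intros limv\<close>)
      show "AE z in H. norm ((1 - cos (z \<bullet> e)) * v (k n) (l / norm z))
          \<le> (2 * C) * (min 1 ((norm z)\<^sup>2) * growth \<epsilon> (l / norm z))" for n
        using AE_dilation_measure_nonzero
      proof eventually_elim
        case (elim z)
        then have "\<bar>v (k n) (l / norm z)\<bar> \<le> C * growth \<epsilon> (l / norm z)" using l by (intro bd) auto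
        then have "(1 - cos (z \<bullet> e)) * \<bar>v (k n) (l / norm z)\<bar>
            \<le> (2 * min 1 ((norm z)\<^sup>2)) * (C * growth \<epsilon> (l / norm z))"
          using weight_le[of 1 z] by (intro mult_mono) auto
        then show ?case by (simp add: abs_mult mult_ac)
      qed
    qed
    then have "(\<lambda>n. c * cosine_transform (v (k n)) l) \<longlonglongrightarrow> c * cosine_transform g l" by (intro tendsto_intros)
    moreover have "(\<lambda>n. f (k n) l - c * cosine_transform (v (k n)) l) \<longlonglongrightarrow> 0"
    proof (rule tendsto_rabs_zero_cancel, rule tendsto_sandwich[of "\<lambda>_. 0" _ _ "\<lambda>n. err (k n)"])
      show "(\<lambda>n. err (k n)) \<longlonglongrightarrow> 0" using LIMSEQ_subseq_LIMSEQ[OF err k] by (simp add: o_def)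
    qed (use fT[OF l] in auto)
    ultimately have "(\<lambda>n. f (k n) l) \<longlonglongrightarrow> c * cosine_transform g l"
      using tendsto_add by fastforce
    then show ?thesis using lim[OF l tendsto_const] LIMSEQ_unique by blast
  qed
  with k g lim that show ?thesis by blast
qed

text \<open>The bound on ratios is invariant under dilations and survives limits.  With $g(1) = 1$ it also bounds $g$ from above
and, with the two arguments exchanged, away from $0$.\<close>

definition positive_solutions :: "real \<Rightarrow> real \<Rightarrow> (real \<Rightarrow> real) set" where
  "positive_solutions \<epsilon> C = {g. continuous_on {0<..} g \<and> (\<forall>l>0. g l = c * cosine_transform g l) \<and>
     (\<forall>l>0. \<forall>m>0. g l \<le> C * g m * growth \<epsilon> (l / m)) \<and> g 1 = 1}"

end

locale cosine_growth = cosine_convolution e c for e :: "'a::euclidean_space" and c :: real +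
  fixes \<epsilon> C :: real
  assumes eps: "0 < \<epsilon>" "\<epsilon> < 2" and C_pos: "0 < C"
begin

abbreviation G :: "(real \<Rightarrow> real) set" where "G \<equiv> positive_solutions \<epsilon> C"

lemma positive_solutions_one: "g \<in> G \<Longrightarrow> g 1 = 1"
  by (simp add: positive_solutions_def)

lemma positive_solutions_ratio: "g \<in> G \<Longrightarrow> l > 0 \<Longrightarrow> m > 0 \<Longrightarrow> g l \<le> C * g m * growth \<epsilon> (l / m)"
  unfolding positive_solutions_def mem_Collect_eq by blast

lemma positive_solutions_pos:
  assumes g: "g \<in> G" and m: "m > 0"
  shows "g m > 0"
proof (rule ccontr)
  assume "\<not> ?thesis"
  then have "C * g m * growth \<epsilon> (1 / m) \<le> 0"
    using C_pos growth_nonneg by (simp add: mult_nonneg_nonpos mult_nonpos_nonneg)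
  moreover have "1 \<le> C * g m * growth \<epsilon> (1 / m)"
    using positive_solutions_ratio[OF g, of 1 m] m positive_solutions_one[OF g] by simp
  ultimately show False by linarith
qed

lemma positive_solutions_le:
  assumes g: "g \<in> G" and l: "l > 0"
  shows "\<bar>g l\<bar> \<le> C * growth \<epsilon> l"
proof -
  have "g l \<le> C * g 1 * growth \<epsilon> (l / 1)"
    by (rule positive_solutions_ratio[OF g l]) simp
  moreover have "g 1 = 1" by (rule positive_solutions_one[OF g])
  ultimately show ?thesis using positive_solutions_pos[OF g l] by simp
qed

lemma positive_solutions_continuous: "g \<in> G \<Longrightarrow> continuous_on {0<..} g"
  by (simp add: positive_solutions_def)

lemma positive_solutions_solution:
  assumes g: "g \<in> G"
  shows "solution g"
  unfolding solution_def
proof (intro conjI allI impI)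
  fix l :: real assume l: "l > 0"
  show "integrable H (\<lambda>z. (1 - cos (z \<bullet> e)) * g (l / norm z))"
    by (rule integrable_cosine_transform[OF eps l continuous_on_positive_measurable[OF positive_solutions_continuous[OF g]] positive_solutions_le[OF g]])
  show "g l = c * cosine_transform g l" using g l by (simp add: positive_solutions_def)
qed (rule positive_solutions_continuous[OF g])

lemma positive_solutions_scale:
  assumes g: "g \<in> G" and k: "k > 0"
  shows "(\<lambda>l. g (k * l) / g k) \<in> G"
proof -
  have gk: "g k > 0" using positive_solutions_pos[OF g k] .
  have "solution (\<lambda>l. inverse (g k) * g (k * l))"
    by (intro solution_cmult solution_scale positive_solutions_solution g k)
  then have "solution (\<lambda>l. g (k * l) / g k)" by (simp add: field_simps)
  moreover have "g (k * l) / g k \<le> C * (g (k * m) / g k) * growth \<epsilon> (l / m)" if "l > 0" "m > 0" for l m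
  proof -
    have "k * l > 0" "k * m > 0" using k that by auto
    then have "g (k * l) \<le> C * g (k * m) * growth \<epsilon> (k * l / (k * m))"
      by (rule positive_solutions_ratio[OF g])
    then have "g (k * l) \<le> C * g (k * m) * growth \<epsilon> (l / m)" using k by simp
    then show ?thesis using gk by (simp add: divide_right_mono)
  qed
  ultimately show ?thesis using gk by (simp add: positive_solutions_def solution_def)
qed

lemma positive_solutions_compact:
  assumes g: "\<And>n. g n \<in> G"
  obtains k h where "strict_mono (k :: nat \<Rightarrow> nat)" "h \<in> G" "\<And>l. l > 0 \<Longrightarrow> (\<lambda>n. g (k n) l) \<longlonglongrightarrow> h l"
proof -
  obtain k h where k: "strict_mono (k :: nat \<Rightarrow> nat)" and cont: "continuous_on {0<..} h"
    and lim: "\<And>s l. l > 0 \<Longrightarrow> s \<longlonglongrightarrow> l \<Longrightarrow> (\<lambda>n. g (k n) (s n)) \<longlonglongrightarrow> h l"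
    and eq: "\<And>l. l > 0 \<Longrightarrow> h l = c * cosine_transform h l"
  proof (rule approximate_solutions_compact[of \<epsilon> C "\<lambda>_. 0" g g])
    show "\<bar>g n l - c * cosine_transform (g n) l\<bar> \<le> 0" if "l > 0" for n l
      using g[of n] that by (simp add: positive_solutions_def)
    show "(\<lambda>x. indicator {0<..} x * g n x) \<in> borel_measurable borel" for n
      by (rule continuous_on_positive_measurable[OF positive_solutions_continuous[OF g]])
  qed (use eps C_pos positive_solutions_le[OF g] in auto)
  have lim': "(\<lambda>n. g (k n) l) \<longlonglongrightarrow> h l" if "l > 0" for l
    using lim[OF that tendsto_const] .
  have "h l \<le> C * h m * growth \<epsilon> (l / m)" if "l > 0" "m > 0" for l m
  proof (rule LIMSEQ_le[OF lim'])
    show "(\<lambda>n. C * g (k n) m * growth \<epsilon> (l / m)) \<longlonglongrightarrow> C * h m * growth \<epsilon> (l / m)"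
      by (intro tendsto_intros lim' that)
    show "\<exists>N. \<forall>n\<ge>N. g (k n) l \<le> C * g (k n) m * growth \<epsilon> (l / m)"
      using positive_solutions_ratio[OF g that] by blast
  qed (rule that)
  moreover have "h 1 = 1"
  proof (rule LIMSEQ_unique[OF lim'])
    show "(\<lambda>n. g (k n) 1) \<longlonglongrightarrow> 1" using g by (simp add: positive_solutions_def)
  qed simp
  ultimately have "h \<in> G" using cont eq by (simp add: positive_solutions_def)
  then show ?thesis using that k lim' by blast
qed

text \<open>Dilation is followed by normalization at $1$, to stay inside the class.\<close>

definition closed_class :: "(real \<Rightarrow> real) set \<Rightarrow> bool" where
  "closed_class K \<longleftrightarrow> K \<subseteq> G \<and> K \<noteq> {} \<and> (\<forall>g\<in>K. \<forall>k>0. (\<lambda>l. g (k * l) / g k) \<in> K) \<and>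
     (\<forall>g h. (\<forall>n. g n \<in> K) \<longrightarrow> h \<in> G \<longrightarrow> (\<forall>l>0. (\<lambda>n. g n l) \<longlonglongrightarrow> h l) \<longrightarrow> h \<in> K)"

lemma closed_class_scale: "closed_class K \<Longrightarrow> g \<in> K \<Longrightarrow> k > 0 \<Longrightarrow> (\<lambda>l. g (k * l) / g k) \<in> K"
  unfolding closed_class_def by blast

lemma closed_class_limit:
  assumes "closed_class K" "\<And>n. g n \<in> K" "h \<in> G" "\<And>l. l > 0 \<Longrightarrow> (\<lambda>n. g n l) \<longlonglongrightarrow> h l"
  shows "h \<in> K"
proof -
  have "\<forall>g h. (\<forall>n. g n \<in> K) \<longrightarrow> h \<in> G \<longrightarrow> (\<forall>l>0. (\<lambda>n. g n l) \<longlonglongrightarrow> h l) \<longrightarrow> h \<in> K"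
    using assms(1) unfolding closed_class_def by (elim conjE)
  from this[THEN spec, of g, THEN spec, of h] assms(2-) show ?thesis by simp
qed

text \<open>The supremum of $q_0 + q_1 h(2) + q_2 h(4)$ over the class is attained by compactness.  By
invariance $\theta g - (q_0 g + q_1 g(2\cdot) + q_2 g(4\cdot))$ is then a nonnegative solution which vanishes at $1$, and the
maximum principle applies.\<close>

lemma closed_class_extremal:
  fixes q0 q1 q2 :: real
  assumes K: "closed_class K"
  obtains g \<theta> where "g \<in> K" "\<And>l. l > 0 \<Longrightarrow> q0 * g l + q1 * g (2 * l) + q2 * g (4 * l) = \<theta> * g l"
    "\<And>h. h \<in> K \<Longrightarrow> q0 + q1 * h 2 + q2 * h 4 \<le> \<theta>"
proof -
  have KG: "K \<subseteq> G" "K \<noteq> {}" using K by (auto simp: closed_class_def)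
  define Q where "Q h = q0 + q1 * h 2 + q2 * h 4" for h :: "real \<Rightarrow> real"
  define B where "B = \<bar>q0\<bar> + \<bar>q1\<bar> * (C * growth \<epsilon> 2) + \<bar>q2\<bar> * (C * growth \<epsilon> 4)"
  have "Q h \<le> B" if h: "h \<in> K" for h
  proof -
    have hG: "h \<in> G" using h KG by auto
    have "\<bar>q1 * h 2\<bar> \<le> \<bar>q1\<bar> * (C * growth \<epsilon> 2)" "\<bar>q2 * h 4\<bar> \<le> \<bar>q2\<bar> * (C * growth \<epsilon> 4)"
      unfolding abs_mult by (intro mult_left_mono positive_solutions_le[OF hG]; simp)+
    then show ?thesis unfolding Q_def B_def by linarith
  qed
  then have bdd: "bdd_above (Q ` K)" by (rule bdd_aboveI2)
  define \<theta> where "\<theta> = (SUP h\<in>K. Q h)"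
  have le: "Q h \<le> \<theta>" if "h \<in> K" for h
    unfolding \<theta>_def by (rule cSUP_upper[OF that bdd])
  have "\<exists>h\<in>K. \<theta> - 1 / Suc n < Q h" for n
    using less_cSUP_iff[OF KG(2) bdd, of "\<theta> - 1 / Suc n"] by (simp add: \<theta>_def)
  then obtain h where h: "\<And>n. h n \<in> K" "\<And>n. \<theta> - 1 / Suc n < Q (h n)" by metis
  have hG: "h n \<in> G" for n using h KG by auto
  obtain k g where k: "strict_mono (k :: nat \<Rightarrow> nat)" and gG: "g \<in> G"
    and lim: "\<And>l. l > 0 \<Longrightarrow> (\<lambda>n. h (k n) l) \<longlonglongrightarrow> g l"
    by (rule positive_solutions_compact[of h, OF hG]) (rule that)
  have gK: "g \<in> K"
    using closed_class_limit[OF K, of "\<lambda>n. h (k n)" g] h(1) gG lim by simp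
  have "(\<lambda>n. Q (h (k n))) \<longlonglongrightarrow> Q g" unfolding Q_def by (intro tendsto_intros lim) auto
  moreover have "(\<lambda>n. Q (h (k n))) \<longlonglongrightarrow> \<theta>"
  proof (rule tendsto_sandwich[of "\<lambda>n. \<theta> - 1 / Suc (k n)" _ _ "\<lambda>_. \<theta>"])
    have "(\<lambda>n. \<theta> - 1 / Suc n) \<longlonglongrightarrow> \<theta> - 0"
      using LIMSEQ_inverse_real_of_nat by (intro tendsto_diff tendsto_const) (simp add: inverse_eq_divide)
    from LIMSEQ_subseq_LIMSEQ[OF this k] show "(\<lambda>n. \<theta> - 1 / Suc (k n)) \<longlonglongrightarrow> \<theta>" by (simp add: o_def)
  qed (use less_imp_le[OF h(2)] le[OF h(1)] in \<open>auto intro!: always_eventually\<close>)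
  ultimately have Qg: "Q g = \<theta>" using LIMSEQ_unique by blast
  define f where "f l = \<theta> * g l - (q0 * g l + q1 * g (2 * l) + q2 * g (4 * l))" for l
  have sg: "solution g" by (rule positive_solutions_solution[OF gG])
  have "solution f" unfolding f_def
    by (intro solution_diff solution_add solution_cmult solution_scale sg) auto
  moreover have "0 \<le> f l" if l: "l > 0" for l
  proof -
    have "(\<lambda>x. g (l * x) / g l) \<in> K" by (rule closed_class_scale[OF K gK l])
    from le[OF this] have "Q (\<lambda>x. g (l * x) / g l) * g l \<le> \<theta> * g l"
      using positive_solutions_pos[OF gG l] by (intro mult_right_mono) auto
    then show ?thesis using positive_solutions_pos[OF gG l] by (simp add: Q_def f_def distrib_right mult.commute[of l])
  qed
  moreover have "f 1 = 0" using Qg gG by (simp add: f_def Q_def positive_solutions_def)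
  ultimately have f0: "f l = 0" if "l > 0" for l
    using solution_nonneg_zero[of f 1 l] that by auto
  show ?thesis
  proof (rule that[OF gK])
    show "q0 * g l + q1 * g (2 * l) + q2 * g (4 * l) = \<theta> * g l" if "l > 0" for l
      using f0[OF that] by (simp add: f_def)
    show "q0 + q1 * h 2 + q2 * h 4 \<le> \<theta>" if "h \<in> K" for h
      using le[OF that] by (simp add: Q_def)
  qed
qed

end

section \<open>Positive solutions are mixtures of powers\<close>

context cosine_convolution
begin

lemma dyadic_representative:
  fixes P :: "real \<Rightarrow> real"
  assumes P: "\<And>l. l > 0 \<Longrightarrow> P (2 * l) = P l" and l: "l > 0"
  obtains m where "1 \<le> m" "m \<le> 2" "P l = P m"
proof -
  have pow: "P (2 ^ j * l) = P l" if "l > 0" for j l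
    using that by (induction j) (simp_all add: P mult.assoc)
  show ?thesis
  proof (cases "1 \<le> l")
    case True
    then obtain j where j: "2 ^ j \<le> l" "l < 2 ^ Suc j" using ex_dyadic_ge_one by blast
    have "P (2 ^ j * (l / 2 ^ j)) = P (l / 2 ^ j)" using l by (intro pow) simp
    then show ?thesis using that[of "l / 2 ^ j"] j by (simp add: field_simps)
  next
    case False
    then have "1 \<le> 1 / l" using l by simp
    then obtain j where j: "2 ^ j \<le> 1 / l" "1 / l < 2 ^ Suc j" using ex_dyadic_ge_one by blast
    have "P (2 ^ Suc j * l) = P l" using l by (intro pow) simp
    moreover have "1 \<le> 2 ^ Suc j * l" "2 ^ Suc j * l \<le> 2" using j l by (auto simp: field_simps)
    ultimately show ?thesis using that by metis
  qed
qed

text \<open>The function $u(l)l^{-\rho}$ is invariant under $l \mapsto 2l$ and hence attains its extrema on $[1,2]$.\<close>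

lemma quasiperiodic_extrema:
  fixes u :: "real \<Rightarrow> real"
  assumes u: "continuous_on {0<..} u" and per: "\<And>l. l > 0 \<Longrightarrow> u (2 * l) = 2 powr \<rho> * u l"
  obtains a b where "a > 0" "b > 0"
    "\<And>l. l > 0 \<Longrightarrow> u l \<le> u a * (l / a) powr \<rho>" "\<And>l. l > 0 \<Longrightarrow> u b * (l / b) powr \<rho> \<le> u l"
proof -
  define P where "P l = u l * l powr - \<rho>" for l
  have P2: "P (2 * l) = P l" if "l > 0" for l
    using that by (simp add: P_def per powr_mult powr_minus)
  have cont: "continuous_on {1..2} P"
    unfolding P_def by (intro continuous_intros continuous_on_subset[OF u]) auto
  obtain a where a: "a \<in> {1..2}" "\<And>y. y \<in> {1..2} \<Longrightarrow> P y \<le> P a"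
    using continuous_attains_sup[OF compact_Icc _ cont] by auto
  obtain b where b: "b \<in> {1..2}" "\<And>y. y \<in> {1..2} \<Longrightarrow> P b \<le> P y"
    using continuous_attains_inf[OF compact_Icc _ cont] by auto
  have uP: "u l = P l * l powr \<rho>" if "l > 0" for l
    using that by (simp add: P_def powr_minus)
  have frac: "u m * (l / m) powr \<rho> = P m * l powr \<rho>" if "l > 0" "m > 0" for l m
    using that by (simp add: P_def powr_divide powr_minus field_simps)
  show ?thesis
  proof (rule that[of a b])
    show "a > 0" "b > 0" using a b by auto
    fix l :: real assume l: "l > 0"
    obtain m where m: "1 \<le> m" "m \<le> 2" "P l = P m" using dyadic_representative[of P l, OF P2 l] by blast
    have "P l \<le> P a" "P b \<le> P l" using a(2)[of m] b(2)[of m] m by auto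
    then show "u l \<le> u a * (l / a) powr \<rho>" "u b * (l / b) powr \<rho> \<le> u l"
      using frac[OF l, of a] frac[OF l, of b] a b uP[OF l] by (auto intro!: mult_right_mono)
  qed
qed

text \<open>At a maximum of $u(l) l^{-\rho}$ the equation gives $c\kappa(\rho) \ge 1$, at a minimum $c\kappa(\rho) \le 1$.\<close>

lemma quasiperiodic_solution_root:
  assumes u: "solution u" and per: "\<And>l. l > 0 \<Longrightarrow> u (2 * l) = 2 powr \<rho> * u l"
    and pos: "\<And>l. l > 0 \<Longrightarrow> u l > 0" and \<rho>: "0 < \<rho>" "\<rho> < 2"
  shows "c * \<kappa> \<rho> = 1"
proof -
  have cont: "continuous_on {0<..} u" using u by (simp add: solution_def)
  obtain a b where ab: "a > 0" "b > 0"
    and le: "\<And>l. l > 0 \<Longrightarrow> u l \<le> u a * (l / a) powr \<rho>"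
    and ge: "\<And>l. l > 0 \<Longrightarrow> u b * (l / b) powr \<rho> \<le> u l"
    by (rule quasiperiodic_extrema[OF cont per]) (assumption | rule that)+
  have int: "integrable H (\<lambda>z. (1 - cos (z \<bullet> e)) * u (l / norm z))" and eq: "u l = c * cosine_transform u l" if "l > 0" for l
    using u that by (auto simp: solution_def)
  have ip: "integrable H (\<lambda>z. (1 - cos (z \<bullet> e)) * norm z powr - \<rho>)" by (rule integrable_weight_powr[OF \<rho>])
  have q: "(l / norm z / l) powr \<rho> = norm z powr - \<rho>" if "l > 0" for l and z :: 'a
  proof -
    have "l / norm z / l = inverse (norm z)" using that by (simp add: divide_inverse)
    then show ?thesis by (simp add: inverse_powr powr_minus)
  qed
  have "cosine_transform u a \<le> (\<integral>z. u a * ((1 - cos (z \<bullet> e)) * norm z powr - \<rho>) \<partial>H)"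
    unfolding cosine_transform_def
  proof (rule integral_mono_AE[OF int[OF ab(1)]])
    show "integrable H (\<lambda>z. u a * ((1 - cos (z \<bullet> e)) * norm z powr - \<rho>))" using ip by simp
    show "AE z in H. (1 - cos (z \<bullet> e)) * u (a / norm z) \<le> u a * ((1 - cos (z \<bullet> e)) * norm z powr - \<rho>)"
      using AE_dilation_measure_nonzero
    proof eventually_elim
      case (elim z)
      then have "u (a / norm z) \<le> u a * norm z powr - \<rho>" using le[of "a / norm z"] q[OF ab(1)] ab by simp
      then have "(1 - cos (z \<bullet> e)) * u (a / norm z) \<le> (1 - cos (z \<bullet> e)) * (u a * norm z powr - \<rho>)"
        by (intro mult_left_mono) auto
      then show ?case by (simp only: mult_ac)
    qed
  qed
  also have "\<dots> = u a * \<kappa> \<rho>" by (simp add: \<kappa>_def)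
  finally have "u a * 1 \<le> u a * (c * \<kappa> \<rho>)" using eq[OF ab(1)] c_pos by (simp add: mult_ac)
  then have 1: "1 \<le> c * \<kappa> \<rho>" using pos[OF ab(1)] by (subst (asm) mult_le_cancel_left_pos) auto
  have "(\<integral>z. u b * ((1 - cos (z \<bullet> e)) * norm z powr - \<rho>) \<partial>H) \<le> cosine_transform u b"
    unfolding cosine_transform_def
  proof (rule integral_mono_AE[OF _ int[OF ab(2)]])
    show "integrable H (\<lambda>z. u b * ((1 - cos (z \<bullet> e)) * norm z powr - \<rho>))" using ip by simp
    show "AE z in H. u b * ((1 - cos (z \<bullet> e)) * norm z powr - \<rho>) \<le> (1 - cos (z \<bullet> e)) * u (b / norm z)"
      using AE_dilation_measure_nonzero
    proof eventually_elim
      case (elim z)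
      then have "u b * norm z powr - \<rho> \<le> u (b / norm z)" using ge[of "b / norm z"] q[OF ab(2)] ab by simp
      then have "(1 - cos (z \<bullet> e)) * (u b * norm z powr - \<rho>) \<le> (1 - cos (z \<bullet> e)) * u (b / norm z)"
        by (intro mult_left_mono) auto
      then show ?case by (simp only: mult_ac)
    qed
  qed
  then have "u b * \<kappa> \<rho> \<le> cosine_transform u b" by (simp add: \<kappa>_def)
  then have "u b * (c * \<kappa> \<rho>) \<le> u b * 1"
    using eq[OF ab(2)] c_pos mult_left_mono[of "u b * \<kappa> \<rho>" "cosine_transform u b" c] by (simp add: mult_ac)
  then have "c * \<kappa> \<rho> \<le> 1" using pos[OF ab(2)] by (subst (asm) mult_le_cancel_left_pos) auto
  with 1 show ?thesis by simp
qed

text \<open>The difference of $u$ and the multiple of $l^\rho$ that touches it from above is a solution of one sign with a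
zero.\<close>

lemma quasiperiodic_solution_eq_powr:
  assumes u: "solution u" and per: "\<And>l. l > 0 \<Longrightarrow> u (2 * l) = 2 powr \<rho> * u l"
    and \<rho>: "0 < \<rho>" "\<rho> < 2" "c * \<kappa> \<rho> = 1"
  obtains b where "\<And>l. l > 0 \<Longrightarrow> u l = b * l powr \<rho>"
proof -
  have cont: "continuous_on {0<..} u" using u by (simp add: solution_def)
  obtain a where a: "a > 0" and le: "\<And>l. l > 0 \<Longrightarrow> u l \<le> u a * (l / a) powr \<rho>"
    by (rule quasiperiodic_extrema[OF cont per]) (assumption | rule that)+
  define b where "b = u a * a powr - \<rho>"
  have b: "u a * (l / a) powr \<rho> = b * l powr \<rho>" if "l > 0" for l
    using that a by (simp add: b_def powr_divide powr_minus field_simps)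
  define f where "f l = b * l powr \<rho> - u l" for l
  have "solution f" unfolding f_def
    by (intro solution_diff solution_cmult solution_powr \<rho> u)
  moreover have "f a = 0" using b[OF a] a by (simp add: f_def)
  moreover have "0 \<le> f l" if "l > 0" for l using le[OF that] b[OF that] by (simp add: f_def)
  ultimately have "f l = 0" if "l > 0" for l using solution_nonneg_zero[of f a l] a that by auto
  then show ?thesis using that[of b] by (simp add: f_def)
qed

text \<open>The exponents $\rho$ for which $l^\rho$ is a solution.\<close>

definition indicial_root :: "real \<Rightarrow> bool" where
  "indicial_root \<rho> \<longleftrightarrow> 0 < \<rho> \<and> \<rho> < 2 \<and> c * \<kappa> \<rho> = 1"

text \<open>By convexity of $\rho \mapsto l^\rho$ the chord through the outer two powers minus the inner power is a
nonnegative solution that vanishes at $1$, hence everywhere; but at $l = 2$ and $l = 4$ this means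
equality in Jensen's inequality for the square function.\<close>

lemma no_three_roots:
  assumes r: "indicial_root \<rho>1" "indicial_root \<rho>2" "indicial_root \<rho>3" and lt: "\<rho>1 < \<rho>2" "\<rho>2 < \<rho>3"
  shows False
proof -
  define t where "t = (\<rho>2 - \<rho>1) / (\<rho>3 - \<rho>1)"
  have t: "0 < t" "t < 1" using lt by (auto simp: t_def)
  have tr: "\<rho>2 = (1 - t) * \<rho>1 + t * \<rho>3"
  proof -
    have "t * (\<rho>3 - \<rho>1) = \<rho>2 - \<rho>1" using lt by (simp add: t_def)
    then show ?thesis by (simp add: algebra_simps)
  qed
  define f where "f l = ((1 - t) * l powr \<rho>1 + t * l powr \<rho>3) - l powr \<rho>2" for l
  have "solution f" unfolding f_def
    using r by (intro solution_diff solution_add solution_cmult solution_powr) (auto simp: indicial_root_def)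
  moreover have "0 \<le> f l" if l: "l > 0" for l
  proof -
    have "exp ((1 - t) *\<^sub>R (\<rho>1 * ln l) + t *\<^sub>R (\<rho>3 * ln l))
        \<le> (1 - t) * exp (\<rho>1 * ln l) + t * exp (\<rho>3 * ln l)"
      using exp_convex t by (intro convex_onD[of UNIV exp]) auto
    moreover have "(1 - t) *\<^sub>R (\<rho>1 * ln l) + t *\<^sub>R (\<rho>3 * ln l) = \<rho>2 * ln l"
      by (simp add: tr algebra_simps)
    ultimately show ?thesis using l by (simp add: f_def powr_def)
  qed
  moreover have "f 1 = 0" by (simp add: f_def)
  ultimately have f0: "f l = 0" if "l > 0" for l
    using solution_nonneg_zero[of f 1 l] that by auto
  define x y where "x = 2 powr \<rho>1" and "y = 2 powr \<rho>3"
  have sq: "4 powr \<rho> = (2 powr \<rho>)\<^sup>2" for \<rho> :: real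
    using powr_mult[of 2 2 \<rho>] by (simp add: power2_eq_square)
  have "2 powr \<rho>2 = (1 - t) * x + t * y" using f0[of 2] by (simp add: f_def x_def y_def)
  moreover have "(2 powr \<rho>2)\<^sup>2 = (1 - t) * x\<^sup>2 + t * y\<^sup>2" using f0[of 4] by (simp add: f_def x_def y_def sq)
  ultimately have "((1 - t) * x + t * y)\<^sup>2 = (1 - t) * x\<^sup>2 + t * y\<^sup>2" by simp
  then have "t * (1 - t) * (x - y)\<^sup>2 = 0" by (simp add: power2_eq_square algebra_simps)
  then have "x = y" using t by simp
  moreover have "x < y" unfolding x_def y_def using lt by (intro powr_less_mono) auto
  ultimately show False by simp
qed

end

context cosine_growth
begin

text \<open>An extremal solution for $h(2)$ satisfies $g(2l) = \theta g(l)$; the growth bounds confine $\log_2\theta$ to the open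
interval from $0$ to $2$, and quasiperiodic solutions are powers.\<close>

lemma closed_class_contains_powr:
  assumes K: "closed_class K"
  obtains \<rho> g where "indicial_root \<rho>" "g \<in> K" "\<And>l. l > 0 \<Longrightarrow> g l = l powr \<rho>"
proof -
  obtain g \<theta> where g: "g \<in> K" and th: "\<And>l. l > 0 \<Longrightarrow> 0 * g l + 1 * g (2 * l) + 0 * g (4 * l) = \<theta> * g l"
    by (rule closed_class_extremal[OF K, of 0 1 0]) (assumption | rule that)+
  have gG: "g \<in> G" using g K by (auto simp: closed_class_def)
  have per: "g (2 * l) = \<theta> * g l" if "l > 0" for l using th[OF that] by simp
  have pow: "g (2 ^ j) = \<theta> ^ j" for j
    by (induction j) (simp_all add: per positive_solutions_one[OF gG])
  have ipow: "\<theta> ^ j * g (1 / 2 ^ j) = 1" for j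
  proof (induction j)
    case (Suc j)
    have "\<theta> * g (1 / 2 ^ Suc j) = g (1 / 2 ^ j)" using per[of "1 / 2 ^ Suc j"] by simp
    moreover have "\<theta> ^ Suc j * g (1 / 2 ^ Suc j) = \<theta> ^ j * (\<theta> * g (1 / 2 ^ Suc j))" by simp
    ultimately show ?case using Suc by simp
  qed (simp add: positive_solutions_one[OF gG])
  have \<theta>: "\<theta> > 0" using pow[of 1] positive_solutions_pos[OF gG, of 2] by simp
  have pw: "(2 ^ j) powr x = (2 powr x) ^ j" for j :: nat and x :: real
    by (simp add: powr_realpow[symmetric] powr_powr mult.commute)
  have small: "q \<le> 1" if q: "0 < q" and bd: "\<And>j. q ^ j \<le> 2 * C" for q
  proof (rule ccontr)
    assume "\<not> q \<le> 1"
    then obtain j where "2 * C < q ^ j" using real_arch_pow[of q] by auto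
    then show False using bd[of j] by simp
  qed
  \<comment> \<open>The smaller of the distances of the two growth exponents from the ends of the interval from $0$ to $2$.\<close>
  define \<epsilon>' where "\<epsilon>' = min \<epsilon> (2 - \<epsilon>)"
  have \<epsilon>': "0 < \<epsilon>'" "\<epsilon>' < 2" using eps by (auto simp: \<epsilon>'_def)
  have growth_ge: "growth \<epsilon> x \<le> 2 * x powr (2 - \<epsilon>')" if "x \<ge> 1" for x
  proof -
    have "x powr \<epsilon> \<le> x powr (2 - \<epsilon>')" "x powr (2 - \<epsilon>) \<le> x powr (2 - \<epsilon>')"
      using that by (auto intro!: powr_mono simp: \<epsilon>'_def)
    then show ?thesis by (simp add: growth_def)
  qed
  have growth_le: "growth \<epsilon> x \<le> 2 * x powr \<epsilon>'" if "0 < x" "x \<le> 1" for x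
  proof -
    have "x powr \<epsilon> \<le> x powr \<epsilon>'" "x powr (2 - \<epsilon>) \<le> x powr \<epsilon>'"
      using that by (auto intro!: powr_mono' simp: \<epsilon>'_def)
    then show ?thesis by (simp add: growth_def)
  qed
  have "\<theta> / 2 powr (2 - \<epsilon>') \<le> 1"
  proof (rule small)
    fix j
    have "\<theta> ^ j \<le> C * growth \<epsilon> (2 ^ j)"
      using positive_solutions_le[OF gG, of "2 ^ j"] \<theta> by (simp add: pow)
    also have "\<dots> \<le> C * (2 * (2 ^ j) powr (2 - \<epsilon>'))" using C_pos growth_ge by simp
    finally show "(\<theta> / 2 powr (2 - \<epsilon>')) ^ j \<le> 2 * C"
      by (simp add: pw power_divide divide_le_eq mult_ac)
  qed (use \<theta> in simp)
  then have up: "\<theta> \<le> 2 powr (2 - \<epsilon>')" by simp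
  have "2 powr \<epsilon>' / \<theta> \<le> 1"
  proof (rule small)
    fix j
    have le1: "(1::real) / 2 ^ j \<le> 1" by simp
    have "g (1 / 2 ^ j) \<le> C * growth \<epsilon> (1 / 2 ^ j)"
      using positive_solutions_le[OF gG, of "1 / 2 ^ j"] by simp
    also have "\<dots> \<le> C * (2 * (1 / 2 ^ j) powr \<epsilon>')" using C_pos growth_le[OF _ le1] by simp
    finally have "\<theta> ^ j * g (1 / 2 ^ j) \<le> \<theta> ^ j * (C * (2 * (1 / 2 ^ j) powr \<epsilon>'))"
      using \<theta> by (intro mult_left_mono) auto
    then have "1 \<le> \<theta> ^ j * (2 * C) / (2 powr \<epsilon>') ^ j"
      by (simp add: ipow powr_divide pw mult_ac)
    then show "(2 powr \<epsilon>' / \<theta>) ^ j \<le> 2 * C"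
      using \<theta> by (simp add: power_divide field_simps)
  qed (use \<theta> in simp)
  then have lo: "2 powr \<epsilon>' \<le> \<theta>" using \<theta> by simp
  define \<rho> where "\<rho> = log 2 \<theta>"
  have \<rho>2: "2 powr \<rho> = \<theta>" using \<theta> by (simp add: \<rho>_def)
  have "\<epsilon>' \<le> \<rho>" "\<rho> \<le> 2 - \<epsilon>'" using up lo unfolding \<rho>2[symmetric] by simp_all
  then have \<rho>: "0 < \<rho>" "\<rho> < 2" using \<epsilon>' by auto
  have sg: "solution g" by (rule positive_solutions_solution[OF gG])
  have per': "g (2 * l) = 2 powr \<rho> * g l" if "l > 0" for l using per[OF that] \<rho>2 by simp
  have rt: "c * \<kappa> \<rho> = 1"
    by (rule quasiperiodic_solution_root[OF sg per' positive_solutions_pos[OF gG] \<rho>])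
  obtain b where b: "\<And>l. l > 0 \<Longrightarrow> g l = b * l powr \<rho>"
    by (rule quasiperiodic_solution_eq_powr[OF sg per' \<rho> rt]) (assumption | rule that)+
  have "b = 1" using b[of 1] positive_solutions_one[OF gG] by simp
  then show ?thesis using that[of \<rho> g] rt \<rho> g b by (simp add: indicial_root_def)
qed

text \<open>Let $\theta$ be the maximum of the functional.  The solutions with $q_0 g(l) + q_1 g(2l) + q_2 g(4l) = \theta g(l)$ form
a closed class, so one of them is a power of a root, and for it the left-hand side is $0$; thus
$\theta = 0$.\<close>

lemma polynomial_vanishing_le:
  assumes roots: "\<And>\<rho>. indicial_root \<rho> \<Longrightarrow> q0 + q1 * 2 powr \<rho> + q2 * 4 powr \<rho> = 0" and g: "g \<in> G" and l: "l > 0"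
  shows "q0 * g l + q1 * g (2 * l) + q2 * g (4 * l) \<le> 0"
proof -
  have KG: "closed_class G"
    using g positive_solutions_scale by (auto simp: closed_class_def)
  obtain h \<theta> where h: "h \<in> G" and th: "\<And>l. l > 0 \<Longrightarrow> q0 * h l + q1 * h (2 * l) + q2 * h (4 * l) = \<theta> * h l"
    and le: "\<And>h. h \<in> G \<Longrightarrow> q0 + q1 * h 2 + q2 * h 4 \<le> \<theta>"
    by (rule closed_class_extremal[OF KG, of q0 q1 q2]) (assumption | rule that)+
  define K where "K = {h\<in>G. \<forall>l>0. q0 * h l + q1 * h (2 * l) + q2 * h (4 * l) = \<theta> * h l}"
  have "closed_class K"
    unfolding closed_class_def
  proof (intro conjI ballI allI impI)
    show "K \<subseteq> G" "K \<noteq> {}" using h th by (auto simp: K_def)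
    show "(\<lambda>l. h (k * l) / h k) \<in> K" if "h \<in> K" "k > 0" for h k
    proof -
      have "q0 * h (k * l) + q1 * h (k * (2 * l)) + q2 * h (k * (4 * l)) = \<theta> * h (k * l)" if "l > 0" for l
      proof -
        have "k * l > 0" using that \<open>k > 0\<close> by simp
        then have "q0 * h (k * l) + q1 * h (2 * (k * l)) + q2 * h (4 * (k * l)) = \<theta> * h (k * l)"
          using \<open>h \<in> K\<close> by (simp add: K_def)
        then show ?thesis by (simp add: mult.left_commute)
      qed
      then have "q0 * (h (k * l) / h k) + q1 * (h (k * (2 * l)) / h k) + q2 * (h (k * (4 * l)) / h k)
          = \<theta> * (h (k * l) / h k)" if "l > 0" for l
        using that by (metis (no_types) add_divide_distrib times_divide_eq_right)
      then show ?thesis using positive_solutions_scale[of h k] that by (simp add: K_def)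
    qed
    show "h \<in> K" if s: "\<forall>n. s n \<in> K" "h \<in> G" "\<forall>l>0. (\<lambda>n. s n l) \<longlonglongrightarrow> h l" for s h
    proof -
      have "q0 * h l + q1 * h (2 * l) + q2 * h (4 * l) = \<theta> * h l" if "l > 0" for l
      proof (rule LIMSEQ_unique)
        show "(\<lambda>n. q0 * s n l + q1 * s n (2 * l) + q2 * s n (4 * l)) \<longlonglongrightarrow> q0 * h l + q1 * h (2 * l) + q2 * h (4 * l)"
          using s(3) that by (intro tendsto_intros) auto
        have "(\<lambda>n. \<theta> * s n l) \<longlonglongrightarrow> \<theta> * h l" using s(3) that by (intro tendsto_intros) auto
        then show "(\<lambda>n. q0 * s n l + q1 * s n (2 * l) + q2 * s n (4 * l)) \<longlonglongrightarrow> \<theta> * h l"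
          using s(1) that by (simp add: K_def)
      qed
      then show ?thesis using s(2) by (simp add: K_def)
    qed
  qed
  then obtain \<rho> h' where h': "indicial_root \<rho>" "h' \<in> K" "\<And>l. l > 0 \<Longrightarrow> h' l = l powr \<rho>"
    by (rule closed_class_contains_powr) (assumption | rule that)+
  have "q0 * h' 1 + q1 * h' (2 * 1) + q2 * h' (4 * 1) = \<theta> * h' 1"
    using h'(2) unfolding K_def by (simp del: mult_1_right)
  then have "\<theta> = 0" using h'(3)[of 1] h'(3)[of 2] h'(3)[of 4] roots[OF h'(1)] by simp
  moreover have "q0 + q1 * (g (l * 2) / g l) + q2 * (g (l * 4) / g l) \<le> \<theta>"
    using le[OF positive_solutions_scale[OF g l]] .
  ultimately have "(q0 + q1 * (g (l * 2) / g l) + q2 * (g (l * 4) / g l)) * g l \<le> 0"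
    using positive_solutions_pos[OF g l] by (simp add: mult_nonpos_nonneg)
  moreover have "(q0 + q1 * (g (l * 2) / g l) + q2 * (g (l * 4) / g l)) * g l = q0 * g l + q1 * g (2 * l) + q2 * g (4 * l)"
    using positive_solutions_pos[OF g l] by (simp add: field_simps)
  ultimately show ?thesis by simp
qed

lemma polynomial_vanishing:
  assumes roots: "\<And>\<rho>. indicial_root \<rho> \<Longrightarrow> q0 + q1 * 2 powr \<rho> + q2 * 4 powr \<rho> = 0" and g: "g \<in> G" and l: "l > 0"
  shows "q0 * g l + q1 * g (2 * l) + q2 * g (4 * l) = 0"
proof -
  have "- q0 + (- q1) * 2 powr \<rho> + (- q2) * 4 powr \<rho> = 0" if "indicial_root \<rho>" for \<rho>
    using roots[OF that] by linarith
  from polynomial_vanishing_le[OF roots g l] polynomial_vanishing_le[OF this g l]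
  show ?thesis by simp
qed

text \<open>If the coefficients had opposite signs, then the expression would vanish at the point $l$ with
$l^{\rho_2 - \rho_1} = -x/y$.\<close>

lemma convex_weights:
  fixes x y \<rho>1 \<rho>2 :: real
  assumes "x + y = 1" "\<rho>1 < \<rho>2" and pos: "\<And>l. l > 0 \<Longrightarrow> 0 < x * l powr \<rho>1 + y * l powr \<rho>2"
  shows "0 \<le> x \<and> 0 \<le> y"
proof (rule ccontr)
  assume "\<not> ?thesis"
  then have "(x < 0 \<and> 0 < y) \<or> (y < 0 \<and> 0 < x)" using assms(1) by linarith
  then have y: "y \<noteq> 0" and r: "0 < - x / y" by (auto simp: divide_less_0_iff)
  define w where "w = - x / y"
  define l where "l = w powr (1 / (\<rho>2 - \<rho>1))"
  have w: "w > 0" using r by (simp add: w_def)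
  have l: "l > 0" using w by (simp add: l_def)
  have "l powr (\<rho>2 - \<rho>1) = w" using w assms(2) by (simp add: l_def powr_powr)
  moreover have "l powr \<rho>2 = l powr \<rho>1 * l powr (\<rho>2 - \<rho>1)" by (simp add: powr_add[symmetric])
  ultimately have "x * l powr \<rho>1 + y * l powr \<rho>2 = l powr \<rho>1 * (x + y * w)"
    by (simp add: algebra_simps)
  also have "\<dots> = 0" using y by (simp add: w_def)
  finally show False using pos[OF l] by simp
qed

text \<open>If there are two roots, the quadratic polynomial that vanishes at $A = 2^{\rho_1}$ and $B = 2^{\rho_2}$ splits a positive solution as
$(B - A) g = (g(2\cdot) - A g) + (B g - g(2\cdot))$ into two quasiperiodic solutions, which are multiples of
$l^{\rho_2}$ and of $l^{\rho_1}$.\<close>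

theorem positive_solutions_eq_powr_mixture:
  assumes "G \<noteq> {}"
  obtains \<rho>1 \<rho>2 where "0 < \<rho>1" "\<rho>1 \<le> \<rho>2" "\<rho>2 < 2"
    "\<And>g. g \<in> G \<Longrightarrow> \<exists>a. 0 \<le> a \<and> a \<le> 1 \<and> (\<forall>l>0. g l = (1 - a) * l powr \<rho>1 + a * l powr \<rho>2)"
proof -
  have "closed_class G" using assms positive_solutions_scale by (auto simp: closed_class_def)
  then obtain \<rho> where \<rho>: "indicial_root \<rho>" by (rule closed_class_contains_powr) (rule that)
  have sq: "4 powr \<rho> = (2 powr \<rho>)\<^sup>2" for \<rho> :: real
    using powr_mult[of 2 2 \<rho>] by (simp add: power2_eq_square)
  show ?thesis
  proof (cases "\<forall>\<rho>'. indicial_root \<rho>' \<longrightarrow> \<rho>' = \<rho>")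
    case True
    have "g l = l powr \<rho>" if g: "g \<in> G" and l: "l > 0" for g l
    proof -
      have per: "g (2 * l) = 2 powr \<rho> * g l" if "l > 0" for l
        using polynomial_vanishing[OF _ g that, of "- (2 powr \<rho>)" 1 0] True by auto
      obtain b where b: "\<And>l. l > 0 \<Longrightarrow> g l = b * l powr \<rho>"
        by (rule quasiperiodic_solution_eq_powr[OF positive_solutions_solution[OF g] per])
          (use \<rho> in \<open>auto simp: indicial_root_def intro: that\<close>)
      have "b = 1" using b[of 1] positive_solutions_one[OF g] by simp
      then show ?thesis using b[OF l] by simp
    qed
    then have "\<exists>a. 0 \<le> a \<and> a \<le> 1 \<and> (\<forall>l>0. g l = (1 - a) * l powr \<rho> + a * l powr \<rho>)" if "g \<in> G" for g
      using that by (intro exI[of _ 0]) auto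
    then show ?thesis using that[of \<rho> \<rho>] \<rho> by (simp add: indicial_root_def)
  next
    case False
    then obtain \<rho>' where \<rho>': "indicial_root \<rho>'" "\<rho>' \<noteq> \<rho>" by blast
    define \<rho>1 \<rho>2 where "\<rho>1 = min \<rho> \<rho>'" and "\<rho>2 = max \<rho> \<rho>'"
    have r12: "indicial_root \<rho>1" "indicial_root \<rho>2" "\<rho>1 < \<rho>2" using \<rho> \<rho>' by (auto simp: \<rho>1_def \<rho>2_def min_def max_def)
    have only: "\<sigma> = \<rho>1 \<or> \<sigma> = \<rho>2" if "indicial_root \<sigma>" for \<sigma>
      using no_three_roots that r12 by (metis linorder_neqE_linordered_idom)
    define A B where "A = 2 powr \<rho>1" and "B = 2 powr \<rho>2"
    have AB: "A < B" using r12 by (simp add: A_def B_def)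
    have "\<exists>a. 0 \<le> a \<and> a \<le> 1 \<and> (\<forall>l>0. g l = (1 - a) * l powr \<rho>1 + a * l powr \<rho>2)" if g: "g \<in> G" for g
    proof -
      \<comment> \<open>This is $Q(E) g = 0$ for $Q(x) = -(x - A)(x - B)$.\<close>
      have rec: "g (4 * l) = (A + B) * g (2 * l) - A * B * g l" if l: "l > 0" for l
      proof -
        have "- (A * B) + (A + B) * 2 powr \<sigma> + (- 1) * 4 powr \<sigma> = 0" if "indicial_root \<sigma>" for \<sigma>
          using only[OF that] by (auto simp: sq A_def B_def power2_eq_square algebra_simps)
        from polynomial_vanishing[OF this g l] show ?thesis by simp
      qed
      have sg: "solution g" by (rule positive_solutions_solution[OF g])
      define u where "u l = g (2 * l) - A * g l" for l
      define v where "v l = B * g l - g (2 * l)" for l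
      have "solution u" unfolding u_def by (intro solution_diff solution_cmult solution_scale sg) simp
      moreover have "u (2 * l) = 2 powr \<rho>2 * u l" if "l > 0" for l
        using rec[OF that] by (simp add: u_def B_def[symmetric] algebra_simps)
      ultimately obtain b where b: "\<And>l. l > 0 \<Longrightarrow> u l = b * l powr \<rho>2"
        by (rule quasiperiodic_solution_eq_powr[of u \<rho>2])
          (use r12 in \<open>auto simp: indicial_root_def intro: that\<close>)
      have "solution v" unfolding v_def by (intro solution_diff solution_cmult solution_scale sg) simp
      moreover have "v (2 * l) = 2 powr \<rho>1 * v l" if "l > 0" for l
        using rec[OF that] by (simp add: v_def A_def[symmetric] algebra_simps)
      ultimately obtain a where a: "\<And>l. l > 0 \<Longrightarrow> v l = a * l powr \<rho>1"
        by (rule quasiperiodic_solution_eq_powr[of v \<rho>1])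
          (use r12 in \<open>auto simp: indicial_root_def intro: that\<close>)
      define x y where "x = a / (B - A)" and "y = b / (B - A)"
      have gxy: "g l = x * l powr \<rho>1 + y * l powr \<rho>2" if l: "l > 0" for l
      proof -
        have "(B - A) * g l = u l + v l" by (simp add: u_def v_def algebra_simps)
        then have "g l = (u l + v l) / (B - A)" using AB by (simp add: field_simps)
        then show ?thesis using a[OF l] b[OF l] by (simp add: x_def y_def add_divide_distrib)
      qed
      have xy: "x + y = 1" using gxy[of 1] positive_solutions_one[OF g] by simp
      have "0 \<le> x \<and> 0 \<le> y"
        by (rule convex_weights[OF xy r12(3)]) (use gxy positive_solutions_pos[OF g] in force)
      moreover have "x = 1 - y" using xy by simp
      ultimately show ?thesis using gxy by (intro exI[of _ y]) auto
    qed
    then show ?thesis using that[of \<rho>1 \<rho>2] r12 by (auto simp: indicial_root_def)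
  qed
qed

end

section \<open>Regular variation from scaling limits\<close>

definition mixture :: "real \<Rightarrow> real \<Rightarrow> real \<Rightarrow> real \<Rightarrow> real" where
  "mixture \<rho>1 \<rho>2 a l = (1 - a) * l powr \<rho>1 + a * l powr \<rho>2"

lemma mixture_pos:
  assumes "0 \<le> a" "a \<le> 1" "l > 0"
  shows "0 < mixture \<rho>1 \<rho>2 a l"
proof (cases "a = 1")
  case False
  then have "0 < (1 - a) * l powr \<rho>1" "0 \<le> a * l powr \<rho>2" using assms by auto
  then show ?thesis by (simp add: mixture_def)
qed (use assms in \<open>simp add: mixture_def\<close>)

lemma mixture_double:
  assumes "l > 0"
  shows "mixture \<rho>1 \<rho>2 a (2 * l) = (1 - a) * l powr \<rho>1 * 2 powr \<rho>1 + a * l powr \<rho>2 * 2 powr \<rho>2"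
  using assms by (simp add: mixture_def powr_mult mult_ac)

text \<open>The argument $s_n$ may vary with the index; the proof that levels of $f(2r)/f(r)$ persist
needs this for multipliers that range over an interval.\<close>

definition scaling_limit :: "(real \<Rightarrow> real) \<Rightarrow> (nat \<Rightarrow> real) \<Rightarrow> (real \<Rightarrow> real) \<Rightarrow> bool" where
  "scaling_limit f r g \<longleftrightarrow>
     (\<forall>s l. l > 0 \<longrightarrow> s \<longlonglongrightarrow> l \<longrightarrow> (\<lambda>n. f (s n * r n) / f (r n)) \<longlonglongrightarrow> g l)"

lemma scaling_limitD:
  "scaling_limit f r g \<Longrightarrow> l > 0 \<Longrightarrow> s \<longlonglongrightarrow> l \<Longrightarrow> (\<lambda>n. f (s n * r n) / f (r n)) \<longlonglongrightarrow> g l"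
  by (simp add: scaling_limit_def)

text \<open>A sequence along which the quotient stays away from its limit has a subsequence with a scaling limit.\<close>

lemma regularly_varying_if_scaling_limits:
  fixes f :: "real \<Rightarrow> real"
  assumes pos: "\<And>x. x > 0 \<Longrightarrow> f x > 0"
    and lim: "\<And>r. filterlim r at_top sequentially \<Longrightarrow>
      \<exists>k. strict_mono (k :: nat \<Rightarrow> nat) \<and> scaling_limit f (r \<circ> k) (\<lambda>l. l powr \<rho>)"
  shows "regularly_varying \<rho> f"
  unfolding regularly_varying_def
proof (intro conjI allI impI)
  show "\<exists>x0>0. \<forall>x\<ge>x0. 0 < f x" using pos by (intro exI[of _ 1]) auto
  fix l :: real assume l: "l > 0"
  show "((\<lambda>x. f (l * x) / f x) \<longlongrightarrow> l powr \<rho>) at_top"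
  proof (rule tendsto_at_topI_sequentially)
    fix X :: "nat \<Rightarrow> real" assume X: "filterlim X at_top sequentially"
    show "(\<lambda>n. f (l * X n) / f (X n)) \<longlonglongrightarrow> l powr \<rho>"
    proof (rule ccontr)
      assume "\<not> ?thesis"
      then obtain d where d: "d > 0" and "\<not> (\<forall>\<^sub>F n in sequentially. dist (f (l * X n) / f (X n)) (l powr \<rho>) < d)"
        unfolding tendsto_iff by blast
      then have inf: "\<exists>n\<ge>N. d \<le> dist (f (l * X n) / f (X n)) (l powr \<rho>)" for N
        by (auto simp: eventually_sequentially not_less)
      define P where "P n \<longleftrightarrow> d \<le> dist (f (l * X n) / f (X n)) (l powr \<rho>)" for n
      have "infinite {n. P n}"
        unfolding infinite_nat_iff_unbounded_le using inf by (auto simp: P_def)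
      then obtain q :: "nat \<Rightarrow> nat" where q: "strict_mono q" "\<And>n. P (q n)"
        using infinite_enumerate by blast
      have "filterlim (X \<circ> q) at_top sequentially"
        unfolding comp_def by (rule filterlim_compose[OF X filterlim_subseq[OF q(1)]])
      from lim[OF this] obtain k where k: "strict_mono (k :: nat \<Rightarrow> nat)"
        "scaling_limit f (X \<circ> q \<circ> k) (\<lambda>l. l powr \<rho>)" by blast
      have "(\<lambda>n. f (l * (X \<circ> q \<circ> k) n) / f ((X \<circ> q \<circ> k) n)) \<longlonglongrightarrow> l powr \<rho>"
        by (rule scaling_limitD[OF k(2) l tendsto_const])
      then have "\<forall>\<^sub>F n in sequentially. dist (f (l * X (q (k n))) / f (X (q (k n)))) (l powr \<rho>) < d"
        using d unfolding tendsto_iff comp_def by blast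
      then show False using q(2) by (auto simp: P_def eventually_sequentially not_less[symmetric])
    qed
  qed
qed

text \<open>Let $D(r) = f(2r)/f(r)$, and let $m$ be a level between $A = 2^{\rho_1}$ and $B = 2^{\rho_2}$ that $D$ exceeds at arbitrarily
large arguments; one exists unless all limits have $a = 0$.  A mixture with $g(2)/g(1) \ge m$ has
$g(2l)/g(l) > m$ for $l > 1$.  So $D(r) \ge m$ persists from a large $r$ to all $\mu r$ with $2 \le \mu \le 4$, and by iteration to
all arguments beyond $2r$.  Then all limits satisfy $g(2l)/g(l) \ge m$ also for $l \to 0$, where
mixtures with $a < 1$ have the limit $A$.\<close>

lemma regularly_varying_if_mixture_limits:
  fixes f :: "real \<Rightarrow> real"
  assumes pos: "\<And>x. x > 0 \<Longrightarrow> f x > 0" and \<rho>: "\<rho>1 \<le> \<rho>2"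
    and lim: "\<And>r. filterlim r at_top sequentially \<Longrightarrow>
      \<exists>k a. strict_mono (k :: nat \<Rightarrow> nat) \<and> 0 \<le> a \<and> a \<le> 1 \<and> scaling_limit f (r \<circ> k) (mixture \<rho>1 \<rho>2 a)"
  shows "regularly_varying \<rho>1 f \<or> regularly_varying \<rho>2 f"
proof (rule disjCI)
  assume not2: "\<not> regularly_varying \<rho>2 f"
  define A B where "A = 2 powr \<rho>1" and "B = 2 powr \<rho>2"
  define D where "D r = f (2 * r) / f r" for r
  have D_lim: "(\<lambda>n. D (s n * r n)) \<longlonglongrightarrow> mixture \<rho>1 \<rho>2 a (2 * l) / mixture \<rho>1 \<rho>2 a l"
    if sl: "scaling_limit f r (mixture \<rho>1 \<rho>2 a)" and a: "0 \<le> a" "a \<le> 1"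
      and l: "l > 0" "s \<longlonglongrightarrow> l" and r: "filterlim r at_top sequentially" for r a l s
  proof -
    have "(\<lambda>n. f ((2 * s n) * r n) / f (r n) / (f (s n * r n) / f (r n)))
        \<longlonglongrightarrow> mixture \<rho>1 \<rho>2 a (2 * l) / mixture \<rho>1 \<rho>2 a l"
      using mixture_pos[OF a l(1), of \<rho>1 \<rho>2] l
      by (intro tendsto_divide scaling_limitD[OF sl] tendsto_intros) auto
    moreover have "\<forall>\<^sub>F n in sequentially. f ((2 * s n) * r n) / f (r n) / (f (s n * r n) / f (r n)) = D (s n * r n)"
    proof -
      have "\<forall>\<^sub>F n in sequentially. r n > 0" using r by (simp add: filterlim_at_top_dense)
      then show ?thesis
      proof eventually_elim
        case (elim n)
        then show ?case using pos[of "r n"] by (simp add: D_def mult.assoc)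
      qed
    qed
    ultimately show ?thesis by (rule Lim_transform_eventually)
  qed
  show "regularly_varying \<rho>1 f"
  proof (rule ccontr)
    assume not1: "\<not> regularly_varying \<rho>1 f"
    have lt: "\<rho>1 < \<rho>2"
    proof (rule ccontr)
      assume "\<not> ?thesis"
      then have "mixture \<rho>1 \<rho>2 a = (\<lambda>l. l powr \<rho>1)" for a
        using \<rho> by (auto simp: mixture_def fun_eq_iff algebra_simps)
      then have "\<exists>k. strict_mono k \<and> scaling_limit f (r \<circ> k) (\<lambda>l. l powr \<rho>1)"
        if "filterlim r at_top sequentially" for r
        using lim[OF that] by auto
      from regularly_varying_if_scaling_limits[of f, OF pos this] have "regularly_varying \<rho>1 f" .
      with not1 show False by simp
    qed
    have AB: "0 < A" "A < B" using lt by (auto simp: A_def B_def)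
    obtain r0 where r0: "filterlim r0 at_top sequentially"
      "\<And>k. strict_mono (k :: nat \<Rightarrow> nat) \<Longrightarrow> \<not> scaling_limit f (r0 \<circ> k) (\<lambda>l. l powr \<rho>1)"
      using regularly_varying_if_scaling_limits[of f \<rho>1] pos not1 by blast
    obtain k0 a0 where k0: "strict_mono (k0 :: nat \<Rightarrow> nat)" and a0: "0 \<le> a0" "a0 \<le> 1"
      and sl0: "scaling_limit f (r0 \<circ> k0) (mixture \<rho>1 \<rho>2 a0)"
      using lim[OF r0(1)] by blast
    have fil: "filterlim (r \<circ> k) at_top sequentially"
      if "filterlim r at_top sequentially" "strict_mono k" for r :: "nat \<Rightarrow> real" and k
      unfolding comp_def by (rule filterlim_compose[OF that(1) filterlim_subseq[OF that(2)]])
    have "a0 \<noteq> 0"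
    proof
      assume "a0 = 0"
      then have "mixture \<rho>1 \<rho>2 a0 = (\<lambda>l. l powr \<rho>1)" by (auto simp: mixture_def)
      then show False using sl0 r0(2)[OF k0] by simp
    qed
    define m0 where "m0 = (1 - a0) * A + a0 * B"
    have m0: "A < m0" "m0 \<le> B"
    proof -
      have e: "m0 = A + a0 * (B - A)" "B = m0 + (1 - a0) * (B - A)" by (auto simp: m0_def algebra_simps)
      have p: "0 < a0 * (B - A)" "0 \<le> (1 - a0) * (B - A)"
        using \<open>a0 \<noteq> 0\<close> a0 AB by auto
      show "A < m0" using e(1) p(1) by linarith
      show "m0 \<le> B" using e(2) p(2) by linarith
    qed
    define m where "m = (A + m0) / 2"
    have m: "A < m" "m < m0" "m < B" using m0 AB by (auto simp: m_def)
    have mix1: "mixture \<rho>1 \<rho>2 a (2 * 1) / mixture \<rho>1 \<rho>2 a 1 = (1 - a) * A + a * B" for a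
      by (simp add: mixture_def A_def B_def)
    have often: "\<exists>r\<ge>R. r > 0 \<and> m \<le> D r" for R
    proof -
      have "(\<lambda>n. D (1 * (r0 \<circ> k0) n)) \<longlonglongrightarrow> m0"
        using D_lim[OF sl0 a0 zero_less_one tendsto_const fil[OF r0(1) k0]] unfolding mix1 m0_def .
      then have "\<forall>\<^sub>F n in sequentially. m < D ((r0 \<circ> k0) n)" using m by (auto dest: order_tendstoD)
      moreover have "\<forall>\<^sub>F n in sequentially. max R 1 \<le> (r0 \<circ> k0) n"
        using fil[OF r0(1) k0] unfolding filterlim_at_top by blast
      ultimately have "\<forall>\<^sub>F n in sequentially. m < D ((r0 \<circ> k0) n) \<and> max R 1 \<le> (r0 \<circ> k0) n"
        by eventually_elim simp
      then obtain n where "m < D ((r0 \<circ> k0) n)" "max R 1 \<le> (r0 \<circ> k0) n"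
        by (auto dest: eventually_happens)
      then show ?thesis by (intro exI[of _ "(r0 \<circ> k0) n"]) auto
    qed
    \<comment> \<open>A failure for arbitrarily large $r$ would give a limit with quotient at least $m$ at $1$ and at most $m$ at some
      $\mu' \ge 2$, which strict growth along mixtures rules out.\<close>
    have "\<exists>R. \<forall>r\<ge>R. \<forall>\<mu>. 2 \<le> \<mu> \<and> \<mu> \<le> 4 \<and> m \<le> D r \<longrightarrow> m \<le> D (\<mu> * r)"
    proof (rule ccontr)
      assume "\<not> ?thesis"
      then have "\<exists>r \<mu>. real n \<le> r \<and> 2 \<le> \<mu> \<and> \<mu> \<le> 4 \<and> m \<le> D r \<and> D (\<mu> * r) < m" for n
        by (metis not_le)
      then obtain r \<mu> where r: "\<And>n. real n \<le> r n" and \<mu>: "\<And>n. \<mu> n \<in> {2..4}"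
        and mD: "\<And>n. m \<le> D (r n)" and Dm: "\<And>n. D (\<mu> n * r n) < m" by (metis atLeastAtMost_iff)
      obtain \<mu>' q where \<mu>': "\<mu>' \<in> {2..4}" and q: "strict_mono (q :: nat \<Rightarrow> nat)" and q\<mu>: "(\<mu> \<circ> q) \<longlonglongrightarrow> \<mu>'"
        using compact_Icc[of 2 "4::real"] \<mu> unfolding compact_def by meson
      have rinf: "filterlim r at_top sequentially"
        by (rule filterlim_at_top_mono[OF filterlim_real_sequentially]) (use r in auto)
      obtain k a where k: "strict_mono (k :: nat \<Rightarrow> nat)" and a: "0 \<le> a" "a \<le> 1"
        and sl: "scaling_limit f (r \<circ> q \<circ> k) (mixture \<rho>1 \<rho>2 a)"
        using lim[OF fil[OF rinf q]] by blast
      have fi: "filterlim (r \<circ> q \<circ> k) at_top sequentially" by (rule fil[OF fil[OF rinf q] k])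
      have "(\<lambda>n. D (1 * (r \<circ> q \<circ> k) n)) \<longlonglongrightarrow> (1 - a) * A + a * B"
        using D_lim[OF sl a zero_less_one tendsto_const fi] unfolding mix1 .
      then have 1: "m \<le> (1 - a) * A + a * B"
        by (rule LIMSEQ_le_const) (use mD in auto)
      have \<mu>0: "\<mu>' > 0" using \<mu>' by auto
      have "(\<lambda>n. D ((\<mu> \<circ> q \<circ> k) n * (r \<circ> q \<circ> k) n)) \<longlonglongrightarrow> mixture \<rho>1 \<rho>2 a (2 * \<mu>') / mixture \<rho>1 \<rho>2 a \<mu>'"
        by (rule D_lim[OF sl a \<mu>0 LIMSEQ_subseq_LIMSEQ[OF q\<mu> k] fi])
      then have "mixture \<rho>1 \<rho>2 a (2 * \<mu>') / mixture \<rho>1 \<rho>2 a \<mu>' \<le> m"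
        by (rule LIMSEQ_le_const2) (use Dm in \<open>auto intro: less_imp_le\<close>)
      then have "mixture \<rho>1 \<rho>2 a (2 * \<mu>') \<le> m * mixture \<rho>1 \<rho>2 a \<mu>'"
        using mixture_pos[OF a \<mu>0, of \<rho>1 \<rho>2] by (simp add: divide_le_eq)
      then have 2: "a * (B - m) * \<mu>' powr \<rho>2 \<le> (1 - a) * (m - A) * \<mu>' powr \<rho>1"
        unfolding mixture_double[OF \<mu>0] A_def[symmetric] B_def[symmetric] by (simp add: mixture_def algebra_simps)
      have 3: "(1 - a) * (m - A) \<le> a * (B - m)" using 1 by (simp add: algebra_simps)
      have pw: "0 < \<mu>' powr \<rho>1" "\<mu>' powr \<rho>1 < \<mu>' powr \<rho>2" using \<mu>' lt by auto
      have "0 \<le> a * (B - m)" using a m by simp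
      show False
      proof (cases "a = 0")
        case True then show False using 3 m by simp
      next
        case False
        then have "0 < a * (B - m)" using a m by simp
        then have "a * (B - m) * \<mu>' powr \<rho>1 < a * (B - m) * \<mu>' powr \<rho>2" using pw by (intro mult_strict_left_mono)
        also have "\<dots> \<le> (1 - a) * (m - A) * \<mu>' powr \<rho>1" by (rule 2)
        also have "\<dots> \<le> a * (B - m) * \<mu>' powr \<rho>1" using 3 pw by (intro mult_right_mono) auto
        finally show False by simp
      qed
    qed
    then obtain R where R: "\<And>r \<mu>. R \<le> r \<Longrightarrow> 2 \<le> \<mu> \<Longrightarrow> \<mu> \<le> 4 \<Longrightarrow> m \<le> D r \<Longrightarrow> m \<le> D (\<mu> * r)" by blast
    obtain r1 where r1: "r1 \<ge> R" "r1 > 0" "m \<le> D r1" using often[of R] by blast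
    \<comment> \<open>The first multiplication by a factor in $[2,4]$ fills an interval; doubling moves it to the right without gaps.\<close>
    have block: "m \<le> D s" if "2 * 2 ^ j \<le> s / r1" "s / r1 \<le> 4 * 2 ^ j" for j s
      using that
    proof (induction j arbitrary: s)
      case 0
      then show ?case using R[of r1 "s / r1"] r1 by simp
    next
      case (Suc j)
      have "2 * 2 ^ j \<le> s / 2 / r1" "s / 2 / r1 \<le> 4 * 2 ^ j" using Suc.prems by auto
      then have "m \<le> D (s / 2)" by (rule Suc.IH)
      moreover have "R \<le> s / 2"
      proof -
        have "(1::real) \<le> 2 * 2 ^ j" using one_le_power[of "2::real" j] by linarith
        then have "1 \<le> s / 2 / r1" using \<open>2 * 2 ^ j \<le> s / 2 / r1\<close> by linarith
        then show ?thesis using r1 by (simp add: le_divide_eq)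
      qed
      ultimately show ?case using R[of "s / 2" 2] by simp
    qed
    have ev: "m \<le> D s" if "2 * r1 \<le> s" for s
    proof -
      have "1 \<le> s / r1 / 2" using that r1 by (simp add: le_divide_eq)
      then obtain j where "2 ^ j \<le> s / r1 / 2" "s / r1 / 2 < 2 ^ Suc j" using ex_dyadic_ge_one by blast
      then show ?thesis by (intro block[of j]) auto
    qed
    have "regularly_varying \<rho>2 f"
    proof (rule regularly_varying_if_scaling_limits[OF pos])
      fix r :: "nat \<Rightarrow> real" assume r: "filterlim r at_top sequentially"
      obtain k a where k: "strict_mono (k :: nat \<Rightarrow> nat)" and a: "0 \<le> a" "a \<le> 1"
        and sl: "scaling_limit f (r \<circ> k) (mixture \<rho>1 \<rho>2 a)"
        using lim[OF r] by blast
      have fi: "filterlim (r \<circ> k) at_top sequentially" by (rule fil[OF r k])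
      have ineq: "(1 - a) * (m - A) * l powr \<rho>1 \<le> a * (B - m) * l powr \<rho>2" if l: "l > 0" for l
      proof -
        have "m \<le> mixture \<rho>1 \<rho>2 a (2 * l) / mixture \<rho>1 \<rho>2 a l"
        proof (rule LIMSEQ_le_const[OF D_lim[OF sl a l tendsto_const fi]])
          have "\<forall>\<^sub>F n in sequentially. 2 * r1 / l \<le> (r \<circ> k) n"
            using fi unfolding filterlim_at_top by blast
          then have "\<forall>\<^sub>F n in sequentially. m \<le> D (l * (r \<circ> k) n)"
            by eventually_elim (use l in \<open>auto intro!: ev simp: divide_le_eq mult.commute\<close>)
          then show "\<exists>N. \<forall>n\<ge>N. m \<le> D (l * (r \<circ> k) n)" by (simp add: eventually_sequentially)
        qed
        then have "m * mixture \<rho>1 \<rho>2 a l \<le> mixture \<rho>1 \<rho>2 a (2 * l)"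
          using mixture_pos[OF a l, of \<rho>1 \<rho>2] by (simp add: le_divide_eq)
        then show ?thesis
          unfolding mixture_double[OF l] A_def[symmetric] B_def[symmetric] by (simp add: mixture_def algebra_simps)
      qed
      have "a = 1"
      proof (rule ccontr)
        assume "a \<noteq> 1"
        define p q where "p = (1 - a) * (m - A)" and "q = a * (B - m)"
        have p: "0 < p" using \<open>a \<noteq> 1\<close> a m by (simp add: p_def)
        have "p \<le> q" using ineq[of 1] by (simp add: p_def q_def)
        then have q: "0 < q" using p by simp
        \<comment> \<open>At this point the term with the larger exponent is exactly half of what the inequality demands.\<close>
        define l where "l = (p / (2 * q)) powr (1 / (\<rho>2 - \<rho>1))"
        have l: "l > 0" using p q by (simp add: l_def)
        have "l powr (\<rho>2 - \<rho>1) = p / (2 * q)" using p q lt by (simp add: l_def powr_powr)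
        moreover have "l powr \<rho>2 = l powr \<rho>1 * l powr (\<rho>2 - \<rho>1)" by (simp add: powr_add[symmetric])
        ultimately have "q * l powr \<rho>2 = p / 2 * l powr \<rho>1" using q by simp
        moreover have "p * l powr \<rho>1 \<le> q * l powr \<rho>2" using ineq[OF l] by (simp add: p_def q_def)
        moreover have "0 < p * l powr \<rho>1" using p l by simp
        ultimately show False by simp
      qed
      then have "mixture \<rho>1 \<rho>2 a = (\<lambda>l. l powr \<rho>2)" by (auto simp: mixture_def)
      then show "\<exists>k. strict_mono k \<and> scaling_limit f (r \<circ> k) (\<lambda>l. l powr \<rho>2)" using k sl by auto
    qed
    with not2 show False by simp
  qed
qed

section \<open>Growth of an exponent comparable to its Levy density\<close>

text \<open>An exponent whose Levy density satisfies the third condition.\<close>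

locale asymptotic_density = unimodal_exponent +
  fixes c :: real
  assumes c_pos: "c > 0"
    and density_asymp: "((\<lambda>x. \<nu> x / (inverse (norm x) ^ DIM('a) * profile (inverse (norm x)))) \<longlongrightarrow> c) (at 0)"
begin

text \<open>Below this radius the density is comparable to $|x|^{-d}\psi(1/|x|)$, with constants $c/2$ and $2c$.\<close>

definition radius :: real where
  "radius = (SOME \<delta>. \<delta> > 0 \<and> (\<forall>x. 0 < norm x \<and> norm x < \<delta> \<longrightarrow>
     \<bar>\<nu> x / (inverse (norm x) ^ DIM('a) * profile (inverse (norm x))) - c\<bar> < c / 2))"

lemma radius: "radius > 0"
  "0 < norm x \<Longrightarrow> norm x < radius \<Longrightarrow>
     \<bar>\<nu> x / (inverse (norm x) ^ DIM('a) * profile (inverse (norm x))) - c\<bar> < c / 2"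
proof -
  have "\<exists>\<delta>>0. \<forall>x. 0 < norm x \<and> norm x < \<delta> \<longrightarrow>
     \<bar>\<nu> x / (inverse (norm x) ^ DIM('a) * profile (inverse (norm x))) - c\<bar> < c / 2"
    using density_asymp c_pos unfolding tendsto_iff eventually_at
    by (auto simp: dist_norm dest!: spec[of _ "c/2"])
  from someI_ex[OF this] have *: "radius > 0 \<and> (\<forall>x. 0 < norm x \<and> norm x < radius \<longrightarrow>
     \<bar>\<nu> x / (inverse (norm x) ^ DIM('a) * profile (inverse (norm x))) - c\<bar> < c / 2)"
    unfolding radius_def .
  then show "radius > 0" "0 < norm x \<Longrightarrow> norm x < radius \<Longrightarrow>
     \<bar>\<nu> x / (inverse (norm x) ^ DIM('a) * profile (inverse (norm x))) - c\<bar> < c / 2"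
    by auto
qed

lemma profile_positive:
  assumes "r > 0"
  shows "profile r > 0"
proof -
  define x :: 'a where "x = (radius / 2) *\<^sub>R axis_vector"
  have x: "0 < norm x" "norm x < radius" using radius(1) by (auto simp: x_def)
  have "profile (inverse (norm x)) \<noteq> 0"
  proof
    assume "profile (inverse (norm x)) = 0"
    then have "\<bar>0 - c\<bar> < c / 2" using radius(2)[OF x] by simp
    then show False using c_pos by simp
  qed
  then have "profile (inverse (norm x)) > 0" using profile_nonneg[of "inverse (norm x)"] by linarith
  from profile_pos[OF this _ assms] show ?thesis using x by simp
qed

lemma density_bounds:
  assumes x: "0 < norm x" "norm x < radius"
  shows "c / 2 * inverse (norm x) ^ DIM('a) * profile (inverse (norm x)) \<le> \<nu> x"
    and "\<nu> x \<le> 2 * c * inverse (norm x) ^ DIM('a) * profile (inverse (norm x))"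
proof -
  define w where "w = inverse (norm x) ^ DIM('a) * profile (inverse (norm x))"
  have w: "w > 0" using x by (auto simp: w_def intro!: mult_pos_pos profile_positive)
  have "\<bar>\<nu> x / w - c\<bar> < c / 2" using radius(2)[OF x] by (simp add: w_def)
  then have "c / 2 \<le> \<nu> x / w" "\<nu> x / w \<le> 2 * c" using c_pos unfolding abs_less_iff by linarith+
  then have "c / 2 * w \<le> \<nu> x" "\<nu> x \<le> 2 * c * w" using w by (auto simp: le_divide_eq divide_le_eq)
  then show "c / 2 * inverse (norm x) ^ DIM('a) * profile (inverse (norm x)) \<le> \<nu> x"
    "\<nu> x \<le> 2 * c * inverse (norm x) ^ DIM('a) * profile (inverse (norm x))"
    by (auto simp: w_def)
qed

lemma truncated_moment_ge_shell:
  assumes ab: "0 < a" "b \<le> radius" and m: "m \<ge> 0"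
    and ge: "\<And>x::'a. a \<le> norm x \<Longrightarrow> norm x < b \<Longrightarrow> m \<le> min 1 (r\<^sup>2 * (norm x)\<^sup>2) * profile (inverse (norm x))"
  shows "ennreal (c / 2 * m) * emeasure dilation_measure (shell a b :: 'a set) \<le> ennreal (truncated_moment r)"
proof -
  have "ennreal (c / 2 * m) * emeasure dilation_measure (shell a b :: 'a set)
      = (\<integral>\<^sup>+x. ennreal (c / 2 * m) * indicator (shell a b :: 'a set) x \<partial>dilation_measure)"
    by (subst nn_integral_cmult) auto
  also have "\<dots> = (\<integral>\<^sup>+x. ennreal (inverse (norm x) ^ DIM('a)) * (ennreal (c / 2 * m) * indicator (shell a b :: 'a set) x) \<partial>lborel)"
    by (rule nn_integral_dilation_measure) simp
  also have "\<dots> \<le> (\<integral>\<^sup>+x. ennreal (\<nu> x) * ennreal (min 1 (r\<^sup>2 * (norm x)\<^sup>2)) \<partial>lborel)"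
  proof (intro nn_integral_mono)
    fix x :: 'a
    show "ennreal (inverse (norm x) ^ DIM('a)) * (ennreal (c / 2 * m) * indicator (shell a b :: 'a set) x)
        \<le> ennreal (\<nu> x) * ennreal (min 1 (r\<^sup>2 * (norm x)\<^sup>2))"
    proof (cases "x \<in> shell a b")
      case True
      then have x: "a \<le> norm x" "norm x < b" by (auto simp: shell_def)
      have x': "0 < norm x" "norm x < radius" using x ab by auto
      have "inverse (norm x) ^ DIM('a) * (c / 2 * m)
          \<le> inverse (norm x) ^ DIM('a) * (c / 2 * (min 1 (r\<^sup>2 * (norm x)\<^sup>2) * profile (inverse (norm x))))"
        using ge[OF x] c_pos by (intro mult_left_mono) auto
      also have "\<dots> = (c / 2 * inverse (norm x) ^ DIM('a) * profile (inverse (norm x))) * min 1 (r\<^sup>2 * (norm x)\<^sup>2)"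
        by simp
      also have "\<dots> \<le> \<nu> x * min 1 (r\<^sup>2 * (norm x)\<^sup>2)"
        using density_bounds(1)[OF x'] by (intro mult_right_mono) auto
      finally have "ennreal (inverse (norm x) ^ DIM('a) * (c / 2 * m)) \<le> ennreal (\<nu> x * min 1 (r\<^sup>2 * (norm x)\<^sup>2))"
        by (rule ennreal_leI)
      moreover have \<nu>x: "0 \<le> \<nu> x"
        using isotropic_unimodal_density_nonneg[OF density, of x] x' by auto
      moreover have "ennreal (inverse (norm x) ^ DIM('a)) * ennreal (c / 2 * m)
          = ennreal (inverse (norm x) ^ DIM('a) * (c / 2 * m))"
        using c_pos m by (intro ennreal_mult[symmetric]) auto
      moreover have "ennreal (\<nu> x) * ennreal (min 1 (r\<^sup>2 * (norm x)\<^sup>2)) = ennreal (\<nu> x * min 1 (r\<^sup>2 * (norm x)\<^sup>2))"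
        using \<nu>x by (intro ennreal_mult[symmetric]) auto
      ultimately show ?thesis using True by simp
    qed simp
  qed
  also have "\<dots> = (\<integral>\<^sup>+x. ennreal (min 1 (r\<^sup>2 * (norm x)\<^sup>2)) \<partial>N)"
    by (rule nn_integral_N[symmetric]) simp
  also have "\<dots> = ennreal (truncated_moment r)" by (rule nn_integral_truncated_moment)
  finally show ?thesis .
qed

definition growth_const :: real where
  "growth_const = c / 2 / doubling_const * measure dilation_measure (shell 1 2 :: 'a set) / (5 * DIM('a))"

lemma emeasure_unit_shell:
  "emeasure dilation_measure (shell 1 2 :: 'a set) = ennreal (measure dilation_measure (shell 1 2 :: 'a set))"
  using emeasure_shell_finite[of 1 2, where 'a='a] by (intro emeasure_eq_ennreal_measure) simp

lemma growth_const_pos: "growth_const > 0"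
proof -
  have "0 < measure dilation_measure (shell 1 2 :: 'a set)"
    using emeasure_shell_pos[of 1 2, where 'a='a] unfolding emeasure_unit_shell by simp
  then show ?thesis using c_pos doubling_const_ge DIM_positive[where 'a='a] by (simp add: growth_const_def)
qed

text \<open>The shell from $a$ to $2^k a$ has mass proportional to $k$ under the dilation-invariant measure.  This
gain of a factor $k$, however small the constant in front of it, forces growth strictly between constant and quadratic.\<close>

lemma profile_ge_dyadic:
  assumes a: "a > 0" "a * 2 ^ k \<le> radius" and m: "m \<ge> 0" and r: "r > 0"
    and ge: "\<And>x::'a. a \<le> norm x \<Longrightarrow> norm x < a * 2 ^ k \<Longrightarrow>
      m / doubling_const \<le> min 1 (r\<^sup>2 * (norm x)\<^sup>2) * profile (inverse (norm x))"
  shows "growth_const * k * m \<le> profile r"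
proof -
  define \<sigma> where "\<sigma> = measure dilation_measure (shell 1 2 :: 'a set)"
  have "emeasure dilation_measure (shell (a * 1) (a * 2 ^ k) :: 'a set)
      = ennreal (k * \<sigma>)"
    unfolding emeasure_shell_scaleR[OF a(1)] emeasure_dyadic_shells emeasure_unit_shell \<sigma>_def
    by (simp add: ennreal_mult ennreal_of_nat_eq_real_of_nat)
  then have "ennreal (c / 2 * (m / doubling_const)) * ennreal (k * \<sigma>) \<le> ennreal (truncated_moment r)"
    using truncated_moment_ge_shell[OF a _ ge] m doubling_const_ge by simp
  then have "c / 2 * (m / doubling_const) * (k * \<sigma>) \<le> truncated_moment r"
    using c_pos m doubling_const_ge truncated_moment_nonneg[of r] 
    by (subst (asm) ennreal_mult[symmetric]) (auto simp: \<sigma>_def)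
  also have "\<dots> \<le> 5 * DIM('a) * profile r"
  proof -
    have "0 \<le> \<eta> * r\<^sup>2" using eta_nonneg by simp
    then show ?thesis using truncated_moment_le_psi[OF r] by linarith
  qed
  finally have "c / 2 * (m / doubling_const) * (k * \<sigma>) / (5 * DIM('a)) \<le> profile r"
    by (subst pos_divide_le_eq) (simp_all add: mult.commute)
  moreover have "c / 2 * (m / doubling_const) * (k * \<sigma>) / (5 * DIM('a)) = growth_const * k * m"
    by (simp add: growth_const_def \<sigma>_def)
  ultimately show ?thesis by simp
qed

text \<open>On the shell between $1/(2^k r)$ and $1/r$ the truncated square $\min(1, (2^k r)^2|x|^2)$ equals $1$ and
$\psi(1/|x|)$ is at least a multiple of $\psi(r)$.\<close>

lemma profile_lower_growth:
  assumes r: "r > 0" "1 / radius \<le> r"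
  shows "growth_const * k * profile r \<le> profile (2 ^ k * r)"
proof (rule profile_ge_dyadic[of "1 / (2 ^ k * r)"])
  show "1 / (2 ^ k * r) * 2 ^ k \<le> radius" using r radius(1) by (simp add: field_simps)
  fix x :: 'a assume x: "1 / (2 ^ k * r) \<le> norm x" "norm x < 1 / (2 ^ k * r) * 2 ^ k"
  then have x0: "0 < norm x" using r by (smt (verit) divide_pos_pos zero_less_mult_iff zero_less_power)
  have "1 \<le> 2 ^ k * r * norm x" using x(1) r by (simp add: divide_le_eq mult.commute)
  then have "1 \<le> (2 ^ k * r * norm x)\<^sup>2" by (rule one_le_power)
  then have 1: "min 1 ((2 ^ k * r)\<^sup>2 * (norm x)\<^sup>2) = 1" by (simp add: power_mult_distrib)
  have "r \<le> inverse (norm x)" using x(2) x0 r by (simp add: field_simps)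
  from profile_mono_up_to_const[OF r(1) this]
  show "profile r / doubling_const \<le> min 1 ((2 ^ k * r)\<^sup>2 * (norm x)\<^sup>2) * profile (inverse (norm x))"
    unfolding 1 using doubling_const_ge by (simp add: divide_le_eq mult.commute)
qed (use r profile_nonneg in auto)

text \<open>On the same shell $|x|^2\psi(1/|x|)$ is at least a multiple of $\psi(2^k r)/(2^k r)^2$.\<close>

lemma profile_upper_growth:
  assumes r: "r > 0" "1 / radius \<le> r"
  shows "growth_const * k * profile (2 ^ k * r) \<le> 4 ^ k * profile r"
proof -
  have "growth_const * k * (profile (2 ^ k * r) / 4 ^ k) \<le> profile r"
  proof (rule profile_ge_dyadic[of "1 / (2 ^ k * r)"])
    show "1 / (2 ^ k * r) * 2 ^ k \<le> radius" using r radius(1) by (simp add: field_simps)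
    fix x :: 'a assume x: "1 / (2 ^ k * r) \<le> norm x" "norm x < 1 / (2 ^ k * r) * 2 ^ k"
    then have x0: "0 < norm x" using r by (smt (verit) divide_pos_pos zero_less_mult_iff zero_less_power)
    have "r * norm x < 1" using x(2) r by (simp add: field_simps)
    then have "(r * norm x)\<^sup>2 \<le> 1" using r by (intro power_le_one) auto
    then have 1: "min 1 (r\<^sup>2 * (norm x)\<^sup>2) = r\<^sup>2 * (norm x)\<^sup>2" by (simp add: power_mult_distrib)
    \<comment> \<open>The point $1/|x|$ is moved to $2^k r$ by this factor, which is at least one on the shell.\<close>
    define l where "l = 2 ^ k * r * norm x"
    have l: "1 \<le> l" using x(1) r by (simp add: divide_le_eq mult.commute l_def)
    have "profile (l * inverse (norm x)) \<le> doubling_const * max 1 (l\<^sup>2) * profile (inverse (norm x))"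
      using l x0 by (intro profile_scale_le) auto
    moreover have "l * inverse (norm x) = 2 ^ k * r" using x0 by (simp add: l_def)
    moreover have "max 1 (l\<^sup>2) = 4 ^ k * (r\<^sup>2 * (norm x)\<^sup>2)"
    proof -
      have "1 \<le> l\<^sup>2" using l by (rule one_le_power)
      moreover have "(2 ^ k)\<^sup>2 = (4::real) ^ k" by (simp add: power2_eq_square power_mult_distrib[symmetric])
      ultimately show ?thesis by (simp add: l_def power_mult_distrib)
    qed
    ultimately have "profile (2 ^ k * r) \<le> doubling_const * (4 ^ k * (r\<^sup>2 * (norm x)\<^sup>2)) * profile (inverse (norm x))"
      by simp
    then show "profile (2 ^ k * r) / 4 ^ k / doubling_const \<le> min 1 (r\<^sup>2 * (norm x)\<^sup>2) * profile (inverse (norm x))"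
      unfolding 1 using doubling_const_ge by (simp add: divide_le_eq mult_ac)
  qed (use r profile_nonneg in auto)
  then show ?thesis by (simp add: field_simps)
qed

text \<open>A positive Gaussian coefficient would give $\psi$ quadratic growth, against the extra factor $k$ in
\<open>profile_upper_growth\<close>.\<close>

lemma eta_zero: "\<eta> = 0"
proof (rule ccontr)
  assume "\<eta> \<noteq> 0"
  then have eta: "\<eta> > 0" using eta_nonneg by simp
  define r where "r = 1 / radius"
  have r: "r > 0" "1 / radius \<le> r" using radius(1) by (auto simp: r_def)
  define d where "d = 5 * real DIM('a)"
  have d: "d > 0" using DIM_positive[where 'a='a] by (simp add: d_def)
  obtain k :: nat where k: "d * profile r / (growth_const * (\<eta> * r\<^sup>2)) < real k"
    using reals_Archimedean2 by blast
  have gp: "0 < growth_const * (\<eta> * r\<^sup>2)" using growth_const_pos eta r by simp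
  have "\<eta> * (2 ^ k * r)\<^sup>2 \<le> d * profile (2 ^ k * r)"
    using truncated_moment_le_psi[of "2 ^ k * r"] truncated_moment_nonneg[of "2 ^ k * r"] r by (simp add: d_def)
  then have "growth_const * k * (\<eta> * (2 ^ k * r)\<^sup>2) \<le> growth_const * k * (d * profile (2 ^ k * r))"
    using growth_const_pos by (intro mult_left_mono) auto
  also have "\<dots> = d * (growth_const * k * profile (2 ^ k * r))" by simp
  also have "\<dots> \<le> d * (4 ^ k * profile r)"
    using profile_upper_growth[OF r] d by (intro mult_left_mono) auto
  also have "growth_const * k * (\<eta> * (2 ^ k * r)\<^sup>2) = 4 ^ k * (k * (growth_const * (\<eta> * r\<^sup>2)))"
  proof -
    have "(2 ^ k)\<^sup>2 = (4::real) ^ k" by (simp add: power2_eq_square power_mult_distrib[symmetric])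
    then show ?thesis by (simp add: power_mult_distrib)
  qed
  finally have "k * (growth_const * (\<eta> * r\<^sup>2)) \<le> d * profile r" by (simp add: mult.left_commute[of d])
  with k gp show False by (simp add: divide_less_eq)
qed

text \<open>An exponent for which the factor $k$ beats the constant by a factor two.\<close>

definition step_exponent :: nat where
  "step_exponent = (SOME k. k \<ge> 1 \<and> 2 \<le> growth_const * real k)"

lemma step_exponent: "1 \<le> step_exponent" "2 \<le> growth_const * real step_exponent"
proof -
  obtain k :: nat where k: "2 / growth_const < real k" using reals_Archimedean2 by blast
  then have "real k > 0" using growth_const_pos by (smt (verit) divide_pos_pos)
  then have "k \<ge> 1" by simp
  moreover have "2 \<le> growth_const * real k" using k growth_const_pos by (simp add: divide_less_eq mult.commute)
  ultimately have "\<exists>k. k \<ge> 1 \<and> 2 \<le> growth_const * real k" by blast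
  from someI_ex[OF this] show "1 \<le> step_exponent" "2 \<le> growth_const * real step_exponent"
    by (auto simp: step_exponent_def)
qed

definition step :: real where "step = 2 ^ step_exponent"

lemma step_gt_1: "step > 1"
  using step_exponent(1) by (simp add: step_def)

lemma profile_step_lower:
  assumes r: "r > 0" "1 / radius \<le> r"
  shows "2 ^ j * profile r \<le> profile (step ^ j * r)"
proof (induction j)
  case (Suc j)
  have "1 \<le> step ^ j" using step_gt_1 by (intro one_le_power) auto
  then have r': "step ^ j * r > 0" "1 / radius \<le> step ^ j * r"
    using r by (auto intro: order_trans[of _ r] simp: mult_le_cancel_right1)
  have "2 * profile (step ^ j * r) \<le> growth_const * step_exponent * profile (step ^ j * r)"
    using step_exponent(2) profile_nonneg by (intro mult_right_mono) auto
  also have "\<dots> \<le> profile (step * (step ^ j * r))"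
    using profile_lower_growth[OF r', of step_exponent] by (simp add: step_def)
  finally show ?case using Suc by (simp add: mult_ac)
qed simp

lemma profile_step_upper:
  assumes r: "r > 0" "1 / radius \<le> r"
  shows "profile (step ^ j * r) \<le> (step\<^sup>2 / 2) ^ j * profile r"
proof (induction j)
  case (Suc j)
  have "1 \<le> step ^ j" using step_gt_1 by (intro one_le_power) auto
  then have r': "step ^ j * r > 0" "1 / radius \<le> step ^ j * r"
    using r by (auto intro: order_trans[of _ r] simp: mult_le_cancel_right1)
  have "(2 ^ step_exponent)\<^sup>2 = (4::real) ^ step_exponent" by (simp add: power2_eq_square power_mult_distrib[symmetric])
  then have s2: "step\<^sup>2 = 4 ^ step_exponent" by (simp add: step_def)
  have "2 * profile (step * (step ^ j * r)) \<le> growth_const * step_exponent * profile (step * (step ^ j * r))"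
    using step_exponent(2) profile_nonneg by (intro mult_right_mono) auto
  also have "\<dots> \<le> step\<^sup>2 * profile (step ^ j * r)"
    using profile_upper_growth[OF r', of step_exponent] by (simp add: step_def s2[symmetric, unfolded step_def])
  also have "\<dots> \<le> step\<^sup>2 * ((step\<^sup>2 / 2) ^ j * profile r)"
    using Suc by (intro mult_left_mono) auto
  finally show ?case by (simp add: mult_ac)
qed simp

text \<open>Chosen so that the factor two gained over one step becomes a power.\<close>

definition growth_index :: real where "growth_index = 1 / real step_exponent"

lemma growth_index: "0 < growth_index" "growth_index < 2" "step powr growth_index = 2"
proof -
  show "0 < growth_index" using step_exponent(1) by (simp add: growth_index_def)
  show "growth_index < 2" using step_exponent(1) by (simp add: growth_index_def divide_less_eq)
  have "step = 2 powr real step_exponent" by (simp add: step_def powr_realpow)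
  then show "step powr growth_index = 2" using step_exponent(1) by (simp add: growth_index_def powr_powr)
qed

definition ratio_const :: real where "ratio_const = doubling_const * step\<^sup>2 + 2 * doubling_const"

lemma ratio_const_pos: "ratio_const > 0"
  using doubling_const_ge step_gt_1 by (simp add: ratio_const_def add_nonneg_pos)

text \<open>Iterated steps give the powers; the remaining factor between two consecutive steps is absorbed
by \<open>profile_scale_le\<close>.\<close>

lemma profile_ratio_le:
  assumes r: "r > 0" "1 / radius \<le> r" and s: "s > 0" "1 / radius \<le> s"
  shows "profile s \<le> ratio_const * profile r * growth growth_index (s / r)"
proof -
  have pw: "(step ^ j) powr x = (step powr x) ^ j" for j x
    using step_gt_1 by (simp add: powr_realpow[symmetric] powr_powr mult.commute)
  show ?thesis
  proof (cases "r \<le> s")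
    case True
    define x where "x = s / r"
    have x: "1 \<le> x" using True r by (simp add: x_def)
    obtain j where j: "step ^ j \<le> x" "x < step ^ Suc j" by (rule ex_power_ge_one[OF step_gt_1 x])
    define \<theta> where "\<theta> = x / step ^ j"
    have sp: "0 < step ^ j" using step_gt_1 by simp
    have \<theta>: "1 \<le> \<theta>" "\<theta> \<le> step" using j sp by (auto simp: \<theta>_def field_simps)
    have s_eq: "s = \<theta> * (step ^ j * r)" using sp r step_gt_1 by (simp add: \<theta>_def x_def)
    have t2: "max 1 (\<theta>\<^sup>2) \<le> step\<^sup>2" using \<theta> step_gt_1 by (auto intro: power_mono one_le_power)
    have "profile s \<le> doubling_const * max 1 (\<theta>\<^sup>2) * profile (step ^ j * r)"
      unfolding s_eq using \<theta> sp r by (intro profile_scale_le) auto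
    also have "\<dots> \<le> doubling_const * step\<^sup>2 * ((step\<^sup>2 / 2) ^ j * profile r)"
      using t2 doubling_const_ge profile_step_upper[OF r] profile_nonneg by (intro mult_mono) auto
    also have "(step\<^sup>2 / 2) ^ j = (step ^ j) powr (2 - growth_index)"
      using step_gt_1 growth_index by (simp add: pw powr_diff power_divide)
    also have "doubling_const * step\<^sup>2 * ((step ^ j) powr (2 - growth_index) * profile r)
        \<le> doubling_const * step\<^sup>2 * (growth growth_index x * profile r)"
    proof -
      have "(step ^ j) powr (2 - growth_index) \<le> x powr (2 - growth_index)"
        using j sp growth_index by (intro powr_mono2) auto
      also have "\<dots> \<le> growth growth_index x" by (simp add: growth_def)
      finally show ?thesis using doubling_const_ge profile_nonneg by (intro mult_left_mono mult_right_mono) auto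
    qed
    also have "\<dots> \<le> ratio_const * (growth growth_index x * profile r)"
      using doubling_const_ge profile_nonneg growth_nonneg
      by (intro mult_right_mono) (auto simp: ratio_const_def)
    finally show ?thesis by (simp add: x_def mult_ac)
  next
    case False
    define x where "x = r / s"
    have x: "1 \<le> x" using False s by (simp add: x_def)
    obtain j where j: "step ^ j \<le> x" "x < step ^ Suc j" by (rule ex_power_ge_one[OF step_gt_1 x])
    have sp: "0 < step ^ j" using step_gt_1 by simp
    have "2 ^ j * profile s \<le> profile (step ^ j * s)" by (rule profile_step_lower[OF s])
    also have "\<dots> \<le> doubling_const * profile r"
      using j(1) s sp by (intro profile_mono_up_to_const) (auto simp: x_def le_divide_eq)
    finally have "profile s \<le> doubling_const * profile r * (1 / 2 ^ j)"
      by (simp add: le_divide_eq mult.commute)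
    also have "1 / 2 ^ j = (step ^ j) powr - growth_index"
      using step_gt_1 growth_index by (simp add: pw powr_minus power_inverse divide_inverse)
    also have "doubling_const * profile r * (step ^ j) powr - growth_index
        \<le> doubling_const * profile r * (2 * (s / r) powr growth_index)"
    proof (intro mult_left_mono)
      have "(step ^ j) powr - growth_index \<le> (x / step) powr - growth_index"
        using j(2) x step_gt_1 growth_index by (intro powr_mono2') (auto simp: divide_le_eq mult.commute)
      also have "\<dots> = 2 * (s / r) powr growth_index"
        using x step_gt_1 growth_index s r by (simp add: powr_minus powr_divide x_def powr_mult)
      finally show "(step ^ j) powr - growth_index \<le> 2 * (s / r) powr growth_index" .
    qed (use doubling_const_ge profile_nonneg in auto)
    also have "\<dots> \<le> doubling_const * profile r * (2 * growth growth_index (s / r))"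
      using doubling_const_ge profile_nonneg by (intro mult_left_mono) (auto simp: growth_def)
    also have "\<dots> = 2 * doubling_const * (profile r * growth growth_index (s / r))" by simp
    also have "\<dots> \<le> ratio_const * (profile r * growth growth_index (s / r))"
      using doubling_const_ge profile_nonneg growth_nonneg
      by (intro mult_right_mono) (auto simp: ratio_const_def)
    finally show ?thesis by (simp add: mult_ac)
  qed
qed

end

section \<open>Scaling limits of the exponent\<close>

context asymptotic_density
begin

sublocale cosine_growth "axis_vector :: 'a" c growth_index ratio_const
  by unfold_locales (use c_pos growth_index ratio_const_pos in auto)

definition cutoff :: real where "cutoff = 2 / radius"

lemma cutoff: "cutoff > 0" "1 / radius \<le> cutoff" "s \<ge> cutoff \<Longrightarrow> 1 / s < radius"
proof -
  show 0: "cutoff > 0" "1 / radius \<le> cutoff" using radius(1) by (auto simp: cutoff_def divide_right_mono)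
  assume "s \<ge> cutoff"
  then have "1 / s \<le> 1 / cutoff" using 0 by (intro divide_left_mono) auto
  also have "\<dots> < radius" using radius(1) by (simp add: cutoff_def)
  finally show "1 / s < radius" .
qed

lemma profile_ratio_le_cutoff:
  assumes "cutoff \<le> r" "cutoff \<le> s"
  shows "profile s \<le> ratio_const * profile r * growth growth_index (s / r)"
  using assms cutoff by (intro profile_ratio_le) auto

text \<open>The Levy density as a function of $s = 1/|x|$, normalized so that by the assumed asymptotics it is
equivalent to $\psi(s)$ at infinity.\<close>

definition density_profile :: "real \<Rightarrow> real" where
  "density_profile s = \<nu> ((1 / s) *\<^sub>R axis_vector) / (c * s ^ DIM('a))"

lemma density_profile_measurable [measurable]: "density_profile \<in> borel_measurable borel"
  unfolding density_profile_def[abs_def] by measurable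

lemma nu_eq_density_profile:
  assumes "x \<noteq> 0"
  shows "\<nu> x = c * inverse (norm x) ^ DIM('a) * density_profile (1 / norm x)"
proof -
  have "\<nu> x = \<nu> (norm x *\<^sub>R axis_vector)"
    by (rule isotropic_unimodal_density_cong_norm[OF density assms]) simp
  moreover define s where "s = 1 / norm x"
  moreover have "s \<noteq> 0" "1 / s = norm x" "inverse (norm x) = s"
    using assms by (simp_all add: s_def inverse_eq_divide)
  ultimately show ?thesis using c_pos by (simp add: density_profile_def)
qed

lemma density_profile_nonneg:
  assumes "s > 0"
  shows "0 \<le> density_profile s"
proof -
  have "(1 / s) *\<^sub>R axis_vector \<noteq> (0 :: 'a)" using assms axis_vector_in_Basis[where 'a='a] by auto
  then show ?thesis
    using assms c_pos isotropic_unimodal_density_nonneg[OF density] by (simp add: density_profile_def)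
qed

lemma density_profile_le:
  assumes "cutoff \<le> s"
  shows "density_profile s \<le> 2 * profile s"
proof -
  define x :: 'a where "x = (1 / s) *\<^sub>R axis_vector"
  have s: "s > 0" using assms cutoff by auto
  then have nx: "norm x = 1 / s" "x \<noteq> 0" using axis_vector_in_Basis[where 'a='a] by (auto simp: x_def)
  have "\<nu> x \<le> 2 * c * inverse (norm x) ^ DIM('a) * profile (inverse (norm x))"
    using nx s cutoff(3)[OF assms] by (intro density_bounds) auto
  then have "\<nu> x \<le> (2 * profile s) * (c * s ^ DIM('a))" using nx s by (simp add: mult_ac)
  then show ?thesis using s c_pos by (simp add: density_profile_def x_def[symmetric] divide_le_eq)
qed

lemma density_profile_asymp: "((\<lambda>s. density_profile s / profile s) \<longlongrightarrow> 1) at_top"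
proof -
  \<comment> \<open>The assumed asymptotics are evaluated along the ray through the axis vector.\<close>
  have 1: "filterlim (\<lambda>s. (1 / s) *\<^sub>R axis_vector :: 'a) (at 0) at_top"
  proof (rule filterlim_atI)
    have "((\<lambda>s::real. 1 / s) \<longlongrightarrow> 0) at_top"
      by (intro tendsto_divide_0[OF tendsto_const] filterlim_at_top_imp_at_infinity filterlim_ident)
    then have "((\<lambda>s::real. (1 / s) *\<^sub>R axis_vector :: 'a) \<longlongrightarrow> 0 *\<^sub>R axis_vector) at_top"
      by (intro tendsto_scaleR tendsto_const)
    then show "((\<lambda>s. (1 / s) *\<^sub>R axis_vector :: 'a) \<longlongrightarrow> 0) at_top" by simp
    show "\<forall>\<^sub>F s in at_top. (1 / s) *\<^sub>R axis_vector \<noteq> (0 :: 'a)"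
      using eventually_gt_at_top[of 0] by eventually_elim (use axis_vector_in_Basis[where 'a='a] in auto)
  qed
  have 2: "((\<lambda>s. \<nu> ((1 / s) *\<^sub>R axis_vector) /
      (inverse (norm ((1 / s) *\<^sub>R axis_vector :: 'a)) ^ DIM('a) * profile (inverse (norm ((1 / s) *\<^sub>R axis_vector :: 'a)))) / c) \<longlongrightarrow> c / c) at_top"
    by (intro tendsto_divide filterlim_compose[OF density_asymp 1] tendsto_const) (use c_pos in auto)
  have "((\<lambda>s. density_profile s / profile s) \<longlongrightarrow> c / c) at_top"
  proof (rule Lim_transform_eventually[OF 2])
    show "\<forall>\<^sub>F s in at_top. \<nu> ((1 / s) *\<^sub>R axis_vector) /
      (inverse (norm ((1 / s) *\<^sub>R axis_vector :: 'a)) ^ DIM('a) * profile (inverse (norm ((1 / s) *\<^sub>R axis_vector :: 'a)))) / c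
      = density_profile s / profile s"
      using eventually_gt_at_top[of 0] by eventually_elim (simp add: density_profile_def mult_ac)
  qed
  then show ?thesis using c_pos by simp
qed

text \<open>The Levy-Khintchine integral over the ball of radius \<open>1 / cutoff\<close> is, after the dilation
by $a$, the transform of the normalized density, cut off at small arguments.\<close>

lemma cosine_transform_density_profile:
  assumes a: "a > 0" and b: "b > 0"
  shows "c * cosine_transform (\<lambda>s. if cutoff \<le> s * b then density_profile (s * b) else 0) (a / b)
     = (\<integral>x. (1 - cos (a * (x \<bullet> axis_vector))) * indicator (cball 0 (1 / cutoff)) x \<partial>N)"
proof -
  define F where "F x = (1 - cos (a * (x \<bullet> axis_vector))) *
    (if cutoff \<le> 1 / norm x then density_profile (1 / norm x) else 0)" for x :: 'a
  have [measurable]: "F \<in> borel_measurable borel" unfolding F_def[abs_def] by measurable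
  have [measurable]: "cball 0 (1 / cutoff) \<in> sets (borel :: 'a measure)" by simp
  have F0: "0 \<le> F x" for x
    by (cases "x = 0") (auto simp: F_def intro!: mult_nonneg_nonneg density_profile_nonneg)
  have "cosine_transform (\<lambda>s. if cutoff \<le> s * b then density_profile (s * b) else 0) (a / b) = (\<integral>z. F ((1 / a) *\<^sub>R z) \<partial>dilation_measure)"
    unfolding cosine_transform_def
  proof (rule Bochner_Integration.integral_cong[OF refl])
    fix z :: 'a
    have "a / b / norm z * b = 1 / norm ((1 / a) *\<^sub>R z)" using a b by simp
    then show "(1 - cos (z \<bullet> axis_vector)) * (if cutoff \<le> a / b / norm z * b then density_profile (a / b / norm z * b) else 0)
        = F ((1 / a) *\<^sub>R z)" using a by (simp add: F_def)
  qed
  also have "\<dots> = (\<integral>x. F x \<partial>dilation_measure)"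
    using a by (intro integral_dilation_measure_scaleR) auto
  also have "\<dots> = enn2real (\<integral>\<^sup>+x. ennreal (F x) \<partial>dilation_measure)"
    using F0 by (intro integral_eq_nn_integral) auto
  finally have TF: "cosine_transform (\<lambda>s. if cutoff \<le> s * b then density_profile (s * b) else 0) (a / b)
      = enn2real (\<integral>\<^sup>+x. ennreal (F x) \<partial>dilation_measure)" .
  have "ennreal c * (\<integral>\<^sup>+x. ennreal (F x) \<partial>dilation_measure)
      = (\<integral>\<^sup>+x. ennreal c * (ennreal (inverse (norm x) ^ DIM('a)) * ennreal (F x)) \<partial>lborel)"
    by (subst nn_integral_dilation_measure) (auto simp: nn_integral_cmult)
  also have "\<dots> = (\<integral>\<^sup>+x. ennreal (\<nu> x) * ennreal ((1 - cos (a * (x \<bullet> axis_vector))) * indicator (cball 0 (1 / cutoff)) x) \<partial>lborel)"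
  proof (intro nn_integral_cong)
    fix x :: 'a
    show "ennreal c * (ennreal (inverse (norm x) ^ DIM('a)) * ennreal (F x))
        = ennreal (\<nu> x) * ennreal ((1 - cos (a * (x \<bullet> axis_vector))) * indicator (cball 0 (1 / cutoff)) x)"
    proof (cases "x = 0")
      case False
      have nx: "0 < norm x" using False by simp
      have iff: "cutoff \<le> 1 / norm x \<longleftrightarrow> x \<in> cball 0 (1 / cutoff)"
        using nx cutoff(1) by (simp add: field_simps)
      have "ennreal c * (ennreal (inverse (norm x) ^ DIM('a)) * ennreal (F x)) = ennreal (c * (inverse (norm x) ^ DIM('a) * F x))"
        using c_pos F0 by (simp add: ennreal_mult)
      also have "c * (inverse (norm x) ^ DIM('a) * F x) = \<nu> x * ((1 - cos (a * (x \<bullet> axis_vector))) * indicator (cball 0 (1 / cutoff)) x)"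
        using nu_eq_density_profile[OF False] iff by (simp add: F_def indicator_def)
      also have "ennreal \<dots> = ennreal (\<nu> x) * ennreal ((1 - cos (a * (x \<bullet> axis_vector))) * indicator (cball 0 (1 / cutoff)) x)"
        using isotropic_unimodal_density_nonneg[OF density False] by (intro ennreal_mult) auto
      finally show ?thesis .
    qed (simp add: F_def)
  qed
  also have "\<dots> = (\<integral>\<^sup>+x. ennreal ((1 - cos (a * (x \<bullet> axis_vector))) * indicator (cball 0 (1 / cutoff)) x) \<partial>N)"
    by (rule nn_integral_N[symmetric]) simp
  finally have "enn2real (ennreal c * (\<integral>\<^sup>+x. ennreal (F x) \<partial>dilation_measure))
      = enn2real (\<integral>\<^sup>+x. ennreal ((1 - cos (a * (x \<bullet> axis_vector))) * indicator (cball 0 (1 / cutoff)) x) \<partial>N)" by simp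
  also have "\<dots> = (\<integral>x. (1 - cos (a * (x \<bullet> axis_vector))) * indicator (cball 0 (1 / cutoff)) x \<partial>N)"
  proof (rule integral_eq_nn_integral[symmetric])
    have "(\<lambda>x::'a. (1 - cos (a * (x \<bullet> axis_vector))) * indicator (cball 0 (1 / cutoff)) x :: real) \<in> borel_measurable borel"
      by (intro borel_measurable_times borel_measurable_indicator) simp_all
    then show "(\<lambda>x::'a. (1 - cos (a * (x \<bullet> axis_vector))) * indicator (cball 0 (1 / cutoff)) x :: real) \<in> borel_measurable N"
      by (simp cong: measurable_cong_sets add: sets_N)
  qed auto
  finally show ?thesis unfolding TF using c_pos by (simp add: enn2real_mult)
qed

definition tail_mass :: real where
  "tail_mass = (\<integral>x. 2 * indicator (- cball 0 (1 / cutoff)) x \<partial>N)"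

lemma integrable_tail: "integrable N (\<lambda>x. indicator (- cball 0 (1 / cutoff)) x :: real)"
proof (rule Bochner_Integration.integrable_bound)
  show "integrable N (\<lambda>x. min 1 (cutoff\<^sup>2 * (norm x)\<^sup>2))" by (rule integrable_scaled_min_N)
  show "AE x in N. norm (indicator (- cball 0 (1 / cutoff)) x :: real) \<le> norm (min 1 (cutoff\<^sup>2 * (norm x)\<^sup>2))"
  proof (intro always_eventually allI)
    fix x :: 'a
    show "norm (indicator (- cball 0 (1 / cutoff)) x :: real) \<le> norm (min 1 (cutoff\<^sup>2 * (norm x)\<^sup>2))"
    proof (cases "x \<in> cball 0 (1 / cutoff)")
      case False
      then have "1 \<le> cutoff * norm x" using cutoff(1) by (simp add: field_simps)
      then have "1 \<le> (cutoff * norm x)\<^sup>2" by (rule one_le_power)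
      then show ?thesis using False by (simp add: power_mult_distrib)
    qed simp
  qed
qed auto

lemma profile_minus_core:
  "\<bar>profile a - (\<integral>x. (1 - cos (a * (x \<bullet> axis_vector))) * indicator (cball 0 (1 / cutoff)) x \<partial>N)\<bar> \<le> tail_mass"
proof -
  let ?h = "\<lambda>x. 1 - cos (a * (x \<bullet> axis_vector))"
  have i: "integrable N ?h" using integrable_one_minus_cos_N[of "a *\<^sub>R axis_vector"] by (simp add: inner_commute)
  have ii: "integrable N (\<lambda>x. ?h x * indicator S x)" if "S \<in> sets borel" for S
    using integrable_mult_indicator[OF _ i, of S] that sets_N by (simp add: mult.commute)
  have p: "profile a = (\<integral>x. ?h x \<partial>N)"
    using psi_eq[of "a *\<^sub>R axis_vector"] by (simp add: radial_profile_axis_vector eta_zero inner_commute)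
  have "profile a - (\<integral>x. ?h x * indicator (cball 0 (1 / cutoff)) x \<partial>N)
      = (\<integral>x. ?h x * indicator (- cball 0 (1 / cutoff)) x \<partial>N)"
  proof -
    have "profile a - (\<integral>x. ?h x * indicator (cball 0 (1 / cutoff)) x \<partial>N)
        = (\<integral>x. ?h x - ?h x * indicator (cball 0 (1 / cutoff)) x \<partial>N)"
      unfolding p by (intro Bochner_Integration.integral_diff[symmetric] i ii) simp
    also have "\<dots> = (\<integral>x. ?h x * indicator (- cball 0 (1 / cutoff)) x \<partial>N)"
      by (intro Bochner_Integration.integral_cong) (auto simp: indicator_def)
    finally show ?thesis .
  qed
  also have "\<bar>\<dots>\<bar> \<le> tail_mass"
    unfolding tail_mass_def
  proof (rule integral_abs_bound_integral)
    show "integrable N (\<lambda>x. ?h x * indicator (- cball 0 (1 / cutoff)) x)" by (rule ii) simp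
    show "integrable N (\<lambda>x. 2 * indicator (- cball 0 (1 / cutoff)) x :: real)" using integrable_tail by simp
    fix x :: 'a
    have "1 - cos (a * (x \<bullet> axis_vector)) \<le> 2" using cos_ge_minus_one[of "a * (x \<bullet> axis_vector)"] by linarith
    then show "\<bar>?h x * indicator (- cball 0 (1 / cutoff)) x\<bar> \<le> 2 * indicator (- cball 0 (1 / cutoff)) x"
      by (simp add: indicator_def)
  qed
  finally show ?thesis .
qed

text \<open>The ratio bound between \<open>cutoff\<close> and $r$ shows that $\psi$ is unbounded.\<close>

lemma inverse_profile_tendsto: "((\<lambda>r. 1 / profile r) \<longlongrightarrow> 0) at_top"
proof (rule tendsto_sandwich[of "\<lambda>_. 0" _ _ "\<lambda>r. ratio_const / profile cutoff * growth growth_index (cutoff / r)"])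
  have pc: "profile cutoff > 0" by (rule profile_positive[OF cutoff(1)])
  show "\<forall>\<^sub>F r in at_top. 1 / profile r \<le> ratio_const / profile cutoff * growth growth_index (cutoff / r)"
    using eventually_ge_at_top[of cutoff]
  proof eventually_elim
    case (elim r)
    have "profile r > 0" using elim cutoff(1) by (intro profile_positive) auto
    then show ?case using profile_ratio_le_cutoff[OF elim order_refl] pc by (simp add: field_simps)
  qed
  have "((\<lambda>r. cutoff / r) \<longlongrightarrow> 0) at_top"
    by (intro tendsto_divide_0[OF tendsto_const] filterlim_at_top_imp_at_infinity filterlim_ident)
  then have "((\<lambda>r. growth growth_index (cutoff / r)) \<longlongrightarrow> 0 + 0) at_top"
    unfolding growth_def using growth_index cutoff(1)
    by (intro tendsto_add tendsto_zero_powrI[OF _ tendsto_const])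
      (auto intro: eventually_mono[OF eventually_gt_at_top[of 0]])
  from tendsto_mult_left[OF this, of "ratio_const / profile cutoff"]
  show "((\<lambda>r. ratio_const / profile cutoff * growth growth_index (cutoff / r)) \<longlongrightarrow> 0) at_top" by simp
  show "\<forall>\<^sub>F r in at_top. 0 \<le> 1 / profile r" by (simp add: profile_nonneg)
qed simp

text \<open>The rescaled exponents are approximate solutions: replacing $\psi$ by the normalized density costs a relative
error that tends to $0$, and cutting the density off costs at most the mass of a tail of
$N$, which is negligible because $\psi$ is unbounded.\<close>

lemma ex_scaling_limit_cutoff:
  assumes r: "filterlim r at_top sequentially" and rc: "\<And>n. cutoff \<le> r n"
  shows "\<exists>k g. strict_mono (k :: nat \<Rightarrow> nat) \<and> g \<in> G \<and> scaling_limit profile (r \<circ> k) g"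
proof -
  have rpos: "r n > 0" for n using rc[of n] cutoff(1) by linarith
  have prpos: "profile (r n) > 0" for n by (rule profile_positive[OF rpos])
  define f where "f n l = profile (l * r n) / profile (r n)" for n l
  define v where "v n l = (if cutoff \<le> l * r n then density_profile (l * r n) else 0) / profile (r n)" for n l
  define err where "err n = tail_mass / profile (r n)" for n
  have flarge: "\<forall>\<^sub>F n in sequentially. cutoff \<le> l * r n" if l: "l > 0" for l
  proof -
    have "\<forall>\<^sub>F n in sequentially. cutoff / l \<le> r n" using r unfolding filterlim_at_top by blast
    then show ?thesis by eventually_elim (use l in \<open>simp add: divide_le_eq mult.commute\<close>)
  qed
  have fle: "f n l \<le> ratio_const * growth growth_index l" if l: "l > 0" "cutoff \<le> l * r n" for n l
  proof -
    have "profile (l * r n) \<le> ratio_const * profile (r n) * growth growth_index (l * r n / r n)"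
      by (rule profile_ratio_le_cutoff[OF rc l(2)])
    then show ?thesis using prpos[of n] rpos[of n] by (simp add: f_def divide_le_eq mult_ac)
  qed
  have f0: "0 \<le> f n l" for n l using profile_nonneg by (simp add: f_def)
  obtain k g where k: "strict_mono (k :: nat \<Rightarrow> nat)" and cont: "continuous_on {0<..} g"
    and lim: "\<And>s l. l > 0 \<Longrightarrow> s \<longlonglongrightarrow> l \<Longrightarrow> (\<lambda>n. f (k n) (s n)) \<longlonglongrightarrow> g l"
    and eq: "\<And>l. l > 0 \<Longrightarrow> g l = c * cosine_transform g l"
  proof (rule approximate_solutions_compact[of growth_index "2 * ratio_const" err v f])
    show "0 < growth_index" "growth_index < 2" "0 \<le> 2 * ratio_const" using growth_index ratio_const_pos by auto
    have "(\<lambda>n. tail_mass * (1 / profile (r n))) \<longlonglongrightarrow> tail_mass * 0"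
      by (intro tendsto_mult tendsto_const filterlim_compose[OF inverse_profile_tendsto r])
    then show "err \<longlonglongrightarrow> 0" by (simp add: err_def[abs_def])
    show "(\<lambda>x. indicator {0<..} x * v n x) \<in> borel_measurable borel" for n
      unfolding v_def by measurable
    show "\<bar>v n x\<bar> \<le> 2 * ratio_const * growth growth_index x" if x: "x > 0" for n x
    proof (cases "cutoff \<le> x * r n")
      case True
      have "v n x \<le> 2 * f n x"
        using density_profile_le[OF True] True prpos[of n] by (simp add: v_def f_def divide_right_mono)
      also have "\<dots> \<le> 2 * (ratio_const * growth growth_index x)" using fle[OF x True] by simp
      finally have "v n x \<le> 2 * ratio_const * growth growth_index x" by simp
      moreover have "0 \<le> v n x" using prpos[of n] rpos[of n] x by (auto simp: v_def intro!: divide_nonneg_pos density_profile_nonneg)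
      ultimately show ?thesis by simp
    next
      case False
      then show ?thesis using ratio_const_pos growth_nonneg[of growth_index x] by (simp add: v_def)
    qed
    show "\<bar>f n l - c * cosine_transform (v n) l\<bar> \<le> err n" if l: "l > 0" for n l
    proof -
      have "cosine_transform (v n) l = cosine_transform (\<lambda>s. if cutoff \<le> s * r n then density_profile (s * r n) else 0) l / profile (r n)"
        unfolding cosine_transform_def v_def by (simp only: times_divide_eq_right Bochner_Integration.integral_divide_zero)
      moreover have "l = (l * r n) / r n" using rpos[of n] by simp
      ultimately have "c * cosine_transform (v n) l = (\<integral>x. (1 - cos ((l * r n) * (x \<bullet> axis_vector))) * indicator (cball 0 (1 / cutoff)) x \<partial>N) / profile (r n)"
        using cosine_transform_density_profile[of "l * r n" "r n"] l rpos[of n] by simp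
      then have "f n l - c * cosine_transform (v n) l = (profile (l * r n) - (\<integral>x. (1 - cos ((l * r n) * (x \<bullet> axis_vector))) * indicator (cball 0 (1 / cutoff)) x \<partial>N)) / profile (r n)"
        by (simp add: f_def diff_divide_distrib)
      then show ?thesis using profile_minus_core[of "l * r n"] prpos[of n]
        by (simp add: err_def abs_divide divide_right_mono)
    qed
    show "(\<lambda>n. v n l - f n l) \<longlonglongrightarrow> 0" if l: "l > 0" for l
    proof -
      have lr: "filterlim (\<lambda>n. l * r n) at_top sequentially"
        using r l by (simp add: filterlim_tendsto_pos_mult_at_top[OF tendsto_const])
      have "(\<lambda>n. density_profile (l * r n) / profile (l * r n) - 1) \<longlonglongrightarrow> 1 - 1"
        by (intro tendsto_diff tendsto_const filterlim_compose[OF density_profile_asymp lr])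
      then have "(\<lambda>n. ratio_const * growth growth_index l * \<bar>density_profile (l * r n) / profile (l * r n) - 1\<bar>) \<longlonglongrightarrow> ratio_const * growth growth_index l * \<bar>0\<bar>"
        by (intro tendsto_mult tendsto_const tendsto_rabs) simp
      then have z: "(\<lambda>n. ratio_const * growth growth_index l * \<bar>density_profile (l * r n) / profile (l * r n) - 1\<bar>) \<longlonglongrightarrow> 0" by simp
      show ?thesis
      proof (rule Lim_null_comparison[OF _ z])
        show "\<forall>\<^sub>F n in sequentially. norm (v n l - f n l) \<le> ratio_const * growth growth_index l * \<bar>density_profile (l * r n) / profile (l * r n) - 1\<bar>"
          using flarge[OF l]
        proof eventually_elim
          case (elim n)
          have pl: "profile (l * r n) > 0" using l rpos[of n] by (intro profile_positive) simp
          have "v n l - f n l = f n l * (density_profile (l * r n) / profile (l * r n) - 1)"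
            using elim pl by (simp add: v_def f_def right_diff_distrib)
          then have "norm (v n l - f n l) = f n l * \<bar>density_profile (l * r n) / profile (l * r n) - 1\<bar>"
            using f0[of n l] by (simp add: abs_mult)
          also have "\<dots> \<le> ratio_const * growth growth_index l * \<bar>density_profile (l * r n) / profile (l * r n) - 1\<bar>"
            using fle[OF l elim] by (intro mult_right_mono) auto
          finally show ?case .
        qed
      qed
    qed
  qed (rule that)
  have "g l \<le> ratio_const * g m * growth growth_index (l / m)" if l: "l > 0" and m: "m > 0" for l m
  proof (rule tendsto_le[OF sequentially_bot])
    show "(\<lambda>n. ratio_const * f (k n) m * growth growth_index (l / m)) \<longlonglongrightarrow> ratio_const * g m * growth growth_index (l / m)"
      by (intro tendsto_intros lim m)
    show "(\<lambda>n. f (k n) l) \<longlonglongrightarrow> g l" by (intro lim l tendsto_const)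
    have "\<forall>\<^sub>F n in sequentially. cutoff \<le> l * r (k n) \<and> cutoff \<le> m * r (k n)"
      using eventually_subseq[OF k, of "\<lambda>n. cutoff \<le> l * r n \<and> cutoff \<le> m * r n"]
        eventually_conj[OF flarge[OF l] flarge[OF m]] by blast
    then show "\<forall>\<^sub>F n in sequentially. f (k n) l \<le> ratio_const * f (k n) m * growth growth_index (l / m)"
    proof eventually_elim
      case (elim n)
      have "profile (l * r (k n)) \<le> ratio_const * profile (m * r (k n)) * growth growth_index (l * r (k n) / (m * r (k n)))"
        using elim by (intro profile_ratio_le_cutoff) auto
      then show ?case using prpos[of "k n"] rpos[of "k n"] by (simp add: f_def divide_right_mono)
    qed
  qed
  moreover have "g 1 = 1"
  proof (rule LIMSEQ_unique[OF lim[OF zero_less_one tendsto_const]])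
    show "(\<lambda>n. f (k n) 1) \<longlonglongrightarrow> 1" using prpos by (simp add: f_def less_imp_neq[symmetric])
  qed
  ultimately have "g \<in> G" using cont eq by (simp add: positive_solutions_def)
  moreover have "scaling_limit profile (r \<circ> k) g"
    unfolding scaling_limit_def using lim by (simp add: f_def)
  ultimately show ?thesis using k by blast
qed

lemma ex_scaling_limit:
  assumes r: "filterlim r at_top sequentially"
  shows "\<exists>k g. strict_mono (k :: nat \<Rightarrow> nat) \<and> g \<in> G \<and> scaling_limit profile (r \<circ> k) g"
proof -
  have "\<forall>\<^sub>F n in sequentially. cutoff \<le> r n" using r unfolding filterlim_at_top by blast
  then obtain n0 where n0: "\<And>n. n \<ge> n0 \<Longrightarrow> cutoff \<le> r n" by (auto simp: eventually_sequentially)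
  have "filterlim (\<lambda>n. r (n + n0)) at_top sequentially"
    by (rule filterlim_compose[OF r]) (rule filterlim_add_const_nat_at_top)
  then obtain k g where k: "strict_mono (k :: nat \<Rightarrow> nat)" and g: "g \<in> G"
    and sl: "scaling_limit profile ((\<lambda>n. r (n + n0)) \<circ> k) g"
    using ex_scaling_limit_cutoff[of "\<lambda>n. r (n + n0)"] n0 by auto
  have "strict_mono (\<lambda>n. k n + n0)" using k by (simp add: strict_mono_def)
  moreover have "scaling_limit profile (r \<circ> (\<lambda>n. k n + n0)) g" using sl by (simp add: comp_def)
  ultimately show ?thesis using g by blast
qed

theorem regularly_varying_profile: "\<exists>\<alpha>. 0 < \<alpha> \<and> \<alpha> < 2 \<and> regularly_varying \<alpha> profile"
proof -
  have "G \<noteq> {}" using ex_scaling_limit[OF filterlim_real_sequentially] by blast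
  then obtain \<rho>1 \<rho>2 where \<rho>: "0 < \<rho>1" "\<rho>1 \<le> \<rho>2" "\<rho>2 < 2"
    and mix: "\<And>g. g \<in> G \<Longrightarrow> \<exists>a. 0 \<le> a \<and> a \<le> 1 \<and> (\<forall>l>0. g l = (1 - a) * l powr \<rho>1 + a * l powr \<rho>2)"
    by (rule positive_solutions_eq_powr_mixture) (rule that)
  have "regularly_varying \<rho>1 profile \<or> regularly_varying \<rho>2 profile"
  proof (rule regularly_varying_if_mixture_limits[OF profile_positive \<rho>(2)])
    fix r :: "nat \<Rightarrow> real" assume "filterlim r at_top sequentially"
    from ex_scaling_limit[OF this] obtain k g where k: "strict_mono (k :: nat \<Rightarrow> nat)" and g: "g \<in> G"
      and sl: "scaling_limit profile (r \<circ> k) g" by blast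
    obtain a where a: "0 \<le> a" "a \<le> 1" "\<And>l. l > 0 \<Longrightarrow> g l = mixture \<rho>1 \<rho>2 a l"
      using mix[OF g] by (auto simp: mixture_def)
    have "scaling_limit profile (r \<circ> k) (mixture \<rho>1 \<rho>2 a)"
      using sl a(3) by (simp add: scaling_limit_def)
    then show "\<exists>k a. strict_mono k \<and> 0 \<le> a \<and> a \<le> 1 \<and> scaling_limit profile (r \<circ> k) (mixture \<rho>1 \<rho>2 a)"
      using k a by blast
  qed
  then show ?thesis using \<rho> by (auto intro: exI[of _ \<rho>1] exI[of _ \<rho>2])
qed

end

section \<open>The three equivalent conditions\<close>

theorem theorem6:
  fixes M :: "'s measure"
    and X :: "real \<Rightarrow> 's \<Rightarrow> 'a::euclidean_space"
    and \<psi> :: "'a \<Rightarrow> real"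
    and \<eta> :: real
    and N :: "'a measure"
    and p :: "real \<Rightarrow> 'a \<Rightarrow> real"
    and \<nu> :: "'a \<Rightarrow> real"
  assumes "isotropic_unimodal_levy_process M X"
    and "characteristic_exponent M X \<psi>"
    and "isotropic_levy_khintchine \<psi> \<eta> N"
    and "\<And>t. t > 0 \<Longrightarrow> isotropic_unimodal_density (distr M borel (X t)) (p t)"
    and "isotropic_unimodal_density N \<nu>"
  shows
    "((\<exists>\<alpha>. 0 < \<alpha> \<and> \<alpha> < 2 \<and> regularly_varying \<alpha> (radial_profile \<psi>))
      \<longleftrightarrow>
      (\<exists>c>0. \<forall>\<epsilon>>0. \<exists>\<delta>>0. \<forall>t>0. \<forall>x.
          0 < norm x \<and> norm x \<le> \<delta> \<and> t * radial_profile \<psi> (inverse (norm x)) \<le> \<delta> \<longrightarrow>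
          \<bar>p t x / (inverse (norm x) ^ DIM('a) * t * radial_profile \<psi> (inverse (norm x))) - c\<bar> \<le> \<epsilon>))
     \<and>
     ((\<exists>c>0. \<forall>\<epsilon>>0. \<exists>\<delta>>0. \<forall>t>0. \<forall>x.
          0 < norm x \<and> norm x \<le> \<delta> \<and> t * radial_profile \<psi> (inverse (norm x)) \<le> \<delta> \<longrightarrow>
          \<bar>p t x / (inverse (norm x) ^ DIM('a) * t * radial_profile \<psi> (inverse (norm x))) - c\<bar> \<le> \<epsilon>)
      \<longleftrightarrow>
      (\<exists>c>0. ((\<lambda>x. \<nu> x / (inverse (norm x) ^ DIM('a) * radial_profile \<psi> (inverse (norm x))))
               \<longlongrightarrow> c) (at 0)))"
proof -
  have levy: "prob_space M" "\<And>t. t \<ge> 0 \<Longrightarrow> X t \<in> borel_measurable M"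
    using assms(1) by (auto simp: isotropic_unimodal_levy_process_def isotropic_levy_process_def levy_process_def)
  interpret unimodal_semigroup \<psi> \<eta> N \<nu> "\<lambda>t. distr M borel (X t)" p
  proof (intro unimodal_semigroup.intro unimodal_exponent.intro unimodal_semigroup_axioms.intro)
    fix t :: real assume t: "t > 0"
    show pr: "prob_space (distr M borel (X t))"
      using levy t by (intro prob_space.prob_space_distr) auto
    show "isotropic_unimodal_density (distr M borel (X t)) (p t)" by (rule assms(4)[OF t])
    fix \<xi> :: 'a
    have "(\<integral>x. cos (\<xi> \<bullet> x) \<partial>distr M borel (X t)) = Re (exp (complex_of_real (- t * \<psi> \<xi>)))"
      using assms(2) t by (subst integral_cos_eq_Re[OF pr]) (auto simp: characteristic_exponent_def)
    then show "(\<integral>x. cos (\<xi> \<bullet> x) \<partial>distr M borel (X t)) = exp (- t * \<psi> \<xi>)"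
      by (simp only: exp_of_real Re_complex_of_real)
  qed (simp_all add: assms(3,5))
  let ?i = "\<exists>\<alpha>. 0 < \<alpha> \<and> \<alpha> < 2 \<and> regularly_varying \<alpha> (radial_profile \<psi>)"
  let ?ii = "\<exists>c>0. \<forall>\<epsilon>>0. \<exists>\<delta>>0. \<forall>t>0. \<forall>x.
          0 < norm x \<and> norm x \<le> \<delta> \<and> t * radial_profile \<psi> (inverse (norm x)) \<le> \<delta> \<longrightarrow>
          \<bar>p t x / (inverse (norm x) ^ DIM('a) * t * radial_profile \<psi> (inverse (norm x))) - c\<bar> \<le> \<epsilon>"
  let ?iii = "\<exists>c>0. ((\<lambda>x. \<nu> x / (inverse (norm x) ^ DIM('a) * radial_profile \<psi> (inverse (norm x))))
               \<longlongrightarrow> c) (at 0)"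
  have "?i \<Longrightarrow> ?ii"
  proof (elim exE conjE)
    fix \<alpha> :: real assume \<alpha>: "0 < \<alpha>" "\<alpha> < 2" and rv: "regularly_varying \<alpha> (radial_profile \<psi>)"
    show ?ii
      by (rule exI[of _ "limit_const \<alpha>"])
        (intro conjI limit_const_pos[OF \<alpha>] allI impI transition_density_asymptotics[OF \<alpha> rv])
  qed
  moreover have "?ii \<Longrightarrow> ?iii"
  proof (elim exE conjE)
    fix c assume "0 < c" and "\<forall>\<epsilon>>0. \<exists>\<delta>>0. \<forall>t>0. \<forall>x.
          0 < norm x \<and> norm x \<le> \<delta> \<and> t * radial_profile \<psi> (inverse (norm x)) \<le> \<delta> \<longrightarrow>
          \<bar>p t x / (inverse (norm x) ^ DIM('a) * t * radial_profile \<psi> (inverse (norm x))) - c\<bar> \<le> \<epsilon>"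
    then have "((\<lambda>x. \<nu> x / (inverse (norm x) ^ DIM('a) * radial_profile \<psi> (inverse (norm x)))) \<longlongrightarrow> c) (at 0)"
      by (intro levy_density_asymptotics) blast+
    then show ?iii using \<open>0 < c\<close> by blast
  qed
  moreover have "?iii \<Longrightarrow> ?i"
  proof (elim exE conjE)
    fix c assume "0 < c" and "((\<lambda>x. \<nu> x / (inverse (norm x) ^ DIM('a) * radial_profile \<psi> (inverse (norm x)))) \<longlongrightarrow> c) (at 0)"
    then interpret asymptotic_density \<psi> \<eta> N \<nu> c by unfold_locales
    show ?i by (rule regularly_varying_profile)
  qed
  ultimately show ?thesis by blast
qed

end
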